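(* Let $\psi:[0,\infty)\to[0,\infty)$ be given by $\psi(r)=(1-r)^2$ if $r\ge\frac12$ and $\psi(r)=\frac83r^3-3r^2+\frac23$ if $r<\frac12$, and let $F:\mathbb R^2\to\mathbb R$, $F(x):=\psi(|x|)$, which is a $C^2$-function; set $f:=\nabla F$. For $(x_1,x_2)\in\mathbb R^2$ let $\mathrm{ort}(x_1,x_2):=(-x_2,x_1)$. Let $\varphi:\mathbb R^2\to[0,1]$ be a rotationally invariant $C^\infty$-function with $\varphi\equiv1$ on $B(0,2)\setminus B(0,\frac23)$ and $\varphi\equiv0$ on $B(0,\frac12)\cup B(0,3)^c$. Let $(W_t)_{t\ge0}$ be a $2$-dimensional Brownian motion with $W_0=0$ and let $(X_t)_{t\ge0}$ be the solution of the SDE $$dX_t=\Bigl(-f(X_t)+\mathrm{ort}(X_t)\,\bigl||X_t|-1\bigr|\Bigr)\,dt+\frac1{t+1}\varphi(X_t)\,dW_t$$ started in a point $x_0\in\mathbb R^2\setminus\{0\}$. Put $\alpha_t:=-f(X_t)+\mathrm{ort}(X_t)\,||X_t|-1|$ and $\beta_t:=\frac1{t+1}\varphi(X_t)\,\mathbb I_2$, and define the events $$\mathbb C:=\Bigl\{\liminf_{t\to\infty}\frac{\langle f(X_t),-\alpha_t\rangle}{|f(X_t)|^2}>0,\ \liminf_{t\to\infty}\frac{|f(X_t)|}{|\alpha_t|}>0,\ \int_0^\infty|\beta_s|_F^2\,ds<\infty,\ \limsup_{t\to\infty}|\beta_t|<\infty\Bigr\}$$ and $\mathbb L:=\{\limsup_{t\to\infty}|X_t|<\infty\}$.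 Then: (i) $F$ is a Łojasiewicz-function. (ii) $\mathbb P(\mathbb C\cap\mathbb L)=1$. (iii) Almost surely, $(X_t)_{t\ge0}$ does not converge (as $t\to\infty$).
   Context: $|\cdot|$ is the Euclidean norm for vectors and the spectral norm for matrices; $|A|_F=\sqrt{\mathrm{tr}(A^\dagger A)}$ is the Frobenius norm; $\mathbb I_2$ is the $2\times2$ identity matrix; $B(x,r)$ is the ball of radius $r$ around $x$. In the quotients defining $\mathbb C$, $\frac00$ is interpreted as $\infty$ (and $c/0=\infty$ for $c>0$). The underlying filtered probability space satisfies the usual conditions and $W$ is a Brownian motion with respect to its filtration. Definition: a $C^2$-function $F:\mathbb R^d\to\mathbb R$ with gradient $f$ is a Łojasiewicz-function if for every $x$ with $f(x)=0$ there exist a neighbourhood $U_x$ of $x$, $L>0$ and $\theta\in[\frac12,1)$ such that for all $y\in U_x$, $|f(y)|\ge L\,|F(y)-F(x)|^\theta$. *)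

theory Defs
  imports "HOL-Probability.Probability"
begin

section \<open>Differentiability classes and Lojasiewicz functions\<close>

text \<open>\<open>C_k_fun k f\<close>: all iterated directional derivatives of \<open>f\<close> up to order \<open>k\<close> exist and are
  continuous; on a finite-dimensional space this is the class $C^k$ on the whole space.\<close>

primrec C_k_fun :: "nat \<Rightarrow> ('a::euclidean_space \<Rightarrow> 'b::real_normed_vector) \<Rightarrow> bool" where
  "C_k_fun 0 f \<longleftrightarrow> continuous_on UNIV f"
| "C_k_fun (Suc k) f \<longleftrightarrow>
     (\<forall>x. f differentiable (at x)) \<and> (\<forall>v. C_k_fun k (\<lambda>x. frechet_derivative f (at x) v))"

definition smooth_fun :: "('a::euclidean_space \<Rightarrow> 'b::real_normed_vector) \<Rightarrow> bool" where
  "smooth_fun f \<longleftrightarrow> (\<forall>k. C_k_fun k f)"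

definition grad :: "('a::euclidean_space \<Rightarrow> real) \<Rightarrow> 'a \<Rightarrow> 'a" where
  "grad F x = (THE D. GDERIV F x :> D)"

definition lojasiewicz_function :: "('a::euclidean_space \<Rightarrow> real) \<Rightarrow> bool" where
  "lojasiewicz_function F \<longleftrightarrow> C_k_fun 2 F \<and>
     (\<forall>x. grad F x = 0 \<longrightarrow>
       (\<exists>U L \<theta>. open U \<and> x \<in> U \<and> L > 0 \<and> \<theta> \<in> {1/2..<1} \<and>
          (\<forall>y\<in>U. norm (grad F y) \<ge> L * \<bar>F y - F x\<bar> powr \<theta>)))"

definition frobenius_norm :: "real^'n^'m \<Rightarrow> real" where
  "frobenius_norm A = sqrt (trace (transpose A ** A))"

definition spectral_norm :: "real^'n^'m \<Rightarrow> real" where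
  "spectral_norm A = onorm (\<lambda>v. A *v v)"

section \<open>Brownian motion and the Ito integral\<close>

text \<open>Time is \<open>{0..}\<close>: all time-indexed objects are functions on \<open>real\<close>, whose values at negative
  times are irrelevant.\<close>

locale usual_filtered_prob_space = prob_space M + complete_measure M
  for M :: "'w measure" +
  fixes F :: "real \<Rightarrow> 'w measure"
  assumes subalgebra_F: "t \<ge> 0 \<Longrightarrow> subalgebra M (F t)"
    and F_mono: "0 \<le> s \<Longrightarrow> s \<le> t \<Longrightarrow> sets (F s) \<subseteq> sets (F t)"
    and F_right_continuous: "t \<ge> 0 \<Longrightarrow> sets (F t) = (\<Inter>u\<in>{t<..}. sets (F u))"
    and null_sets_F: "null_sets M \<subseteq> sets (F 0)"

definition adapted :: "(real \<Rightarrow> 'w measure) \<Rightarrow> (real \<Rightarrow> 'w \<Rightarrow> 'b::topological_space) \<Rightarrow> bool" where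
  "adapted F X \<longleftrightarrow> (\<forall>t\<ge>0. X t \<in> borel_measurable (F t))"

definition progressive :: "(real \<Rightarrow> 'w measure) \<Rightarrow> (real \<Rightarrow> 'w \<Rightarrow> 'b::topological_space) \<Rightarrow> bool" where
  "progressive F X \<longleftrightarrow>
     (\<forall>T\<ge>0. (\<lambda>(s, \<omega>). X s \<omega>) \<in> borel_measurable (restrict_space borel {0..T} \<Otimes>\<^sub>M F T))"

definition continuous_paths :: "'w measure \<Rightarrow> (real \<Rightarrow> 'w \<Rightarrow> 'b::topological_space) \<Rightarrow> bool" where
  "continuous_paths M X \<longleftrightarrow> (AE \<omega> in M. continuous_on {0..} (\<lambda>t. X t \<omega>))"

text \<open>Standard Brownian motion (started in the origin) with respect to the filtration \<open>F\<close>.\<close>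

definition brownian_motion ::
    "'w measure \<Rightarrow> (real \<Rightarrow> 'w measure) \<Rightarrow> (real \<Rightarrow> 'w \<Rightarrow> real^'n) \<Rightarrow> bool" where
  "brownian_motion M F W \<longleftrightarrow>
     adapted F W \<and> continuous_paths M W \<and> (AE \<omega> in M. W 0 \<omega> = 0) \<and>
     (\<forall>s t. 0 \<le> s \<and> s < t \<longrightarrow>
        distributed M lborel (\<lambda>\<omega>. W t \<omega> - W s \<omega>)
          (\<lambda>x. ennreal (\<Prod>i\<in>UNIV. normal_density 0 (sqrt (t - s)) (x $ i))) \<and>
        prob_space.indep_set M (sets (F s))
          {(\<lambda>\<omega>. W t \<omega> - W s \<omega>) -` B \<inter> space M | B. B \<in> sets borel})"

text \<open>Simple integrands $\sum_{i<n} \xi_i 1_{(\tau_i, \tau_{i+1}]}$ with deterministic times $\tau_i$ and bounded,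
  \<open>F (\<tau> i)\<close>-measurable matrices \<open>\<xi> i\<close>.\<close>

definition simple_integrand ::
    "'w measure \<Rightarrow> (real \<Rightarrow> 'w measure) \<Rightarrow> nat \<Rightarrow> (nat \<Rightarrow> real) \<Rightarrow> (nat \<Rightarrow> 'w \<Rightarrow> real^'n^'m) \<Rightarrow> bool" where
  "simple_integrand M F n \<tau> \<xi> \<longleftrightarrow> 0 \<le> \<tau> 0 \<and>
     (\<forall>i<n. \<tau> i \<le> \<tau> (Suc i) \<and> \<xi> i \<in> borel_measurable (F (\<tau> i)) \<and> bounded (\<xi> i ` space M))"

definition simple_process ::
    "nat \<Rightarrow> (nat \<Rightarrow> real) \<Rightarrow> (nat \<Rightarrow> 'w \<Rightarrow> real^'n^'m) \<Rightarrow> real \<Rightarrow> 'w \<Rightarrow> real^'n^'m" where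
  "simple_process n \<tau> \<xi> t \<omega> = (\<Sum>i<n. indicat_real {\<tau> i<..\<tau> (Suc i)} t *\<^sub>R \<xi> i \<omega>)"

definition simple_integral ::
    "(real \<Rightarrow> 'w \<Rightarrow> real^'n) \<Rightarrow> nat \<Rightarrow> (nat \<Rightarrow> real) \<Rightarrow> (nat \<Rightarrow> 'w \<Rightarrow> real^'n^'m) \<Rightarrow> real \<Rightarrow> 'w \<Rightarrow> real^'m" where
  "simple_integral W n \<tau> \<xi> t \<omega> =
     (\<Sum>i<n. \<xi> i \<omega> *v (W (min t (\<tau> (Suc i))) \<omega> - W (min t (\<tau> i)) \<omega>))"

text \<open>Measurability is demanded explicitly since \<open>measure\<close> vanishes on nonmeasurable sets.\<close>

definition null_in_probability :: "'w measure \<Rightarrow> (nat \<Rightarrow> 'w \<Rightarrow> ennreal) \<Rightarrow> bool" where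
  "null_in_probability M Y \<longleftrightarrow> (\<forall>k. Y k \<in> borel_measurable M) \<and>
     (\<forall>\<epsilon>>0. (\<lambda>k. measure M {\<omega> \<in> space M. Y k \<omega> > ennreal \<epsilon>}) \<longlonglongrightarrow> 0)"

text \<open>\<open>is_ito_integral M F W H I\<close>: the process \<open>I\<close> is (a version of) $\int_0^\cdot H_s\,dW_s$, for
  progressive \<open>H\<close> that is a.s. locally square-integrable in time. The integral is the limit, uniformly
  on compacts in probability, of the integrals of simple integrands approximating \<open>H\<close>.\<close>

definition is_ito_integral ::
    "'w measure \<Rightarrow> (real \<Rightarrow> 'w measure) \<Rightarrow> (real \<Rightarrow> 'w \<Rightarrow> real^'n) \<Rightarrow>
     (real \<Rightarrow> 'w \<Rightarrow> real^'n^'m) \<Rightarrow> (real \<Rightarrow> 'w \<Rightarrow> real^'m) \<Rightarrow> bool" where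
  "is_ito_integral M F W H I \<longleftrightarrow>
     progressive F H \<and>
     (AE \<omega> in M. \<forall>T\<ge>0. (\<integral>\<^sup>+ s\<in>{0..T}. ennreal ((frobenius_norm (H s \<omega>))\<^sup>2) \<partial>lborel) < \<infinity>) \<and>
     adapted F I \<and> continuous_paths M I \<and>
     (\<exists>n \<tau> \<xi>. (\<forall>k. simple_integrand M F (n k) (\<tau> k) (\<xi> k)) \<and>
       (\<forall>T\<ge>0.
          null_in_probability M (\<lambda>k \<omega>. \<integral>\<^sup>+ s\<in>{0..T}. ennreal
            ((frobenius_norm (simple_process (n k) (\<tau> k) (\<xi> k) s \<omega> - H s \<omega>))\<^sup>2) \<partial>lborel) \<and>
          null_in_probability M (\<lambda>k \<omega>. SUP t\<in>{0..T}. ennreal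
            (norm (simple_integral W (n k) (\<tau> k) (\<xi> k) t \<omega> - I t \<omega>)))))"

text \<open>\<open>is_ito_process M F W x \<alpha> \<beta> X\<close>: $dX_t = \alpha_t\,dt + \beta_t\,dW_t$, $X_0 = x$.\<close>

definition is_ito_process ::
    "'w measure \<Rightarrow> (real \<Rightarrow> 'w measure) \<Rightarrow> (real \<Rightarrow> 'w \<Rightarrow> real^'n) \<Rightarrow> real^'m \<Rightarrow>
     (real \<Rightarrow> 'w \<Rightarrow> real^'m) \<Rightarrow> (real \<Rightarrow> 'w \<Rightarrow> real^'n^'m) \<Rightarrow> (real \<Rightarrow> 'w \<Rightarrow> real^'m) \<Rightarrow> bool" where
  "is_ito_process M F W x \<alpha> \<beta> X \<longleftrightarrow>
     adapted F X \<and> continuous_paths M X \<and>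
     (\<exists>I. is_ito_integral M F W \<beta> I \<and>
       (AE \<omega> in M. \<forall>t\<ge>0. set_integrable lborel {0..t} (\<lambda>s. \<alpha> s \<omega>) \<and>
          X t \<omega> = x + (LINT s:{0..t}|lborel. \<alpha> s \<omega>) + I t \<omega>))"

section \<open>The events and the potential\<close>

text \<open>Conventions $0/0 = \infty$ and $c/0 = \infty$ for $c > 0$. The value for $c < 0$ is immaterial: in
  \<open>event_C\<close> a zero denominator comes with a nonnegative numerator.\<close>

definition equotient :: "real \<Rightarrow> real \<Rightarrow> ereal" where
  "equotient a b = (if b = 0 then \<infinity> else ereal (a / b))"

definition event_C ::
    "'w measure \<Rightarrow> (real^'m \<Rightarrow> real^'m) \<Rightarrow> (real \<Rightarrow> 'w \<Rightarrow> real^'m) \<Rightarrow>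
     (real \<Rightarrow> 'w \<Rightarrow> real^'m) \<Rightarrow> (real \<Rightarrow> 'w \<Rightarrow> real^'n^'m) \<Rightarrow> 'w set" where
  "event_C M f X \<alpha> \<beta> = {\<omega> \<in> space M.
     Liminf at_top (\<lambda>t. equotient (f (X t \<omega>) \<bullet> (- \<alpha> t \<omega>)) ((norm (f (X t \<omega>)))\<^sup>2)) > 0 \<and>
     Liminf at_top (\<lambda>t. equotient (norm (f (X t \<omega>))) (norm (\<alpha> t \<omega>))) > 0 \<and>
     (\<integral>\<^sup>+ s\<in>{0..}. ennreal ((frobenius_norm (\<beta> s \<omega>))\<^sup>2) \<partial>lborel) < \<infinity> \<and>
     Limsup at_top (\<lambda>t. ereal (spectral_norm (\<beta> t \<omega>))) < \<infinity>}"

definition event_L :: "'w measure \<Rightarrow> (real \<Rightarrow> 'w \<Rightarrow> real^'m) \<Rightarrow> 'w set" where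
  "event_L M X = {\<omega> \<in> space M. Limsup at_top (\<lambda>t. ereal (norm (X t \<omega>))) < \<infinity>}"

definition psi :: "real \<Rightarrow> real" where
  "psi r = (if r \<ge> 1/2 then (1 - r)\<^sup>2 else 8/3 * r^3 - 3 * r\<^sup>2 + 2/3)"

definition potential :: "real^2 \<Rightarrow> real" where
  "potential x = psi (norm x)"

definition ort :: "real^2 \<Rightarrow> real^2" where
  "ort x = vector [- (x $ 2), x $ 1]"

definition rotationally_invariant :: "(real^2 \<Rightarrow> 'b) \<Rightarrow> bool" where
  "rotationally_invariant \<phi> \<longleftrightarrow> (\<forall>R x. rotation_matrix R \<longrightarrow> \<phi> (R *v x) = \<phi> x)"

end

theory Submission
  imports Defs
begin

text \<open>Near the unit circle the drift pulls the radius \<open>r\<close> towards 1 at rate 2 and rotates with speed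
  \<open>\<bar>r - 1\<bar>\<close>, while the noise has size \<open>1 / (t + 1)\<close>, so that \<open>\<bar>r - 1\<bar>\<close> is of order \<open>1 / t\<close> and the angle
  diverges like a harmonic series. Neither the Ito formula nor martingale convergence is needed to make
  this precise. All that enters is a tail inequality for the Ito integral (a large increment of
  \<open>\<integral>(H - \<eta>) dW\<close> forces \<open>\<integral>\<bar>H - \<eta>\<bar>\<^sup>2 ds\<close> to be large), which implies that the path moves
  deterministically wherever the noise is switched off, that the integral does not tend to infinity in norm,
  and that over \<open>[t, t + 1]\<close> it is \<open>(W (t + 1) - W t) / (t + 1)\<close> up to a summable error.

  If \<open>X\<close> converges, its limit is a zero of the drift, hence on the unit circle, and the tangential part of
  the drift shows \<open>\<integral>\<bar>r - 1\<bar> dt < \<infinity>\<close>. For almost every offset \<open>\<theta>\<close> the numbers \<open>\<bar>r - 1\<bar>\<close> at the times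
  \<open>t = n + \<theta>\<close> are then summable, and comparing \<open>\<bar>X\<bar>\<^sup>2\<close> at consecutive such times shows that the
  \<open>\<bar>X t \<bullet> (W (t + 1) - W t)\<bar> / (t + 1)\<close> are summable too. But given the past, each
  \<open>\<bar>X t \<bullet> (W (t + 1) - W t)\<bar>\<close> exceeds \<open>\<bar>X t\<bar>\<close> with a probability bounded away from 0,
  so almost surely this series diverges with the harmonic series.\<close>

section \<open>The potential\<close>

text \<open>The obstacle is that the Ito integral is defined only as a limit in probability of
  simple integrals, which gives no direct access to its second moments. The tail inequality is
  therefore stated jointly with an upper bound on the energy of the integrand; in this form it
  survives an approximation in probability. Allowing a deterministic matrix \<eta> in it makes
  "close to a multiple of a Brownian increment" the same estimate as "small".

  Each almost sure statement holds at first for fixed or countably many times only. Hence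
  path-dependent intervals are reached through rational endpoints and continuity, and bounds on
  paths are indexed by natural numbers.

  Steps of length 1 are fine enough: on such a step 1 / (t + 1) changes by at most a multiple of 1 /
  t^2, so the energy of the error is of order 1 / t^4, which leaves room for a summable error in the
  Borel-Cantelli argument. The noise sizes 1 / (t + 1) are square summable but not summable: in the
  expansion of the squared norm the square of the noise is harmless while its linear radial part
  diverges.\<close>

lemma has_real_derivative_if_ge_at:
  fixes f g :: "real \<Rightarrow> real"
  assumes "(f has_real_derivative D) (at a)" "(g has_real_derivative D) (at a)" "f a = g a"
  shows "((\<lambda>x. if x \<ge> a then f x else g x) has_real_derivative D) (at a)"
  unfolding has_field_derivative_iff
proof (rule filterlim_split_at)
  let ?h = "\<lambda>x. if x \<ge> a then f x else g x"
  have "((\<lambda>y. (g y - g a) / (y - a)) \<longlongrightarrow> D) (at_left a)"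
    using assms(2) unfolding has_field_derivative_iff by (rule filterlim_mono) (auto simp: at_le)
  then show "((\<lambda>y. (?h y - ?h a) / (y - a)) \<longlongrightarrow> D) (at_left a)"
    by (rule Lim_transform_eventually)
      (auto simp: eventually_at_filter assms(3))
  have "((\<lambda>y. (f y - f a) / (y - a)) \<longlongrightarrow> D) (at_right a)"
    using assms(1) unfolding has_field_derivative_iff by (rule filterlim_mono) (auto simp: at_le)
  then show "((\<lambda>y. (?h y - ?h a) / (y - a)) \<longlongrightarrow> D) (at_right a)"
    by (rule Lim_transform_eventually)
      (auto simp: eventually_at_filter assms(3))
qed

lemma has_real_derivative_if_ge:
  fixes f g :: "real \<Rightarrow> real"
  assumes "f a = g a"
    and "\<And>x. x \<ge> a \<Longrightarrow> (f has_real_derivative f' x) (at x)"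
    and "\<And>x. x \<le> a \<Longrightarrow> (g has_real_derivative g' x) (at x)"
    and "f' a = g' a"
  shows "((\<lambda>x. if x \<ge> a then f x else g x) has_real_derivative (if x \<ge> a then f' x else g' x)) (at x)"
proof (cases x a rule: linorder_cases)
  case less
  have "((\<lambda>x. if x \<ge> a then f x else g x) has_real_derivative g' x) (at x)"
    by (rule has_field_derivative_transform_within_open[OF assms(3), of x "{..<a}"]) (use less in auto)
  then show ?thesis using less by simp
next
  case greater
  have "((\<lambda>x. if x \<ge> a then f x else g x) has_real_derivative f' x) (at x)"
    by (rule has_field_derivative_transform_within_open[OF assms(2), of x "{a<..}"]) (use greater in auto)
  then show ?thesis using greater by simp
next
  case equal
  then show ?thesis using has_real_derivative_if_ge_at[of f "f' a" a g] assms(1,4) assms(2,3)[of a] by simp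
qed

text \<open>This is psi'(r) / r, so that the gradient of the potential is
  \<open>slope (norm x)\<close> times x, with no division at the origin. Both branches take the
  value -2 at 1/2 and both have derivative 8 there, which is what makes the potential twice
  continuously differentiable.\<close>

definition slope :: "real \<Rightarrow> real" where
  "slope r = (if r \<ge> 1/2 then 2 - 2 / r else 8 * r - 6)"

definition slope' :: "real \<Rightarrow> real" where
  "slope' r = (if r \<ge> 1/2 then 2 / r\<^sup>2 else 8)"

lemma psi_deriv: "(psi has_real_derivative r * slope r) (at r)"
proof -
  have "((\<lambda>x. if x \<ge> 1/2 then (1 - x)\<^sup>2 else 8/3 * x^3 - 3 * x\<^sup>2 + 2/3) has_real_derivative
      (if r \<ge> 1/2 then 2 * r - 2 else 8 * r\<^sup>2 - 6 * r)) (at r)"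
    by (rule has_real_derivative_if_ge) (auto intro!: derivative_eq_intros simp: field_simps power2_eq_square)
  also have "(if r \<ge> 1/2 then 2 * r - 2 else 8 * r\<^sup>2 - 6 * r) = r * slope r"
    by (auto simp: slope_def field_simps power2_eq_square)
  finally show ?thesis unfolding psi_def[abs_def] .
qed

lemma slope_deriv: "(slope has_real_derivative slope' r) (at r)"
  unfolding slope_def[abs_def] slope'_def
  by (rule has_real_derivative_if_ge) (auto intro!: derivative_eq_intros simp: field_simps power2_eq_square)

lemma continuous_on_slope [continuous_intros]:
  "continuous_on A h \<Longrightarrow> continuous_on A (\<lambda>x. slope (h x))"
  using continuous_on_compose2[of UNIV slope A h] DERIV_isCont[OF slope_deriv]
  by (auto simp: continuous_at_imp_continuous_on)

lemma isCont_slope': "r > 0 \<Longrightarrow> isCont slope' r"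
proof -
  assume r: "r > 0"
  \<comment> \<open>Replacing r by \<open>max (1/2) r\<close> merges the two branches into one
    formula, because 2 / (1/2)^2 = 8.\<close>
  have "continuous_on {0<..} (\<lambda>r. 2 / (max (1/2) r)\<^sup>2 :: real)"
    by (intro continuous_intros) (auto simp: max_def)
  moreover have "2 / (max (1/2) r)\<^sup>2 = slope' r" for r
    by (auto simp: slope'_def max_def power2_eq_square field_simps)
  ultimately have "continuous_on {0<..} slope'" by simp
  then show ?thesis using r by (simp add: continuous_on_eq_continuous_at)
qed

lemma slope'_bounds: "0 \<le> slope' r" "slope' r \<le> 8"
proof -
  show "0 \<le> slope' r" by (simp add: slope'_def)
  have "2 \<le> 8 * r\<^sup>2" if "r \<ge> 1/2"
    using power_mono[OF that, of 2] by (simp add: power_divide)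
  then show "slope' r \<le> 8" by (auto simp: slope'_def divide_le_eq)
qed

text \<open>At a zero of G the product rule asks only for continuity of the other factor, since the
  variation of c contributes (c h - c 0) * G' h, which is o(norm h). This admits factors containing
  the norm, which is not differentiable at the origin.\<close>

lemma has_derivative_mult_at_zero:
  fixes G :: "'a::euclidean_space \<Rightarrow> real"
  assumes c: "isCont c 0" and G: "(G has_derivative G') (at 0)" and "G 0 = 0"
  shows "((\<lambda>x. c x * G x) has_derivative (\<lambda>h. c 0 * G' h)) (at 0)"
proof -
  interpret G': bounded_linear G' using G by (rule has_derivative_bounded_linear)
  obtain K where K: "\<And>x. norm (G' x) \<le> norm x * K" "K > 0" using G'.pos_bounded by blast
  have lim: "((\<lambda>h. norm (G h - G' h) / norm h) \<longlongrightarrow> 0) (at 0)"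
    using G \<open>G 0 = 0\<close> unfolding has_derivative_at by simp
  have c0: "(c \<longlongrightarrow> c 0) (at 0)" using c by (simp add: isCont_def)
  have "((\<lambda>h. \<bar>c h\<bar> * (norm (G h - G' h) / norm h) + \<bar>c h - c 0\<bar> * K) \<longlongrightarrow> \<bar>c 0\<bar> * 0 + \<bar>c 0 - c 0\<bar> * K) (at 0)"
    by (intro tendsto_intros lim c0)
  then have lim2: "((\<lambda>h. \<bar>c h\<bar> * (norm (G h - G' h) / norm h) + \<bar>c h - c 0\<bar> * K) \<longlongrightarrow> 0) (at 0)" by simp
  have "((\<lambda>h. norm (c h * G h - c 0 * G' h) / norm h) \<longlongrightarrow> 0) (at 0)"
  proof (rule tendsto_sandwich[OF _ _ tendsto_const lim2])
    have "norm (c h * G h - c 0 * G' h) / norm h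
        \<le> \<bar>c h\<bar> * (norm (G h - G' h) / norm h) + \<bar>c h - c 0\<bar> * K" if "h \<noteq> 0" for h
    proof -
      have "c h * G h - c 0 * G' h = c h * (G h - G' h) + (c h - c 0) * G' h" by algebra
      then have "norm (c h * G h - c 0 * G' h) \<le> \<bar>c h\<bar> * norm (G h - G' h) + \<bar>c h - c 0\<bar> * norm (G' h)"
        by (metis abs_mult abs_triangle_ineq real_norm_def)
      also have "\<dots> \<le> \<bar>c h\<bar> * norm (G h - G' h) + \<bar>c h - c 0\<bar> * (norm h * K)"
        by (intro add_mono mult_left_mono K) auto
      finally show ?thesis using that by (simp add: field_simps)
    qed
    then show "\<forall>\<^sub>F h in at 0. norm (c h * G h - c 0 * G' h) / norm h
        \<le> \<bar>c h\<bar> * (norm (G h - G' h) / norm h) + \<bar>c h - c 0\<bar> * K"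
      by (auto simp: eventually_at_filter)
  qed auto
  then show ?thesis
    unfolding has_derivative_at using \<open>G 0 = 0\<close>
    by (auto intro!: bounded_linear_const_mult G'.bounded_linear_axioms)
qed

lemma has_derivative_radial:
  assumes "(h has_real_derivative D) (at (norm x))" "x \<noteq> 0"
  shows "((\<lambda>x. h (norm x)) has_derivative (\<lambda>v. D / norm x * (x \<bullet> v))) (at (x::'a::euclidean_space))"
proof -
  have "(h \<circ> norm has_derivative (\<lambda>x. D * x) \<circ> (\<lambda>v. v \<bullet> sgn x)) (at x)"
    using assms by (intro diff_chain_at has_derivative_norm) (auto simp: has_field_derivative_def)
  then show ?thesis by (simp add: o_def sgn_div_norm inner_commute field_simps)
qed

section \<open>Gradient and second derivative of the potential\<close>

definition fgrad :: "real^2 \<Rightarrow> real^2" where "fgrad x = slope (norm x) *\<^sub>R x"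

lemma potential_has_derivative:
  "(potential has_derivative (\<lambda>h. fgrad x \<bullet> h)) (at x)"
proof (cases "x = 0")
  case False
  then show ?thesis
    using has_derivative_radial[OF psi_deriv False]
    by (simp add: potential_def[abs_def] fgrad_def)
next
  case True
  \<comment> \<open>On the ball of radius 1/2 the potential is (8/3 r - 3) r^2 + 2/3 with r the
    norm: a continuous factor times the smooth function \<open>x \<bullet> x\<close>, whose value
    and derivative vanish at 0.\<close>
  have "((\<lambda>x. (8/3 * norm x - 3) * (x \<bullet> x)) has_derivative (\<lambda>h. (8/3 * norm (0::real^2) - 3) * 0)) (at (0::real^2))"
    by (rule has_derivative_mult_at_zero) (auto intro!: derivative_eq_intros continuous_intros)
  then have "((\<lambda>x. (8/3 * norm x - 3) * (x \<bullet> x) + 2/3) has_derivative (\<lambda>h. 0)) (at (0::real^2))"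
    by (simp add: has_derivative_add_const)
  then have "(potential has_derivative (\<lambda>h. 0)) (at 0)"
    by (rule has_derivative_transform_within_open[of _ _ _ _ "ball 0 (1/2)"])
      (auto simp: potential_def psi_def dot_square_norm power2_eq_square power3_eq_cube algebra_simps)
  then show ?thesis using True by (simp add: fgrad_def)
qed

lemma grad_potential: "grad potential = fgrad"
proof
  fix x
  have "GDERIV potential x :> fgrad x"
    using potential_has_derivative by (simp add: gderiv_def inner_commute)
  then show "grad potential x = fgrad x"
    unfolding grad_def
  proof (rule the_equality)
    fix D assume "GDERIV potential x :> D"
    then have "(\<lambda>h. h \<bullet> D) = (\<lambda>h. fgrad x \<bullet> h)"
      unfolding gderiv_def using potential_has_derivative has_derivative_unique by blast
    then have "h \<bullet> D = h \<bullet> fgrad x" for h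
      by (metis inner_commute)
    then show "D = fgrad x" by (metis vector_eq_ldot)
  qed
qed

text \<open>The Hessian of the potential as a bilinear form in v and h. At x = 0 the first summand
  is 0, both by the convention on division and because of its factor \<open>x \<bullet> h\<close>,
  which leaves -6 times the inner product.\<close>

definition hess :: "real^2 \<Rightarrow> real^2 \<Rightarrow> real^2 \<Rightarrow> real" where
  "hess v x h = slope' (norm x) / norm x * (x \<bullet> h) * (x \<bullet> v) + slope (norm x) * (h \<bullet> v)"

lemma fgrad_has_derivative: "((\<lambda>x. fgrad x \<bullet> v) has_derivative hess v x) (at x)"
proof (cases "x = 0")
  case True
  have "((\<lambda>x. (8 * norm x - 6) * (x \<bullet> v)) has_derivative (\<lambda>h. (8 * norm (0::real^2) - 6) * (h \<bullet> v))) (at (0::real^2))"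
    by (rule has_derivative_mult_at_zero) (auto intro!: derivative_eq_intros continuous_intros)
  then have "((\<lambda>x. fgrad x \<bullet> v) has_derivative (\<lambda>h. -6 * (h \<bullet> v))) (at 0)"
    by (rule has_derivative_transform_within_open[of _ _ _ _ "ball 0 (1/2)", THEN has_derivative_eq_rhs])
      (auto simp: fgrad_def slope_def)
  then show ?thesis using True by (simp add: hess_def[abs_def] slope_def)
next
  case False
  have "((\<lambda>x. slope (norm x) * (x \<bullet> v)) has_derivative
     (\<lambda>h. slope (norm x) * (h \<bullet> v) + slope' (norm x) / norm x * (x \<bullet> h) * (x \<bullet> v))) (at x)"
    using has_derivative_radial[OF slope_deriv False] by (auto intro!: derivative_eq_intros)
  then show ?thesis by (simp add: fgrad_def hess_def[abs_def] add.commute)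
qed

text \<open>Only the origin is critical: there the quotient by the norm is compensated by two inner
  products with x, so that the first summand is at most
  \<open>8 * norm h * norm v * norm x\<close>.\<close>

lemma continuous_hess: "continuous_on UNIV (\<lambda>x. hess v x h)"
proof -
  have "isCont (\<lambda>x. slope' (norm x) / norm x * (x \<bullet> h) * (x \<bullet> v)) x" for x :: "real^2"
  proof (cases "x = 0")
    case False
    then show ?thesis by (intro continuous_intros isCont_o2[OF _ isCont_slope']) auto
  next
    case True
    have "((\<lambda>x. slope' (norm x) / norm x * (x \<bullet> h) * (x \<bullet> v)) \<longlongrightarrow> 0) (at (0::real^2))"
    proof (rule Lim_null_comparison)
      have "norm (slope' (norm x) / norm x * (x \<bullet> h) * (x \<bullet> v)) \<le> 8 * norm h * norm v * norm x"
        if "x \<noteq> 0" for x :: "real^2"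
      proof -
        have "norm (slope' (norm x) / norm x * (x \<bullet> h) * (x \<bullet> v))
          = slope' (norm x) / norm x * \<bar>x \<bullet> h\<bar> * \<bar>x \<bullet> v\<bar>"
          using slope'_bounds by (simp add: abs_mult)
        also have "\<dots> \<le> 8 / norm x * (norm x * norm h) * (norm x * norm v)"
          using slope'_bounds by (intro mult_mono divide_right_mono Cauchy_Schwarz_ineq2) auto
        finally show ?thesis using that by (simp add: field_simps)
      qed
      then show "\<forall>\<^sub>F x in at (0::real^2). norm (slope' (norm x) / norm x * (x \<bullet> h) * (x \<bullet> v)) \<le> 8 * norm h * norm v * norm x"
        by (auto simp: eventually_at_filter)
      show "((\<lambda>x. 8 * norm h * norm v * norm x) \<longlongrightarrow> 0) (at (0::real^2))"
        by (auto intro!: tendsto_eq_intros)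
    qed
    then show ?thesis using True by (simp add: isCont_def)
  qed
  then have "continuous_on UNIV (\<lambda>x. slope' (norm x) / norm x * (x \<bullet> h) * (x \<bullet> v))"
    by (simp add: continuous_at_imp_continuous_on)
  then show ?thesis unfolding hess_def
    by (rule continuous_on_add) (intro continuous_intros)
qed

lemma C2_potential: "C_k_fun 2 potential"
proof -
  have 1: "frechet_derivative potential (at x) = (\<lambda>h. fgrad x \<bullet> h)" for x
    using potential_has_derivative frechet_derivative_at by metis
  have 2: "frechet_derivative (\<lambda>x. fgrad x \<bullet> v) (at x) = hess v x" for x v
    using fgrad_has_derivative frechet_derivative_at by metis
  show ?thesis
    unfolding numeral_2_eq_2 C_k_fun.simps 1 2
    using potential_has_derivative fgrad_has_derivative continuous_hess
    by (auto simp: differentiable_def)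
qed

section \<open>Critical points and the Lojasiewicz inequality\<close>

lemma norm_fgrad: "norm (fgrad x) = \<bar>slope (norm x)\<bar> * norm x"
  by (simp add: fgrad_def)

lemma norm_fgrad_outer: "norm x \<ge> 1/2 \<Longrightarrow> norm (fgrad x) = 2 * \<bar>norm x - 1\<bar>"
proof -
  assume *: "norm x \<ge> 1/2"
  then have "slope (norm x) * norm x = 2 * (norm x - 1)" by (auto simp: slope_def field_simps)
  then have "\<bar>slope (norm x) * norm x\<bar> = \<bar>2 * (norm x - 1)\<bar>" by simp
  then show ?thesis by (simp only: norm_fgrad abs_mult abs_norm_cancel)
qed

lemma fgrad_eq_0_iff: "fgrad x = 0 \<longleftrightarrow> x = 0 \<or> norm x = 1"
proof -
  have "slope r = 0 \<longleftrightarrow> r = 1" for r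
    by (cases "r \<ge> 1/2") (auto simp: slope_def divide_eq_eq)
  then show ?thesis by (auto simp: fgrad_def)
qed

text \<open>The critical points are the origin and the unit circle, and \<psi> has nonzero second
  derivative at the radii 0 and 1. Near either the potential differs from its critical value
  quadratically in the radial distance while the gradient is linear in it, so the exponent 1/2 with
  constant 1 works.\<close>

lemma lojasiewicz_potential: "lojasiewicz_function potential"
  unfolding lojasiewicz_function_def
proof (intro conjI allI impI C2_potential)
  fix x :: "real^2" assume "grad potential x = 0"
  then consider "x = 0" | "norm x = 1" by (auto simp: grad_potential fgrad_eq_0_iff)
  then show "\<exists>U L \<theta>. open U \<and> x \<in> U \<and> L > 0 \<and> \<theta> \<in> {1/2..<1} \<and>
      (\<forall>y\<in>U. norm (grad potential y) \<ge> L * \<bar>potential y - potential x\<bar> powr \<theta>)"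
  proof cases
    case 1
    have "1 * \<bar>potential y - potential x\<bar> powr (1/2) \<le> norm (grad potential y)"
      if y: "y \<in> ball 0 (1/2)" for y
    proof -
      define r where "r = norm y"
      have r: "0 \<le> r" "r < 1/2" using y by (auto simp: r_def)
      have "potential y - potential x = - (r\<^sup>2 * (3 - 8/3 * r))"
        using 1 r by (simp add: potential_def psi_def r_def[symmetric] algebra_simps power2_eq_square power3_eq_cube)
      then have "\<bar>potential y - potential x\<bar> = r\<^sup>2 * (3 - 8/3 * r)"
        using r by simp
      also have "\<dots> \<le> r\<^sup>2 * (6 - 8 * r)\<^sup>2"
      proof (intro mult_left_mono)
        \<comment> \<open>The exact difference of the two sides wanted is 33 - (280/3) r + 64 r^2.
          Lowering the middle coefficient to -98 keeps a lower bound and puts a root at r = 1/2, the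
          edge of the ball.\<close>
        have "0 \<le> (1 - 2 * r) * (33 - 32 * r)" using r by (intro mult_nonneg_nonneg) auto
        then have "0 \<le> 33 - 98 * r + 64 * r\<^sup>2" by (simp add: algebra_simps power2_eq_square)
        then have "3 - 8/3 * r \<le> 36 - 96 * r + 64 * r\<^sup>2" using r by linarith
        then show "3 - 8/3 * r \<le> (6 - 8 * r)\<^sup>2" by (simp add: algebra_simps power2_eq_square)
      qed auto
      also have "\<dots> = (r * (6 - 8 * r))\<^sup>2" by (simp add: power_mult_distrib)
      finally have "sqrt \<bar>potential y - potential x\<bar> \<le> r * (6 - 8 * r)"
        using r by (intro real_le_lsqrt) auto
      moreover have "norm (fgrad y) = r * (6 - 8 * r)"
        using r by (simp add: norm_fgrad r_def[symmetric] slope_def)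
      ultimately show ?thesis by (simp add: grad_potential powr_half_sqrt)
    qed
    then show ?thesis using 1
      by (intro exI[of _ "ball 0 (1/2)"] exI[of _ 1] exI[of _ "1/2"]) auto
  next
    case 2
    have "1 * \<bar>potential y - potential x\<bar> powr (1/2) \<le> norm (grad potential y)"
      if y: "y \<in> - cball 0 (1/2)" for y
    proof -
      have "\<bar>potential y - potential x\<bar> = (norm y - 1)\<^sup>2"
        using y 2 by (simp add: potential_def psi_def power2_commute)
      then show ?thesis using y
        by (simp add: grad_potential powr_half_sqrt norm_fgrad_outer)
    qed
    then show ?thesis using 2
      by (intro exI[of _ "- cball 0 (1/2)"] exI[of _ 1] exI[of _ "1/2"]) (auto simp: closed_Compl)
  qed
qed

section \<open>Discrete stochastic integrals\<close>

lemma norm_matrix_sq: "(norm (A :: real^'n^'m))\<^sup>2 = (\<Sum>i\<in>UNIV. \<Sum>j\<in>UNIV. (A $ i $ j)\<^sup>2)"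
  by (simp add: norm_vec_def L2_set_def sum_nonneg)

text \<open>A matrix is a vector of rows, so its Euclidean norm collects the squares of all entries.
  From here on estimates are made with \<open>norm\<close>.\<close>

lemma frobenius_norm_eq_norm: "frobenius_norm A = norm A"
proof -
  have "trace (transpose A ** A) = (\<Sum>j\<in>UNIV. \<Sum>i\<in>UNIV. (A $ i $ j)\<^sup>2)"
    by (simp add: trace_def matrix_matrix_mult_def transpose_def power2_eq_square)
  also have "\<dots> = (norm A)\<^sup>2"
    unfolding norm_matrix_sq by (rule sum.swap)
  finally show ?thesis by (simp add: frobenius_norm_def)
qed

lemma norm_matrix_vector_mult_le: "norm (A *v x) \<le> norm (A :: real^'n^'m) * norm x"
proof -
  have "(norm (A *v x))\<^sup>2 = (\<Sum>i\<in>UNIV. (A $ i \<bullet> x)\<^sup>2)"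
    by (simp add: norm_vec_def L2_set_def sum_nonneg matrix_mult_dot)
  also have "\<dots> \<le> (\<Sum>i\<in>UNIV. (norm (A $ i) * norm x)\<^sup>2)"
    by (intro sum_mono) (metis Cauchy_Schwarz_ineq2 abs_ge_zero power2_abs power_mono)
  also have "\<dots> = (\<Sum>i\<in>UNIV. (norm (A $ i))\<^sup>2) * (norm x)\<^sup>2"
    by (simp add: power_mult_distrib sum_distrib_right)
  also have "\<dots> = (norm A * norm x)\<^sup>2"
    by (simp add: norm_vec_def[of A] L2_set_def sum_nonneg power_mult_distrib)
  finally show ?thesis
    by (rule power2_le_imp_le) simp
qed

lemma borel_measurable_matrix_vector_mult [measurable (raw)]:
  fixes A :: "'a \<Rightarrow> real^'n^'m"
  assumes "A \<in> borel_measurable M" "x \<in> borel_measurable M"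
  shows "(\<lambda>w. A w *v x w) \<in> borel_measurable M"
  using assms
  by (rule borel_measurable_continuous_Pair) (unfold matrix_vector_mult_def, intro continuous_intros)

lemma borel_measurable_vec_nth [measurable (raw)]:
  fixes f :: "'a \<Rightarrow> ('b::topological_space)^'n"
  assumes "f \<in> borel_measurable M"
  shows "(\<lambda>x. f x $ i) \<in> borel_measurable M"
  using assms by (rule measurable_compose)
    (intro borel_measurable_continuous_onI continuous_intros)

lemma prod_Basis_cart: "(\<Prod>b\<in>Basis. h b) = (\<Prod>i\<in>UNIV. h (axis i 1 :: real^'n))"
proof -
  have "(Basis :: (real^'n) set) = range (\<lambda>i. axis i 1)"
    by (auto simp: Basis_vec_def)
  moreover have "inj (\<lambda>i. axis i 1 :: real^'n)"
    by (simp add: inj_on_def axis_eq_axis)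
  ultimately show ?thesis
    by (metis (no_types, lifting) prod.reindex_cong)
qed

lemma steps_mono:
  fixes \<sigma> :: "nat \<Rightarrow> real"
  assumes "\<And>i. i < m \<Longrightarrow> \<sigma> i \<le> \<sigma> (Suc i)" "i \<le> j" "j \<le> m"
  shows "\<sigma> i \<le> \<sigma> j"
  using assms(2,3)
proof (induction j rule: dec_induct)
  case (step n)
  then show ?case using assms(1)[of n] by simp
qed simp

lemma steps_interval_unique:
  fixes \<sigma> :: "nat \<Rightarrow> real"
  assumes "\<And>i. i < m \<Longrightarrow> \<sigma> i \<le> \<sigma> (Suc i)" "i < m" "j < m"
    "s \<in> {\<sigma> i<..\<sigma> (Suc i)}" "s \<in> {\<sigma> j<..\<sigma> (Suc j)}"
  shows "i = j"
proof (cases i j rule: linorder_cases)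
  case less
  then have "\<sigma> (Suc i) \<le> \<sigma> j" using steps_mono[of m \<sigma> "Suc i" j] assms by auto
  then show ?thesis using assms by simp
next
  case greater
  then have "\<sigma> (Suc j) \<le> \<sigma> i" using steps_mono[of m \<sigma> "Suc j" i] assms by auto
  then show ?thesis using assms by simp
qed

locale filtered_brownian_motion = usual_filtered_prob_space M F
  for M :: "'w measure" and F :: "real \<Rightarrow> 'w measure" +
  fixes W :: "real \<Rightarrow> 'w \<Rightarrow> real^'n"
  assumes brownian: "brownian_motion M F W"
begin

section \<open>Moments and independence of Brownian increments\<close>

lemma measurable_F_M: "t \<ge> 0 \<Longrightarrow> f \<in> measurable (F t) N \<Longrightarrow> f \<in> measurable M N"
  using measurable_from_subalg subalgebra_F by blast

lemma space_F [simp]: "t \<ge> 0 \<Longrightarrow> space (F t) = space M"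
  using subalgebra_F by (auto simp: subalgebra_def)

lemma measurable_F_mono: "0 \<le> s \<Longrightarrow> s \<le> t \<Longrightarrow> f \<in> measurable (F s) N \<Longrightarrow> f \<in> measurable (F t) N"
  using F_mono[of s t] by (auto simp: measurable_def)

lemma W_measurable_F: "0 \<le> s \<Longrightarrow> s \<le> t \<Longrightarrow> W s \<in> borel_measurable (F t)"
  using brownian measurable_F_mono unfolding brownian_motion_def adapted_def by blast

lemma W_measurable: "0 \<le> s \<Longrightarrow> W s \<in> borel_measurable M"
  using W_measurable_F measurable_F_M by blast

lemma W_increment_distributed:
  "0 \<le> s \<Longrightarrow> s < t \<Longrightarrow> distributed M lborel (\<lambda>\<omega>. W t \<omega> - W s \<omega>)
      (\<lambda>x. ennreal (\<Prod>i\<in>UNIV. normal_density 0 (sqrt (t - s)) (x $ i)))"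
  using brownian unfolding brownian_motion_def by blast

lemma nn_integral_W_increment_prod:
  assumes "0 \<le> s" "s < t" and g: "\<And>i. g i \<in> borel_measurable borel"
  shows "(\<integral>\<^sup>+\<omega>. (\<Prod>i\<in>UNIV. g i ((W t \<omega> - W s \<omega>) $ i)) \<partial>M) =
    (\<Prod>i\<in>UNIV. \<integral>\<^sup>+x. ennreal (normal_density 0 (sqrt (t - s)) x) * g i x \<partial>lborel)"
proof -
  note [measurable] = g
  \<comment> \<open>Fubini for \<open>lborel\<close> indexes the factors by basis vectors rather
    than coordinates; the choice operator recovers the coordinate, uniquely because
    \<open>axis\<close> is injective.\<close>
  define h where "h b x = ennreal (normal_density 0 (sqrt (t - s)) x) * g (SOME i. b = axis i 1) x"
    for b :: "real^'n" and x
  have h: "h (axis i 1) x = ennreal (normal_density 0 (sqrt (t - s)) x) * g i x" for i x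
    by (simp add: h_def axis_eq_axis)
  have "(\<integral>\<^sup>+\<omega>. (\<Prod>i\<in>UNIV. g i ((W t \<omega> - W s \<omega>) $ i)) \<partial>M) =
     (\<integral>\<^sup>+x. ennreal (\<Prod>i\<in>UNIV. normal_density 0 (sqrt (t - s)) (x $ i)) * (\<Prod>i\<in>UNIV. g i (x $ i)) \<partial>lborel)"
    by (rule distributed_nn_integral[OF W_increment_distributed, symmetric]) (use assms in auto)
  also have "\<dots> = (\<integral>\<^sup>+x. (\<Prod>b\<in>Basis. h b (x \<bullet> b)) \<partial>lborel)"
    by (simp add: prod_Basis_cart h inner_axis prod.distrib prod_ennreal)
  also have "\<dots> = (\<Prod>b\<in>Basis. \<integral>\<^sup>+x. h b x \<partial>lborel)"
    by (rule nn_integral_lborel_prod) (auto simp: h_def)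
  finally show ?thesis unfolding prod_Basis_cart h .
qed

lemma W_component_distributed:
  assumes "0 \<le> s" "s < t"
  shows "distributed M lborel (\<lambda>\<omega>. (W t \<omega> - W s \<omega>) $ a) (normal_density 0 (sqrt (t - s)))"
  unfolding distributed_def
proof (intro conjI)
  have [measurable]: "W t \<in> borel_measurable M" "W s \<in> borel_measurable M"
    using assms W_measurable by auto
  show meas: "(\<lambda>\<omega>. (W t \<omega> - W s \<omega>) $ a) \<in> measurable M lborel"
    unfolding measurable_lborel1
    by (rule measurable_compose[OF borel_measurable_diff borel_measurable_nth]) measurable
  show "distr M lborel (\<lambda>\<omega>. (W t \<omega> - W s \<omega>) $ a) = density lborel (normal_density 0 (sqrt (t - s)))"
  proof (rule measure_eqI)
    fix A assume "A \<in> sets (distr M lborel (\<lambda>\<omega>. (W t \<omega> - W s \<omega>) $ a))"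
    then have [measurable]: "A \<in> sets borel" by simp
    \<comment> \<open>Only coordinate a is tested; each of the other factors integrates to the total
      mass 1 of a normal density.\<close>
    define g where "g i x = (if i = a then indicator A x else 1 :: ennreal)" for i :: 'n and x :: real
    have total: "(\<integral>\<^sup>+x. ennreal (normal_density 0 (sqrt (t - s)) x) \<partial>lborel) = 1"
      using prob_space.emeasure_space_1[OF prob_space_normal_density[of "sqrt (t - s)" 0]] assms
      by (simp add: emeasure_density)
    have "emeasure (distr M lborel (\<lambda>\<omega>. (W t \<omega> - W s \<omega>) $ a)) A
        = (\<integral>\<^sup>+\<omega>. indicator A ((W t \<omega> - W s \<omega>) $ a) \<partial>M)"
      using meas by (subst nn_integral_distr[of _ M lborel "indicator A", symmetric]) auto
    also have "\<dots> = (\<integral>\<^sup>+\<omega>. (\<Prod>i\<in>UNIV. g i ((W t \<omega> - W s \<omega>) $ i)) \<partial>M)"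
      by (intro nn_integral_cong) (simp add: g_def prod.delta)
    also have "\<dots> = (\<Prod>i\<in>UNIV. \<integral>\<^sup>+x. ennreal (normal_density 0 (sqrt (t - s)) x) * g i x \<partial>lborel)"
      by (rule nn_integral_W_increment_prod) (use assms in \<open>auto simp: g_def\<close>)
    also have "\<dots> = (\<Prod>i\<in>UNIV. if i = a then
        \<integral>\<^sup>+x. ennreal (normal_density 0 (sqrt (t - s)) x) * indicator A x \<partial>lborel else 1)"
      by (intro prod.cong) (auto simp: g_def total)
    also have "\<dots> = (\<integral>\<^sup>+x. ennreal (normal_density 0 (sqrt (t - s)) x) * indicator A x \<partial>lborel)"
      by (simp add: prod.delta)
    finally show "emeasure (distr M lborel (\<lambda>\<omega>. (W t \<omega> - W s \<omega>) $ a)) A =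
        emeasure (density lborel (normal_density 0 (sqrt (t - s)))) A"
      by (simp add: emeasure_density)
  qed simp
qed simp

lemma W_component_moments:
  assumes "0 \<le> s" "s \<le> t"
  shows "integrable M (\<lambda>\<omega>. (W t \<omega> - W s \<omega>) $ a)" "expectation (\<lambda>\<omega>. (W t \<omega> - W s \<omega>) $ a) = 0"
    "integrable M (\<lambda>\<omega>. ((W t \<omega> - W s \<omega>) $ a)\<^sup>2)" "expectation (\<lambda>\<omega>. ((W t \<omega> - W s \<omega>) $ a)\<^sup>2) = t - s"
proof -
  let ?n = "normal_density 0 (sqrt (t - s))"
  have "integrable M (\<lambda>\<omega>. (W t \<omega> - W s \<omega>) $ a) \<and> expectation (\<lambda>\<omega>. (W t \<omega> - W s \<omega>) $ a) = 0 \<and>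
    integrable M (\<lambda>\<omega>. ((W t \<omega> - W s \<omega>) $ a)\<^sup>2) \<and> expectation (\<lambda>\<omega>. ((W t \<omega> - W s \<omega>) $ a)\<^sup>2) = t - s"
  proof (cases "s = t")
    case False
    then have st: "s < t" using assms by simp
    note D = W_component_distributed[OF assms(1) st, of a]
    have 1: "integrable lborel (\<lambda>x. ?n x * x)" "(LINT x|lborel. ?n x * x) = 0"
      using integrable_normal_moment_nz_1[of "sqrt (t-s)" 0] integral_normal_moment_nz_1[of "sqrt (t-s)" 0] st by auto
    have 2: "integrable lborel (\<lambda>x. ?n x * x\<^sup>2)"
      using integrable_normal_moment[of "sqrt (t-s)" 0 2] st by auto
    have 3: "(LINT x|lborel. ?n x * x\<^sup>2) = t - s"
      using integral_normal_moment_even[of "sqrt (t-s)" 0 1] st by (simp add: fact_2 power_divide)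
    show ?thesis
      using distributed_integrable[OF D, of "\<lambda>x. x"] distributed_integral[OF D, of "\<lambda>x. x"]
        distributed_integrable[OF D, of "\<lambda>x. x\<^sup>2"] distributed_integral[OF D, of "\<lambda>x. x\<^sup>2"] 1 2 3
      by simp
  qed simp
  then show "integrable M (\<lambda>\<omega>. (W t \<omega> - W s \<omega>) $ a)" "expectation (\<lambda>\<omega>. (W t \<omega> - W s \<omega>) $ a) = 0"
    "integrable M (\<lambda>\<omega>. ((W t \<omega> - W s \<omega>) $ a)\<^sup>2)" "expectation (\<lambda>\<omega>. ((W t \<omega> - W s \<omega>) $ a)\<^sup>2) = t - s"
    by blast+
qed

lemma W_increment_second_moment:
  fixes s t :: real
  assumes "0 \<le> s" "s \<le> t"
  shows "integrable M (\<lambda>\<omega>. (norm (W t \<omega> - W s \<omega>))\<^sup>2)"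
    "expectation (\<lambda>\<omega>. (norm (W t \<omega> - W s \<omega>))\<^sup>2) = real CARD('n) * (t - s)"
proof -
  have *: "(\<lambda>\<omega>. (norm (W t \<omega> - W s \<omega>))\<^sup>2) = (\<lambda>\<omega>. \<Sum>a\<in>UNIV. ((W t \<omega> - W s \<omega>) $ a)\<^sup>2)"
    by (simp add: norm_vec_def L2_set_def sum_nonneg)
  show "integrable M (\<lambda>\<omega>. (norm (W t \<omega> - W s \<omega>))\<^sup>2)"
    unfolding * by (intro Bochner_Integration.integrable_sum W_component_moments assms)
  show "expectation (\<lambda>\<omega>. (norm (W t \<omega> - W s \<omega>))\<^sup>2) = real CARD('n) * (t - s)"
    unfolding * by (subst Bochner_Integration.integral_sum) (auto simp del: vector_minus_component intro: W_component_moments assms simp: W_component_moments assms)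
qed

text \<open>This takes the place of conditional expectations: a factor known at time s splits off
  from any function of the later increment.\<close>

lemma W_increment_indep:
  assumes "0 \<le> s" "s \<le> t" and z: "z \<in> borel_measurable (F s)" and g: "g \<in> borel_measurable borel"
    and "integrable M z" "integrable M (\<lambda>\<omega>. g (W t \<omega> - W s \<omega>))"
  shows "integrable M (\<lambda>\<omega>. z \<omega> * g (W t \<omega> - W s \<omega>) :: real)"
    "expectation (\<lambda>\<omega>. z \<omega> * g (W t \<omega> - W s \<omega>)) = expectation z * expectation (\<lambda>\<omega>. g (W t \<omega> - W s \<omega>))"
proof -
  have "integrable M (\<lambda>\<omega>. z \<omega> * g (W t \<omega> - W s \<omega>)) \<and>
    expectation (\<lambda>\<omega>. z \<omega> * g (W t \<omega> - W s \<omega>)) = expectation z * expectation (\<lambda>\<omega>. g (W t \<omega> - W s \<omega>))"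
  proof (cases "s = t")
    case True
    then show ?thesis using assms(5) by (simp add: prob_space)
  next
    case False
    then have st: "s < t" using assms by simp
    have [measurable]: "W s \<in> borel_measurable M" "W t \<in> borel_measurable M"
      using assms W_measurable by auto
    note [measurable] = g
    let ?D = "\<lambda>\<omega>. W t \<omega> - W s \<omega>"
    have D: "?D \<in> borel_measurable M" by measurable
    have ind: "indep_set (sets (F s)) {?D -` B \<inter> space M | B. B \<in> sets borel}"
      using brownian assms(1) st unfolding brownian_motion_def by blast
    have sub1: "sigma_sets (space M) {z -` A \<inter> space M | A. A \<in> sets borel} \<subseteq> sets (F s)"
      using sets.sigma_sets_subset[of "{z -` A \<inter> space M | A. A \<in> sets borel}" "F s"]
        measurable_sets[OF z] space_F[OF assms(1)] by auto
    have sub2: "sigma_sets (space M) {(\<lambda>\<omega>. g (?D \<omega>)) -` A \<inter> space M | A. A \<in> sets borel}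
       \<subseteq> {?D -` B \<inter> space M | B. B \<in> sets borel}"
    proof -
      \<comment> \<open>Preimages of Borel sets already form a sigma-algebra, so the family
        appearing in \<open>brownian_motion\<close> is its own generated sigma-algebra.\<close>
      have "{?D -` B \<inter> space M | B. B \<in> sets borel} = sigma_sets (space M) {?D -` B \<inter> space M | B. B \<in> sets borel}"
        using sigma_sets_vimage_commute[of ?D "space M" UNIV "sets borel"]
          sets.sigma_sets_eq[of "borel :: (real^'n) measure"] by simp
      moreover have "sigma_sets (space M) {(\<lambda>\<omega>. g (?D \<omega>)) -` A \<inter> space M | A. A \<in> sets borel}
        \<subseteq> sigma_sets (space M) {?D -` B \<inter> space M | B. B \<in> sets borel}"
      proof (rule sigma_sets_mono')
        show "{(\<lambda>\<omega>. g (?D \<omega>)) -` A \<inter> space M | A. A \<in> sets borel} \<subseteq> {?D -` B \<inter> space M | B. B \<in> sets borel}"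
        proof clarify
          fix A :: "real set" assume "A \<in> sets borel"
          then have "g -` A \<in> sets borel" using measurable_sets[OF g] by simp
          then show "\<exists>B. (\<lambda>\<omega>. g (?D \<omega>)) -` A \<inter> space M = ?D -` B \<inter> space M \<and> B \<in> sets borel"
            by (intro exI[of _ "g -` A"]) auto
        qed
      qed
      ultimately show ?thesis by simp
    qed
    have "indep_var borel z borel (\<lambda>\<omega>. g (?D \<omega>))"
      unfolding indep_var_eq
    proof (intro conjI)
      show "random_variable borel z" using z assms(1) measurable_F_M by blast
      show "random_variable borel (\<lambda>\<omega>. g (?D \<omega>))" using D by measurable
      show "indep_set (sigma_sets (space M) {z -` A \<inter> space M | A. A \<in> sets borel})
        (sigma_sets (space M) {(\<lambda>\<omega>. g (?D \<omega>)) -` A \<inter> space M | A. A \<in> sets borel})"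
        using ind unfolding indep_set_def
        by (rule indep_sets_mono_sets) (use sub1 sub2 in \<open>auto split: bool.split\<close>)
    qed
    then show ?thesis
      using indep_var_integrable indep_var_lebesgue_integral assms(5,6) by blast
  qed
  then show "integrable M (\<lambda>\<omega>. z \<omega> * g (W t \<omega> - W s \<omega>))"
    "expectation (\<lambda>\<omega>. z \<omega> * g (W t \<omega> - W s \<omega>)) = expectation z * expectation (\<lambda>\<omega>. g (W t \<omega> - W s \<omega>))"
    by blast+
qed

text \<open>Half of the Ito isometry. Cross terms vanish because a later increment is centred and
  independent of the past; a diagonal term is bounded by the squared norm of the matrix times that
  of the increment. This crude bound costs the factor \<open>CARD('n)\<close> but avoids mixed
  moments of the components.\<close>

lemma discrete_integral_L2:
  fixes \<sigma> :: "nat \<Rightarrow> real" and \<zeta> :: "nat \<Rightarrow> 'w \<Rightarrow> real^'n^'m"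
  defines "Y \<equiv> \<lambda>m \<omega>. \<Sum>i<m. \<zeta> i \<omega> *v (W (\<sigma> (Suc i)) \<omega> - W (\<sigma> i) \<omega>)"
  assumes \<sigma>0: "0 \<le> \<sigma> 0" and mono: "\<And>i. i < m \<Longrightarrow> \<sigma> i \<le> \<sigma> (Suc i)"
    and \<zeta>: "\<And>i. i < m \<Longrightarrow> \<zeta> i \<in> borel_measurable (F (\<sigma> i))"
    and bnd: "\<And>i. i < m \<Longrightarrow> bounded (\<zeta> i ` space M)"
  shows "0 \<le> \<sigma> m \<and> Y m \<in> borel_measurable (F (\<sigma> m)) \<and> integrable M (\<lambda>\<omega>. (norm (Y m \<omega>))\<^sup>2) \<and>
    expectation (\<lambda>\<omega>. (norm (Y m \<omega>))\<^sup>2) \<le>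
      CARD('n) * expectation (\<lambda>\<omega>. \<Sum>i<m. (norm (\<zeta> i \<omega>))\<^sup>2 * (\<sigma> (Suc i) - \<sigma> i))"
  using mono \<zeta> bnd
proof (induction m)
  case 0
  then show ?case using \<sigma>0 by (simp add: Y_def)
next
  case (Suc m)
  then have IH: "0 \<le> \<sigma> m" "Y m \<in> borel_measurable (F (\<sigma> m))" "integrable M (\<lambda>\<omega>. (norm (Y m \<omega>))\<^sup>2)"
    "expectation (\<lambda>\<omega>. (norm (Y m \<omega>))\<^sup>2) \<le>
      CARD('n) * expectation (\<lambda>\<omega>. \<Sum>i<m. (norm (\<zeta> i \<omega>))\<^sup>2 * (\<sigma> (Suc i) - \<sigma> i))"
    by auto
  have st: "\<sigma> m \<le> \<sigma> (Suc m)" using Suc.prems by simp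
  have i_nonneg: "0 \<le> \<sigma> i" if "i \<le> m" for i
    using that
  proof (induction i)
    case (Suc i)
    then show ?case using Suc.prems \<open>\<And>i. i < Suc m \<Longrightarrow> \<sigma> i \<le> \<sigma> (Suc i)\<close>[of i] by simp
  qed (use \<sigma>0 in simp)
  define D where "D \<omega> = W (\<sigma> (Suc m)) \<omega> - W (\<sigma> m) \<omega>" for \<omega>
  have zF[measurable]: "\<zeta> m \<in> borel_measurable (F (\<sigma> m))" using Suc.prems by simp
  have zM[measurable]: "\<zeta> m \<in> borel_measurable M" using zF IH(1) measurable_F_M by blast
  have YM[measurable]: "Y m \<in> borel_measurable M" using IH(1,2) measurable_F_M by blast
  have DM[measurable]: "D \<in> borel_measurable M"
    unfolding D_def using IH(1) st by (intro borel_measurable_diff W_measurable) auto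
  obtain B where B: "\<And>\<omega>. \<omega> \<in> space M \<Longrightarrow> norm (\<zeta> m \<omega>) \<le> B" 
    using Suc.prems(3)[of m] unfolding bounded_iff by auto
  have D2: "integrable M (\<lambda>\<omega>. (norm (D \<omega>))\<^sup>2)"
    "expectation (\<lambda>\<omega>. (norm (D \<omega>))\<^sup>2) = CARD('n) * (\<sigma> (Suc m) - \<sigma> m)"
    unfolding D_def using W_increment_second_moment[OF IH(1) st] by auto
  have z2: "integrable M (\<lambda>\<omega>. (norm (\<zeta> m \<omega>))\<^sup>2)"
    by (rule Bochner_Integration.integrable_bound[of _ "\<lambda>_. B\<^sup>2"])
      (auto intro!: AE_I2 power_mono B)
  have zD: "integrable M (\<lambda>\<omega>. (norm (\<zeta> m \<omega>))\<^sup>2 * (norm (D \<omega>))\<^sup>2)"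
    "expectation (\<lambda>\<omega>. (norm (\<zeta> m \<omega>))\<^sup>2 * (norm (D \<omega>))\<^sup>2)
      = expectation (\<lambda>\<omega>. (norm (\<zeta> m \<omega>))\<^sup>2) * (CARD('n) * (\<sigma> (Suc m) - \<sigma> m))"
    using W_increment_indep[OF IH(1) st, of "\<lambda>\<omega>. (norm (\<zeta> m \<omega>))\<^sup>2" "\<lambda>x. (norm x)\<^sup>2"] z2 D2
    unfolding D_def by auto
  have Z2: "integrable M (\<lambda>\<omega>. (norm (\<zeta> m \<omega> *v D \<omega>))\<^sup>2)"
    by (rule Bochner_Integration.integrable_bound[OF zD(1)])
      (auto simp flip: power_mult_distrib intro!: AE_I2 power_mono norm_matrix_vector_mult_le)
  have Z2': "expectation (\<lambda>\<omega>. (norm (\<zeta> m \<omega> *v D \<omega>))\<^sup>2)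
      \<le> CARD('n) * expectation (\<lambda>\<omega>. (norm (\<zeta> m \<omega>))\<^sup>2 * (\<sigma> (Suc m) - \<sigma> m))"
  proof -
    have "expectation (\<lambda>\<omega>. (norm (\<zeta> m \<omega> *v D \<omega>))\<^sup>2) \<le> expectation (\<lambda>\<omega>. (norm (\<zeta> m \<omega>))\<^sup>2 * (norm (D \<omega>))\<^sup>2)"
      by (rule integral_mono[OF Z2 zD(1)])
        (auto simp flip: power_mult_distrib intro!: power_mono norm_matrix_vector_mult_le)
    also have "\<dots> = CARD('n) * expectation (\<lambda>\<omega>. (norm (\<zeta> m \<omega>))\<^sup>2 * (\<sigma> (Suc m) - \<sigma> m))"
      by (simp add: zD(2))
    finally show ?thesis .
  qed
  \<comment> \<open>The coefficient of component a of the new increment in the cross term. It is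
    known at time \<open>\<sigma> m\<close>, so its product with the centred increment has
    expectation 0.\<close>
  define z where "z a \<omega> = (\<Sum>i\<in>UNIV. Y m \<omega> $ i * \<zeta> m \<omega> $ i $ a)" for a \<omega>
  have zF': "z a \<in> borel_measurable (F (\<sigma> m))" for a
    using IH(2) zF unfolding z_def
    by (intro borel_measurable_sum borel_measurable_times borel_measurable_vec_nth) auto
  have Y1: "integrable M (\<lambda>\<omega>. norm (Y m \<omega>))"
  proof (rule Bochner_Integration.integrable_bound[of _ "\<lambda>\<omega>. 1 + (norm (Y m \<omega>))\<^sup>2"])
    have "x \<le> 1 + x\<^sup>2" if "x \<ge> 0" for x :: real
      using zero_le_power2[of "x - 1"] that by (simp add: power2_diff)
    then show "AE \<omega> in M. norm (norm (Y m \<omega>)) \<le> norm (1 + (norm (Y m \<omega>))\<^sup>2)" by auto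
  qed (use IH(3) in auto)
  have zi: "integrable M (z a)" for a
    unfolding z_def
  proof (intro Bochner_Integration.integrable_sum)
    fix i
    show "integrable M (\<lambda>\<omega>. Y m \<omega> $ i * \<zeta> m \<omega> $ i $ a)"
    proof (rule Bochner_Integration.integrable_bound[of _ "\<lambda>\<omega>. norm (Y m \<omega>) * B"])
      show "AE \<omega> in M. norm (Y m \<omega> $ i * \<zeta> m \<omega> $ i $ a) \<le> norm (norm (Y m \<omega>) * B)"
      proof (rule AE_I2)
        fix \<omega> assume w: "\<omega> \<in> space M"
        have "\<bar>\<zeta> m \<omega> $ i $ a\<bar> \<le> norm (\<zeta> m \<omega> $ i)" by (rule component_le_norm_cart)
        also have "\<dots> \<le> norm (\<zeta> m \<omega>)" by (rule Finite_Cartesian_Product.norm_nth_le)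
        also have "\<dots> \<le> B" by (rule B[OF w])
        finally show "norm (Y m \<omega> $ i * \<zeta> m \<omega> $ i $ a) \<le> norm (norm (Y m \<omega>) * B)"
          using component_le_norm_cart[of "Y m \<omega>" i]
          by (auto simp: abs_mult intro!: mult_mono)
      qed
    qed (use Y1 in auto)
  qed
  have cross: "integrable M (\<lambda>\<omega>. Y m \<omega> \<bullet> (\<zeta> m \<omega> *v D \<omega>))" "expectation (\<lambda>\<omega>. Y m \<omega> \<bullet> (\<zeta> m \<omega> *v D \<omega>)) = 0"
  proof -
    have eq: "Y m \<omega> \<bullet> (\<zeta> m \<omega> *v D \<omega>) = (\<Sum>a\<in>UNIV. z a \<omega> * D \<omega> $ a)" for \<omega>
    proof -
      have "Y m \<omega> \<bullet> (\<zeta> m \<omega> *v D \<omega>) = (\<Sum>i\<in>UNIV. \<Sum>a\<in>UNIV. Y m \<omega> $ i * \<zeta> m \<omega> $ i $ a * D \<omega> $ a)"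
        by (simp add: inner_vec_def matrix_vector_mult_def sum_distrib_left mult.assoc)
      also have "\<dots> = (\<Sum>a\<in>UNIV. \<Sum>i\<in>UNIV. Y m \<omega> $ i * \<zeta> m \<omega> $ i $ a * D \<omega> $ a)"
        by (rule sum.swap)
      finally show ?thesis by (simp add: z_def sum_distrib_right)
    qed
    have *: "integrable M (\<lambda>\<omega>. z a \<omega> * D \<omega> $ a)" "expectation (\<lambda>\<omega>. z a \<omega> * D \<omega> $ a) = 0" for a
      using W_increment_indep[OF IH(1) st zF' _ zi, of "\<lambda>x. x $ a"] W_component_moments[OF IH(1) st, of a]
      unfolding D_def by auto
    show "integrable M (\<lambda>\<omega>. Y m \<omega> \<bullet> (\<zeta> m \<omega> *v D \<omega>))" unfolding eq by (intro Bochner_Integration.integrable_sum *)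
    show "expectation (\<lambda>\<omega>. Y m \<omega> \<bullet> (\<zeta> m \<omega> *v D \<omega>)) = 0"
      unfolding eq by (subst Bochner_Integration.integral_sum) (auto simp: *)
  qed
  have YS: "Y (Suc m) \<omega> = Y m \<omega> + \<zeta> m \<omega> *v D \<omega>" for \<omega> by (simp add: Y_def D_def)
  have sq: "(norm (Y (Suc m) \<omega>))\<^sup>2 = (norm (Y m \<omega>))\<^sup>2 + 2 * (Y m \<omega> \<bullet> (\<zeta> m \<omega> *v D \<omega>)) + (norm (\<zeta> m \<omega> *v D \<omega>))\<^sup>2" for \<omega>
    unfolding YS by (simp add: power2_norm_eq_inner inner_add_left inner_add_right inner_commute)
  have sumint: "integrable M (\<lambda>\<omega>. \<Sum>i<m. (norm (\<zeta> i \<omega>))\<^sup>2 * (\<sigma> (Suc i) - \<sigma> i))"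
  proof (intro Bochner_Integration.integrable_sum integrable_mult_left)
    fix i assume i: "i \<in> {..<m}"
    obtain B where B: "\<And>\<omega>. \<omega> \<in> space M \<Longrightarrow> norm (\<zeta> i \<omega>) \<le> B" 
      using Suc.prems(3)[of i] i unfolding bounded_iff by auto
    have [measurable]: "\<zeta> i \<in> borel_measurable M"
      using Suc.prems(2)[of i] i i_nonneg[of i] measurable_F_M by auto
    show "integrable M (\<lambda>\<omega>. (norm (\<zeta> i \<omega>))\<^sup>2)"
    proof (rule Bochner_Integration.integrable_bound)
      show "integrable M (\<lambda>_. B\<^sup>2)" by simp
      show "AE \<omega> in M. norm ((norm (\<zeta> i \<omega>))\<^sup>2) \<le> norm (B\<^sup>2)"
        using B by (intro AE_I2) (simp add: power_mono)
    qed measurable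
  qed
  have "integrable M (\<lambda>\<omega>. (norm (Y (Suc m) \<omega>))\<^sup>2)"
    unfolding sq using IH(3) cross(1) Z2 by auto
  moreover have "expectation (\<lambda>\<omega>. (norm (Y (Suc m) \<omega>))\<^sup>2)
     = expectation (\<lambda>\<omega>. (norm (Y m \<omega>))\<^sup>2) + expectation (\<lambda>\<omega>. (norm (\<zeta> m \<omega> *v D \<omega>))\<^sup>2)"
    unfolding sq using IH(3) cross Z2 by simp
  moreover have "Y (Suc m) \<in> borel_measurable (F (\<sigma> (Suc m)))"
  proof -
    have [measurable]: "Y m \<in> borel_measurable (F (\<sigma> (Suc m)))" "\<zeta> m \<in> borel_measurable (F (\<sigma> (Suc m)))"
      "W (\<sigma> m) \<in> borel_measurable (F (\<sigma> (Suc m)))" "W (\<sigma> (Suc m)) \<in> borel_measurable (F (\<sigma> (Suc m)))"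
      using measurable_F_mono[OF IH(1) st IH(2)] measurable_F_mono[OF IH(1) st zF]
        W_measurable_F[OF IH(1) st] W_measurable_F[of "\<sigma> (Suc m)" "\<sigma> (Suc m)"] IH(1) st by auto
    have "(\<lambda>\<omega>. Y m \<omega> + \<zeta> m \<omega> *v (W (\<sigma> (Suc m)) \<omega> - W (\<sigma> m) \<omega>)) \<in> borel_measurable (F (\<sigma> (Suc m)))"
      by measurable
    then show ?thesis using YS unfolding D_def by presburger
  qed
  ultimately show ?case
    using IH(1,4) st Z2' z2 sumint by (simp add: distrib_left)
qed

text \<open>Cutting the integrand off as soon as its squared norm exceeds \<open>\<delta>\<close> keeps it adapted, because the sum up to
  and including the interval from \<open>\<sigma> i\<close> to \<open>\<sigma> (Suc i)\<close> is already known at time \<open>\<sigma> i\<close>.\<close>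

lemma discrete_integral_tail:
  fixes \<sigma> :: "nat \<Rightarrow> real" and \<delta> \<epsilon> :: real and \<zeta> :: "nat \<Rightarrow> 'w \<Rightarrow> real^'n^'m"
  assumes \<sigma>0: "0 \<le> \<sigma> 0" and mono: "\<And>i. i < m \<Longrightarrow> \<sigma> i \<le> \<sigma> (Suc i)"
    and \<zeta>: "\<And>i. i < m \<Longrightarrow> \<zeta> i \<in> borel_measurable (F (\<sigma> i))"
    and bnd: "\<And>i. i < m \<Longrightarrow> bounded (\<zeta> i ` space M)"
    and "0 < \<epsilon>" "0 \<le> \<delta>"
  shows "prob {\<omega> \<in> space M. \<epsilon> < norm (\<Sum>i<m. \<zeta> i \<omega> *v (W (\<sigma> (Suc i)) \<omega> - W (\<sigma> i) \<omega>)) \<and>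
      (\<Sum>i<m. (norm (\<zeta> i \<omega>))\<^sup>2 * (\<sigma> (Suc i) - \<sigma> i)) \<le> \<delta>} \<le> CARD('n) * \<delta> / \<epsilon>\<^sup>2"
proof -
  let ?S = "\<lambda>\<zeta> \<omega>. \<Sum>i<m. (norm (\<zeta> i \<omega>))\<^sup>2 * (\<sigma> (Suc i) - \<sigma> i)"
  define Q where "Q k \<omega> = (\<Sum>i<k. (norm (\<zeta> i \<omega>))\<^sup>2 * (\<sigma> (Suc i) - \<sigma> i))" for k \<omega>
  define \<zeta>' where "\<zeta>' i \<omega> = (if Q (Suc i) \<omega> \<le> \<delta> then \<zeta> i \<omega> else 0)" for i \<omega>
  define Y where "Y \<omega> = (\<Sum>i<m. \<zeta>' i \<omega> *v (W (\<sigma> (Suc i)) \<omega> - W (\<sigma> i) \<omega>))" for \<omega>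
  note \<sigma>mono = steps_mono[of m \<sigma>, OF mono]
  have \<sigma>nn: "0 \<le> \<sigma> i" if "i \<le> m" for i using \<sigma>mono[of 0 i] \<sigma>0 that by simp
  have QF: "Q (Suc i) \<in> borel_measurable (F (\<sigma> i))" if "i < m" for i
    unfolding Q_def
  proof (intro borel_measurable_sum)
    fix j assume "j \<in> {..<Suc i}"
    then have "\<zeta> j \<in> borel_measurable (F (\<sigma> i))"
      using measurable_F_mono[OF \<sigma>nn \<sigma>mono \<zeta>, of j i] that by auto
    then show "(\<lambda>\<omega>. (norm (\<zeta> j \<omega>))\<^sup>2 * (\<sigma> (Suc j) - \<sigma> j)) \<in> borel_measurable (F (\<sigma> i))" by measurable
  qed
  have \<zeta>'F: "\<zeta>' i \<in> borel_measurable (F (\<sigma> i))" if "i < m" for i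
    using QF[OF that] \<zeta>[OF that] unfolding \<zeta>'_def by measurable
  have \<zeta>'b: "bounded (\<zeta>' i ` space M)" if "i < m" for i
  proof -
    obtain B where "\<And>\<omega>. \<omega> \<in> space M \<Longrightarrow> norm (\<zeta> i \<omega>) \<le> B"
      using bnd[OF \<open>i < m\<close>] unfolding bounded_iff by auto
    then have "norm (\<zeta>' i \<omega>) \<le> max B 0" if "\<omega> \<in> space M" for \<omega>
      using that by (simp add: \<zeta>'_def le_max_iff_disj)
    then show ?thesis unfolding bounded_iff by blast
  qed
  \<comment> \<open>Once the running sum has passed \<delta>, the cut-off integrand contributes
    nothing more; before that, the cut-off sum is dominated by the running sum.\<close>
  have le: "(\<Sum>i<k. (norm (\<zeta>' i \<omega>))\<^sup>2 * (\<sigma> (Suc i) - \<sigma> i)) \<le> \<delta>" if "k \<le> m" for k \<omega>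
    using that
  proof (induction k)
    case (Suc k)
    show ?case
    proof (cases "Q (Suc k) \<omega> \<le> \<delta>")
      case True
      have "(\<Sum>i<Suc k. (norm (\<zeta>' i \<omega>))\<^sup>2 * (\<sigma> (Suc i) - \<sigma> i)) \<le> Q (Suc k) \<omega>"
        unfolding Q_def using Suc.prems mono
        by (intro sum_mono mult_right_mono) (auto simp: \<zeta>'_def)
      then show ?thesis using True by simp
    next
      case False
      then show ?thesis using Suc by (simp add: \<zeta>'_def)
    qed
  qed (use \<open>0 \<le> \<delta>\<close> in simp)
  have L2: "Y \<in> borel_measurable (F (\<sigma> m))" "integrable M (\<lambda>\<omega>. (norm (Y \<omega>))\<^sup>2)"
    "expectation (\<lambda>\<omega>. (norm (Y \<omega>))\<^sup>2) \<le> CARD('n) * expectation (\<lambda>\<omega>. ?S \<zeta>' \<omega>)"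
    using discrete_integral_L2[of \<sigma> m \<zeta>', OF \<sigma>0 mono \<zeta>'F \<zeta>'b] unfolding Y_def by auto
  note L2(3)
  also have "CARD('n) * expectation (\<lambda>\<omega>. ?S \<zeta>' \<omega>) \<le> CARD('n) * \<delta>"
  proof (intro mult_left_mono)
    have m: "(\<lambda>\<omega>. ?S \<zeta>' \<omega>) \<in> borel_measurable M"
      using measurable_F_M[OF \<sigma>nn \<zeta>'F]
      by (intro borel_measurable_sum borel_measurable_times borel_measurable_power borel_measurable_norm) auto
    have "integrable M (\<lambda>\<omega>. ?S \<zeta>' \<omega>)"
    proof (rule Bochner_Integration.integrable_bound[OF _ m])
      show "integrable M (\<lambda>_. \<delta>)" by simp
      have "0 \<le> (?S \<zeta>' \<omega>)" for \<omega>
        using mono by (intro sum_nonneg mult_nonneg_nonneg) auto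
      then show "AE \<omega> in M. norm (?S \<zeta>' \<omega>) \<le> norm \<delta>"
        using le[of m] \<open>0 \<le> \<delta>\<close> by (simp only: real_norm_def abs_of_nonneg) simp
    qed
    then show "expectation (\<lambda>\<omega>. ?S \<zeta>' \<omega>) \<le> \<delta>"
      using integral_mono[of M _ "\<lambda>_. \<delta>"] le[of m] by (simp add: prob_space)
  qed simp
  finally have E: "expectation (\<lambda>\<omega>. (norm (Y \<omega>))\<^sup>2) \<le> CARD('n) * \<delta>" .
  have YM[measurable]: "Y \<in> borel_measurable M" using L2(1) measurable_F_M \<sigma>nn by blast
  have "prob {\<omega> \<in> space M. \<epsilon> < norm (\<Sum>i<m. \<zeta> i \<omega> *v (W (\<sigma> (Suc i)) \<omega> - W (\<sigma> i) \<omega>)) \<and>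
      Q m \<omega> \<le> \<delta>} \<le> prob {\<omega> \<in> space M. \<epsilon>\<^sup>2 \<le> (norm (Y \<omega>))\<^sup>2}"
  proof (intro finite_measure_mono subsetI)
    fix \<omega> assume w: "\<omega> \<in> {\<omega> \<in> space M. \<epsilon> < norm (\<Sum>i<m. \<zeta> i \<omega> *v (W (\<sigma> (Suc i)) \<omega> - W (\<sigma> i) \<omega>)) \<and> Q m \<omega> \<le> \<delta>}"
    \<comment> \<open>The running sum is nondecreasing in its index, so a final value of at most
      \<delta> means that the cut-off never acted. On this event Y is the original sum, and
      Chebyshev's inequality applies.\<close>
    have "\<zeta>' i \<omega> = \<zeta> i \<omega>" if "i < m" for i
    proof -
      have "Q (Suc i) \<omega> \<le> Q m \<omega>"
        unfolding Q_def using that mono by (intro sum_mono2) auto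
      then show ?thesis using w by (simp add: \<zeta>'_def)
    qed
    then have "Y \<omega> = (\<Sum>i<m. \<zeta> i \<omega> *v (W (\<sigma> (Suc i)) \<omega> - W (\<sigma> i) \<omega>))"
      by (simp add: Y_def)
    then have "\<epsilon> < norm (Y \<omega>)" using w by simp
    then show "\<omega> \<in> {\<omega> \<in> space M. \<epsilon>\<^sup>2 \<le> (norm (Y \<omega>))\<^sup>2}" using w \<open>0 < \<epsilon>\<close> by (auto intro!: power_mono)
  qed measurable
  also have "\<dots> \<le> expectation (\<lambda>\<omega>. (norm (Y \<omega>))\<^sup>2) / \<epsilon>\<^sup>2"
    by (rule integral_Markov_inequality_measure[OF L2(2), of "{}"]) (use \<open>0 < \<epsilon>\<close> in auto)
  also have "\<dots> \<le> CARD('n) * \<delta> / \<epsilon>\<^sup>2" using E by (rule divide_right_mono) simp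
  finally show ?thesis unfolding Q_def .
qed

end

section \<open>Tail inequality for the Ito integral\<close>

lemma simple_process_eq:
  assumes "\<And>i. i < n \<Longrightarrow> \<tau> i \<le> \<tau> (Suc i)" "i < n" "s \<in> {\<tau> i<..\<tau> (Suc i)}"
  shows "simple_process n \<tau> \<xi> s \<omega> = \<xi> i \<omega>"
proof -
  have "indicat_real {\<tau> j<..\<tau> (Suc j)} s *\<^sub>R \<xi> j \<omega> = (if j = i then \<xi> i \<omega> else 0)" if "j < n" for j
    using steps_interval_unique[of n \<tau> j i s, OF assms(1) that assms(2) _ assms(3)] assms(3)
    by (cases "j = i") (auto simp: indicator_def)
  then have "simple_process n \<tau> \<xi> s \<omega> = (\<Sum>j<n. if j = i then \<xi> i \<omega> else 0)"
    unfolding simple_process_def by (intro sum.cong) auto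
  then show ?thesis using assms by simp
qed

lemma simple_process_eq_0:
  assumes "\<And>i. i < n \<Longrightarrow> \<tau> i \<le> \<tau> (Suc i)" "s \<le> \<tau> 0 \<or> \<tau> n < s"
  shows "simple_process n \<tau> \<xi> s \<omega> = 0"
proof -
  have "indicat_real {\<tau> j<..\<tau> (Suc j)} s = 0" if "j < n" for j
    using steps_mono[of n \<tau> 0 j, OF assms(1)] steps_mono[of n \<tau> "Suc j" n, OF assms(1)] assms(2) that
    by (auto simp: indicator_def)
  then show ?thesis unfolding simple_process_def by simp
qed

lemma borel_measurable_simple_process:
  "(\<lambda>s. simple_process n \<tau> \<xi> s \<omega>) \<in> borel_measurable borel"
  unfolding simple_process_def by measurable

context filtered_brownian_motion
begin

text \<open>An increment over {a..b}, corrected by a constant integrand \<eta>, is again a discrete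
  integral: clip the step times to {a..b} and add the outer pieces from a to the first and from the
  last clipped time to b, where the simple process vanishes and the integrand is -\<eta>. This gives
  n + 2 steps. The conclusion provides a covering event, a form that can be combined by inclusion
  and union bounds alone.\<close>

lemma simple_integral_tail:
  fixes \<xi> :: "nat \<Rightarrow> 'w \<Rightarrow> real^'n^'m" and \<delta> \<epsilon> a b :: real
  assumes simple: "simple_integrand M F n \<tau> \<xi>" and ab: "0 \<le> a" "a \<le> b" and "0 < \<epsilon>" "0 \<le> \<delta>"
  shows "\<exists>A\<in>events. prob A \<le> CARD('n) * \<delta> / \<epsilon>\<^sup>2 \<and>
    {\<omega> \<in> space M. \<epsilon> < norm (simple_integral W n \<tau> \<xi> b \<omega> - simple_integral W n \<tau> \<xi> a \<omega> - \<eta> *v (W b \<omega> - W a \<omega>)) \<and>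
      (\<integral>\<^sup>+ s\<in>{a..b}. ennreal ((norm (simple_process n \<tau> \<xi> s \<omega> - \<eta>))\<^sup>2) \<partial>lborel) \<le> ennreal \<delta>} \<subseteq> A"
proof -
  have \<tau>0: "0 \<le> \<tau> 0" and \<tau>mono: "\<And>i. i < n \<Longrightarrow> \<tau> i \<le> \<tau> (Suc i)"
    and \<xi>: "\<And>i. i < n \<Longrightarrow> \<xi> i \<in> borel_measurable (F (\<tau> i))" "\<And>i. i < n \<Longrightarrow> bounded (\<xi> i ` space M)"
    using simple unfolding simple_integrand_def by auto
  have \<tau>nn: "0 \<le> \<tau> i" if "i \<le> n" for i
    using steps_mono[of n \<tau> 0 i, OF \<tau>mono] \<tau>0 that by simp
  define clip where "clip t = max a (min b t)" for t
  define \<sigma> where "\<sigma> j = (case j of 0 \<Rightarrow> a | Suc i \<Rightarrow> if i \<le> n then clip (\<tau> i) else b)" for j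
  \<comment> \<open>Where \<open>\<tau> i \<ge> b\<close> the interval is degenerate, and \<open>\<xi> i\<close> must be dropped as it need not be known at time \<open>b\<close>.\<close>
  define \<zeta> where "\<zeta> j \<omega> = (case j of 0 \<Rightarrow> - \<eta> | Suc i \<Rightarrow> if i < n \<and> \<tau> i < b then \<xi> i \<omega> - \<eta> else - \<eta>)" for j \<omega>
  define m where "m = Suc (Suc n)"
  have \<sigma>_simps: "\<sigma> 0 = a" "i \<le> n \<Longrightarrow> \<sigma> (Suc i) = clip (\<tau> i)" "\<sigma> (Suc (Suc n)) = b" for i
    by (auto simp: \<sigma>_def)
  have clip_mono: "s \<le> t \<Longrightarrow> clip s \<le> clip t" for s t by (auto simp: clip_def)
  have clip_bounds: "a \<le> clip t" "clip t \<le> b" for t using ab by (auto simp: clip_def)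
  have \<sigma>0: "0 \<le> \<sigma> 0" using ab by (simp add: \<sigma>_simps)
  have mono: "\<sigma> j \<le> \<sigma> (Suc j)" if "j < m" for j
    using that clip_mono[OF \<tau>mono] clip_bounds
    by (cases j) (auto simp: \<sigma>_def m_def)
  have \<zeta>F: "\<zeta> j \<in> borel_measurable (F (\<sigma> j))" if "j < m" for j
  proof (cases j)
    case (Suc i)
    show ?thesis
    proof (cases "i < n \<and> \<tau> i < b")
      case True
      then have "\<tau> i \<le> \<sigma> j" by (auto simp: Suc \<sigma>_simps clip_def)
      then have "\<xi> i \<in> borel_measurable (F (\<sigma> j))"
        using measurable_F_mono[of "\<tau> i"] \<tau>nn[of i] \<xi>(1) True by auto
      moreover have "\<zeta> j = (\<lambda>\<omega>. \<xi> i \<omega> - \<eta>)" using True by (auto simp: \<zeta>_def Suc)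
      ultimately show ?thesis by simp
    next
      case False
      then have "\<zeta> j = (\<lambda>\<omega>. - \<eta>)" by (auto simp: \<zeta>_def Suc)
      then show ?thesis by simp
    qed
  next
    case 0
    then have "\<zeta> j = (\<lambda>\<omega>. - \<eta>)" by (auto simp: \<zeta>_def)
    then show ?thesis by simp
  qed
  have \<zeta>b: "bounded (\<zeta> j ` space M)" if "j < m" for j
  proof (cases j)
    case (Suc i)
    show ?thesis
    proof (cases "i < n \<and> \<tau> i < b")
      case True
      then have "\<zeta> j ` space M = (\<lambda>x. x - \<eta>) ` (\<xi> i ` space M)" by (auto simp: \<zeta>_def Suc image_image)
      then show ?thesis using bounded_translation_minus[OF \<xi>(2)] True by simp
    next
      case False
      then have "\<zeta> j ` space M \<subseteq> {- \<eta>}" by (auto simp: \<zeta>_def Suc)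
      then show ?thesis by (rule bounded_subset[rotated]) simp
    qed
  next
    case 0
    then have "\<zeta> j ` space M \<subseteq> {- \<eta>}" by (auto simp: \<zeta>_def)
    then show ?thesis by (rule bounded_subset[rotated]) simp
  qed
  define S where "S \<omega> = (\<Sum>j<m. \<zeta> j \<omega> *v (W (\<sigma> (Suc j)) \<omega> - W (\<sigma> j) \<omega>))" for \<omega>
  define Q where "Q \<omega> = (\<Sum>j<m. (norm (\<zeta> j \<omega>))\<^sup>2 * (\<sigma> (Suc j) - \<sigma> j))" for \<omega>
  have S_eq: "S \<omega> = simple_integral W n \<tau> \<xi> b \<omega> - simple_integral W n \<tau> \<xi> a \<omega> - \<eta> *v (W b \<omega> - W a \<omega>)" for \<omega>
  proof -
    define D where "D i = W (clip (\<tau> (Suc i))) \<omega> - W (clip (\<tau> i)) \<omega>" for i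
    \<comment> \<open>For t below a both sides vanish; otherwise \<open>min a t\<close> is a and
      \<open>min b t\<close> is \<open>clip t\<close>. So the difference of the integrals up to b
      and up to a sees only the clipped times.\<close>
    have W_clip: "W (min b t) \<omega> - W (min a t) \<omega> = W (clip t) \<omega> - W a \<omega>" for t
      using ab by (auto simp: clip_def min_def max_def)
    have D_eq: "(W (min b (\<tau> (Suc i))) \<omega> - W (min b (\<tau> i)) \<omega>)
       - (W (min a (\<tau> (Suc i))) \<omega> - W (min a (\<tau> i)) \<omega>) = D i" for i
    proof -
      have "D i = (W (clip (\<tau> (Suc i))) \<omega> - W a \<omega>) - (W (clip (\<tau> i)) \<omega> - W a \<omega>)"
        by (simp add: D_def)
      then show ?thesis unfolding W_clip[symmetric] by simp
    qed
    have mid: "\<zeta> (Suc i) \<omega> *v D i = \<xi> i \<omega> *v D i - \<eta> *v D i" if "i < n" for i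
    proof (cases "\<tau> i < b")
      case True
      then show ?thesis using that by (simp add: \<zeta>_def matrix_vector_mult_diff_rdistrib)
    next
      case False
      then have "clip (\<tau> (Suc i)) = clip (\<tau> i)" using \<tau>mono[OF that] ab by (simp add: clip_def)
      then show ?thesis by (simp add: D_def)
    qed
    have minus: "(- \<eta>) *v x = - (\<eta> *v x)" for x
      using matrix_vector_mult_diff_rdistrib[of 0 \<eta> x] by simp
    have "S \<omega> = - \<eta> *v (W (clip (\<tau> 0)) \<omega> - W a \<omega>) + (\<Sum>i<n. \<zeta> (Suc i) \<omega> *v D i)
        - \<eta> *v (W b \<omega> - W (clip (\<tau> n)) \<omega>)"
      unfolding S_def m_def sum.lessThan_Suc_shift[of _ "Suc n"] sum.lessThan_Suc[of _ n]
      by (simp add: \<sigma>_simps D_def \<zeta>_def minus)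
    also have "(\<Sum>i<n. \<zeta> (Suc i) \<omega> *v D i) = (\<Sum>i<n. \<xi> i \<omega> *v D i) - (\<Sum>i<n. \<eta> *v D i)"
      using mid by (simp add: sum_subtractf)
    also have "(\<Sum>i<n. \<eta> *v D i) = \<eta> *v (\<Sum>i<n. D i)"
      by (simp add: linear_sum[OF matrix_vector_mul_linear])
    also have "(\<Sum>i<n. D i) = W (clip (\<tau> n)) \<omega> - W (clip (\<tau> 0)) \<omega>"
      unfolding D_def by (rule sum_lessThan_telescope)
    also have "(\<Sum>i<n. \<xi> i \<omega> *v D i) = simple_integral W n \<tau> \<xi> b \<omega> - simple_integral W n \<tau> \<xi> a \<omega>"
      unfolding simple_integral_def sum_subtractf[symmetric] matrix_vector_mult_diff_distrib[symmetric] D_eq ..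
    finally show ?thesis
      by (simp add: minus matrix_vector_mult_diff_distrib algebra_simps)
  qed
  \<comment> \<open>Each s lies in at most one clipped step, and there the coefficient is the simple
    process minus \<eta>. The half-open steps miss the point a, so pointwise this is only an
    inequality, in the direction required.\<close>
  have Q_le: "ennreal (Q \<omega>) \<le> (\<integral>\<^sup>+ s\<in>{a..b}. ennreal ((norm (simple_process n \<tau> \<xi> s \<omega> - \<eta>))\<^sup>2) \<partial>lborel)" for \<omega>
  proof -
    have "ennreal (Q \<omega>) = (\<Sum>j<m. ennreal ((norm (\<zeta> j \<omega>))\<^sup>2) * ennreal (\<sigma> (Suc j) - \<sigma> j))"
      unfolding Q_def using mono by (subst sum_ennreal[symmetric]) (auto simp: ennreal_mult)
    also have "\<dots> = (\<Sum>j<m. \<integral>\<^sup>+ s. ennreal ((norm (\<zeta> j \<omega>))\<^sup>2) * indicator {\<sigma> j<..\<sigma> (Suc j)} s \<partial>lborel)"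
      using mono by (intro sum.cong) (auto simp: nn_integral_cmult_indicator)
    also have "\<dots> = (\<integral>\<^sup>+ s. (\<Sum>j<m. ennreal ((norm (\<zeta> j \<omega>))\<^sup>2) * indicator {\<sigma> j<..\<sigma> (Suc j)} s) \<partial>lborel)"
      by (subst nn_integral_sum) auto
    also have "\<dots> \<le> (\<integral>\<^sup>+ s\<in>{a..b}. ennreal ((norm (simple_process n \<tau> \<xi> s \<omega> - \<eta>))\<^sup>2) \<partial>lborel)"
    proof (intro nn_integral_mono)
      fix s
      show "(\<Sum>j<m. ennreal ((norm (\<zeta> j \<omega>))\<^sup>2) * indicator {\<sigma> j<..\<sigma> (Suc j)} s)
        \<le> ennreal ((norm (simple_process n \<tau> \<xi> s \<omega> - \<eta>))\<^sup>2) * indicator {a..b} s"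
      proof (cases "\<exists>j<m. s \<in> {\<sigma> j<..\<sigma> (Suc j)}")
        case False
        then have "(\<Sum>j<m. ennreal ((norm (\<zeta> j \<omega>))\<^sup>2) * indicator {\<sigma> j<..\<sigma> (Suc j)} s) = 0"
          by (intro sum.neutral) (auto simp: indicator_def)
        then show ?thesis by simp
      next
        case True
        then obtain j where j: "j < m" "s \<in> {\<sigma> j<..\<sigma> (Suc j)}" by blast
        have "ennreal ((norm (\<zeta> i \<omega>))\<^sup>2) * indicator {\<sigma> i<..\<sigma> (Suc i)} s
           = (if i = j then ennreal ((norm (\<zeta> j \<omega>))\<^sup>2) else 0)" if "i < m" for i
          using steps_interval_unique[of m \<sigma> i j s, OF mono that j(1) _ j(2)] j(2)
          by (cases "i = j") (auto simp: indicator_def)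
        then have "(\<Sum>i<m. ennreal ((norm (\<zeta> i \<omega>))\<^sup>2) * indicator {\<sigma> i<..\<sigma> (Suc i)} s)
          = (\<Sum>i<m. if i = j then ennreal ((norm (\<zeta> j \<omega>))\<^sup>2) else 0)" by (intro sum.cong) auto
        also have "\<dots> = ennreal ((norm (\<zeta> j \<omega>))\<^sup>2)" using j by simp
        finally have sum_eq: "(\<Sum>i<m. ennreal ((norm (\<zeta> i \<omega>))\<^sup>2) * indicator {\<sigma> i<..\<sigma> (Suc i)} s)
          = ennreal ((norm (\<zeta> j \<omega>))\<^sup>2)" .
        have "\<zeta> j \<omega> = simple_process n \<tau> \<xi> s \<omega> - \<eta> \<and> s \<in> {a..b}"
        proof -
          consider "j = 0" | i where "j = Suc i" "i < n" | "j = Suc n"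
            using j(1) unfolding m_def by (metis less_Suc_eq old.nat.exhaust Suc_less_eq)
          then show ?thesis
          proof cases
            case 1
            then have "a < s" "s \<le> clip (\<tau> 0)" using j \<sigma>_simps by auto
            moreover from this have "s \<le> \<tau> 0" "s \<le> b" using ab by (auto simp: clip_def max_def min_def split: if_splits)
            ultimately show ?thesis using 1 simple_process_eq_0[of n \<tau> s \<xi> \<omega>, OF \<tau>mono] by (simp add: \<zeta>_def)
          next
            case 2
            then have *: "clip (\<tau> i) < s" "s \<le> clip (\<tau> (Suc i))" using j \<sigma>_simps by auto
            then have "s \<in> {\<tau> i<..\<tau> (Suc i)}" "a < s" "s \<le> b" "\<tau> i < b"
              using ab by (auto simp: clip_def max_def min_def split: if_splits)
            then show ?thesis using 2 simple_process_eq[of n \<tau> i s \<xi> \<omega>, OF \<tau>mono] by (simp add: \<zeta>_def)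
          next
            case 3
            then have *: "clip (\<tau> n) < s" "s \<le> b" using j \<sigma>_simps by auto
            then have "\<tau> n < s" "a < s" by (auto simp: clip_def)
            then show ?thesis using * 3 simple_process_eq_0[of n \<tau> s \<xi> \<omega>, OF \<tau>mono] by (simp add: \<zeta>_def)
          qed
        qed
        then show ?thesis unfolding sum_eq by simp
      qed
    qed
    finally show ?thesis .
  qed
  have \<sigma>nn: "0 \<le> \<sigma> j" if "j \<le> m" for j
    using steps_mono[of m \<sigma> 0 j, OF mono] \<sigma>0 that by simp
  have [measurable]: "S \<in> borel_measurable M" "Q \<in> borel_measurable M"
    unfolding S_def Q_def using measurable_F_M[OF \<sigma>nn \<zeta>F] W_measurable[OF \<sigma>nn]
    by (auto intro!: borel_measurable_sum borel_measurable_matrix_vector_mult borel_measurable_diff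
        borel_measurable_times borel_measurable_power borel_measurable_norm simp del: One_nat_def)
  have "Q \<omega> \<le> \<delta>" if "(\<integral>\<^sup>+ s\<in>{a..b}. ennreal ((norm (simple_process n \<tau> \<xi> s \<omega> - \<eta>))\<^sup>2) \<partial>lborel) \<le> ennreal \<delta>" for \<omega>
    using order_trans[OF Q_le that] \<open>0 \<le> \<delta>\<close> by simp
  moreover have "prob {\<omega> \<in> space M. \<epsilon> < norm (S \<omega>) \<and> Q \<omega> \<le> \<delta>} \<le> CARD('n) * \<delta> / \<epsilon>\<^sup>2"
    unfolding S_def Q_def by (rule discrete_integral_tail[OF \<sigma>0 mono \<zeta>F \<zeta>b assms(4,5)])
  moreover have "{\<omega> \<in> space M. \<epsilon> < norm (S \<omega>) \<and> Q \<omega> \<le> \<delta>} \<in> events" by measurable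
  ultimately show ?thesis
    by (intro bexI[of _ "{\<omega> \<in> space M. \<epsilon> < norm (S \<omega>) \<and> Q \<omega> \<le> \<delta>}"]) (auto simp: S_eq)
qed

text \<open>Progressive measurability controls the process only up to a finite time b; the indicator
  turns the section into a Borel function on the whole line.\<close>

lemma progressive_section_measurable:
  assumes "progressive F H" "0 \<le> b" "\<omega> \<in> space M"
  shows "(\<lambda>s. indicator {0..b} s *\<^sub>R (H s \<omega> :: 'b::real_normed_vector)) \<in> borel_measurable borel"
proof -
  have "(\<lambda>(s, \<omega>). H s \<omega>) \<in> borel_measurable (restrict_space borel {0..b} \<Otimes>\<^sub>M F b)"
    using assms unfolding progressive_def by blast
  from measurable_Pair1[OF this, of \<omega>] have "(\<lambda>s. H s \<omega>) \<in> borel_measurable (restrict_space borel {0..b})"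
    using assms by simp
  then show ?thesis by (subst (asm) borel_measurable_restrict_space_iff) auto
qed

text \<open>A single good approximant suffices. Off two events of probability below c / 2 its energy
  distance to H is at most \<delta> and its path is within \<epsilon>/4 of I. A deviation above
  \<epsilon> then forces one above \<epsilon>/2 for the approximant, whose energy is at most 4
  \<delta> since (u + v)^2 is at most 2 u^2 + 2 v^2.\<close>

lemma ito_integral_tail:
  fixes H :: "real \<Rightarrow> 'w \<Rightarrow> real^'n^'m" and \<delta> \<epsilon> a b :: real
  assumes ito: "is_ito_integral M F W H I" and ab: "0 \<le> a" "a \<le> b" and "0 < \<epsilon>" "0 < \<delta>"
  shows "\<exists>A\<in>events. prob A \<le> 17 * CARD('n) * \<delta> / \<epsilon>\<^sup>2 \<and>
    {\<omega> \<in> space M. \<epsilon> < norm (I b \<omega> - I a \<omega> - \<eta> *v (W b \<omega> - W a \<omega>)) \<and>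
      (\<integral>\<^sup>+ s\<in>{a..b}. ennreal ((norm (H s \<omega> - \<eta>))\<^sup>2) \<partial>lborel) \<le> ennreal \<delta>} \<subseteq> A"
proof -
  let ?L = "\<lambda>h \<eta>. \<integral>\<^sup>+ s\<in>{a..b}. ennreal ((norm (h s - \<eta> s))\<^sup>2) \<partial>lborel"
  have b0: "0 \<le> b" using ab by simp
  obtain n \<tau> \<xi> where simple: "\<And>k. simple_integrand M F (n k) (\<tau> k) (\<xi> k)"
    and approx: "\<And>T. 0 \<le> T \<Longrightarrow> null_in_probability M (\<lambda>k \<omega>. \<integral>\<^sup>+ s\<in>{0..T}. ennreal
            ((frobenius_norm (simple_process (n k) (\<tau> k) (\<xi> k) s \<omega> - H s \<omega>))\<^sup>2) \<partial>lborel)"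
      "\<And>T. 0 \<le> T \<Longrightarrow> null_in_probability M (\<lambda>k \<omega>. SUP t\<in>{0..T}. ennreal
            (norm (simple_integral W (n k) (\<tau> k) (\<xi> k) t \<omega> - I t \<omega>)))"
    using ito unfolding is_ito_integral_def by blast
  define Z where "Z k \<omega> = (\<integral>\<^sup>+ s\<in>{0..b}. ennreal
     ((norm (simple_process (n k) (\<tau> k) (\<xi> k) s \<omega> - H s \<omega>))\<^sup>2) \<partial>lborel)" for k \<omega>
  define V where "V k \<omega> = (SUP t\<in>{0..b}. ennreal
     (norm (simple_integral W (n k) (\<tau> k) (\<xi> k) t \<omega> - I t \<omega>)))" for k \<omega>
  have [measurable]: "Z k \<in> borel_measurable M" "V k \<in> borel_measurable M" for k
    using approx[OF b0] unfolding null_in_probability_def Z_def V_def frobenius_norm_eq_norm by auto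
  \<comment> \<open>The unit in which probabilities are counted: the simple integral with 4 \<delta>
    and \<epsilon>/2 contributes 16 c, and the two approximation errors together at most c, whence
    the factor 17.\<close>
  define c where "c = CARD('n) * \<delta> / \<epsilon>\<^sup>2"
  have c: "c > 0" using assms by (simp add: c_def)
  have "(\<lambda>k. prob {\<omega> \<in> space M. Z k \<omega> > ennreal \<delta>}) \<longlonglongrightarrow> 0"
    "(\<lambda>k. prob {\<omega> \<in> space M. V k \<omega> > ennreal (\<epsilon>/4)}) \<longlonglongrightarrow> 0"
    using approx[OF b0] assms(4,5)
    unfolding null_in_probability_def Z_def V_def frobenius_norm_eq_norm by auto
  then have "\<forall>\<^sub>F k in sequentially. prob {\<omega> \<in> space M. Z k \<omega> > ennreal \<delta>} < c / 2 \<and>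
      prob {\<omega> \<in> space M. V k \<omega> > ennreal (\<epsilon>/4)} < c / 2"
    using c by (intro eventually_conj order_tendstoD(2)) auto
  then obtain k where k: "prob {\<omega> \<in> space M. Z k \<omega> > ennreal \<delta>} < c / 2"
      "prob {\<omega> \<in> space M. V k \<omega> > ennreal (\<epsilon>/4)} < c / 2"
    unfolding eventually_sequentially by blast
  define S where "S s \<omega> = simple_process (n k) (\<tau> k) (\<xi> k) s \<omega>" for s \<omega>
  define J where "J t \<omega> = simple_integral W (n k) (\<tau> k) (\<xi> k) t \<omega>" for t \<omega>
  have "\<exists>A\<in>events. prob A \<le> CARD('n) * (4 * \<delta>) / (\<epsilon>/2)\<^sup>2 \<and>
    {\<omega> \<in> space M. \<epsilon>/2 < norm (J b \<omega> - J a \<omega> - \<eta> *v (W b \<omega> - W a \<omega>)) \<and>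
      ?L (\<lambda>s. S s \<omega>) (\<lambda>s. \<eta>) \<le> ennreal (4 * \<delta>)} \<subseteq> A"
    unfolding S_def J_def by (rule simple_integral_tail[OF simple ab]) (use assms in auto)
  then obtain A where A[measurable]: "A \<in> events" and PA: "prob A \<le> 16 * c"
    and sub: "\<And>\<omega>. \<omega> \<in> space M \<Longrightarrow> \<epsilon>/2 < norm (J b \<omega> - J a \<omega> - \<eta> *v (W b \<omega> - W a \<omega>)) \<Longrightarrow>
      ?L (\<lambda>s. S s \<omega>) (\<lambda>s. \<eta>) \<le> ennreal (4 * \<delta>) \<Longrightarrow> \<omega> \<in> A"
    by (fastforce simp: c_def power_divide)
  define B where "B = A \<union> ({\<omega> \<in> space M. Z k \<omega> > ennreal \<delta>} \<union> {\<omega> \<in> space M. V k \<omega> > ennreal (\<epsilon>/4)})"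
  have "prob B \<le> prob A + (prob {\<omega> \<in> space M. Z k \<omega> > ennreal \<delta>} + prob {\<omega> \<in> space M. V k \<omega> > ennreal (\<epsilon>/4)})"
    unfolding B_def by (intro order_trans[OF measure_Un_le] add_mono measure_Un_le) auto
  also have "\<dots> \<le> 17 * c" using PA k by linarith
  finally have PB: "prob B \<le> 17 * CARD('n) * \<delta> / \<epsilon>\<^sup>2" by (simp add: c_def)
  moreover have "B \<in> events" unfolding B_def by measurable
  moreover have "{\<omega> \<in> space M. \<epsilon> < norm (I b \<omega> - I a \<omega> - \<eta> *v (W b \<omega> - W a \<omega>)) \<and>
      ?L (\<lambda>s. H s \<omega>) (\<lambda>s. \<eta>) \<le> ennreal \<delta>} \<subseteq> B"
  proof (rule subsetI, rule ccontr)
    fix \<omega> assume *: "\<omega> \<in> {\<omega> \<in> space M. \<epsilon> < norm (I b \<omega> - I a \<omega> - \<eta> *v (W b \<omega> - W a \<omega>)) \<and>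
      ?L (\<lambda>s. H s \<omega>) (\<lambda>s. \<eta>) \<le> ennreal \<delta>}" and "\<omega> \<notin> B"
    then have w: "\<omega> \<in> space M" and Zk: "Z k \<omega> \<le> ennreal \<delta>" and Vk: "V k \<omega> \<le> ennreal (\<epsilon>/4)" and "\<omega> \<notin> A"
      by (auto simp: B_def not_less)
    have JI: "norm (J t \<omega> - I t \<omega>) \<le> \<epsilon>/4" if "t \<in> {0..b}" for t
    proof -
      have "ennreal (norm (J t \<omega> - I t \<omega>)) \<le> V k \<omega>"
        unfolding V_def J_def using that by (rule SUP_upper)
      then have "ennreal (norm (J t \<omega> - I t \<omega>)) \<le> ennreal (\<epsilon>/4)" using Vk by (rule order_trans)
      then show ?thesis using \<open>0 < \<epsilon>\<close> by simp
    qed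
    have "norm (I b \<omega> - I a \<omega> - \<eta> *v (W b \<omega> - W a \<omega>)) \<le>
       norm (J b \<omega> - J a \<omega> - \<eta> *v (W b \<omega> - W a \<omega>)) + norm (J b \<omega> - I b \<omega>) + norm (J a \<omega> - I a \<omega>)"
      by norm
    then have "\<epsilon>/2 < norm (J b \<omega> - J a \<omega> - \<eta> *v (W b \<omega> - W a \<omega>))"
      using * JI[of a] JI[of b] ab by auto
    moreover have "?L (\<lambda>s. S s \<omega>) (\<lambda>s. \<eta>) \<le> ennreal (4 * \<delta>)"
    proof -
      \<comment> \<open>The cut-off makes the section Borel measurable, as needed to split the
        integral, and changes nothing on {a..b}.\<close>
      define H' where "H' s = indicator {0..b} s *\<^sub>R H s \<omega>" for s
      have [measurable]: "H' \<in> borel_measurable borel"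
        unfolding H'_def
        using progressive_section_measurable[of H b \<omega>] ito b0 w by (auto simp: is_ito_integral_def)
      have [measurable]: "(\<lambda>s. S s \<omega>) \<in> borel_measurable borel"
        unfolding S_def by (rule borel_measurable_simple_process)
      have "?L (\<lambda>s. S s \<omega>) (\<lambda>s. \<eta>) \<le>
        (\<integral>\<^sup>+ s. 2 * (ennreal ((norm (S s \<omega> - H' s))\<^sup>2) * indicator {a..b} s) +
           2 * (ennreal ((norm (H' s - \<eta>))\<^sup>2) * indicator {a..b} s) \<partial>lborel)"
      proof (intro nn_integral_mono)
        fix s
        have "(norm (S s \<omega> - \<eta>))\<^sup>2 \<le> (norm (S s \<omega> - H' s) + norm (H' s - \<eta>))\<^sup>2"
          by (intro power_mono) (norm, simp)
        also have "\<dots> \<le> 2 * (norm (S s \<omega> - H' s))\<^sup>2 + 2 * (norm (H' s - \<eta>))\<^sup>2"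
          using zero_le_power2[of "norm (S s \<omega> - H' s) - norm (H' s - \<eta>)"]
          by (simp add: power2_diff power2_sum)
        finally have "ennreal ((norm (S s \<omega> - \<eta>))\<^sup>2) \<le>
            ennreal (2 * (norm (S s \<omega> - H' s))\<^sup>2 + 2 * (norm (H' s - \<eta>))\<^sup>2)"
          by (rule ennreal_leI)
        also have "\<dots> = 2 * ennreal ((norm (S s \<omega> - H' s))\<^sup>2) + 2 * ennreal ((norm (H' s - \<eta>))\<^sup>2)"
          by (simp add: ennreal_mult)
        finally have "ennreal ((norm (S s \<omega> - \<eta>))\<^sup>2) \<le>
            2 * ennreal ((norm (S s \<omega> - H' s))\<^sup>2) + 2 * ennreal ((norm (H' s - \<eta>))\<^sup>2)" .
        then show "ennreal ((norm (S s \<omega> - \<eta>))\<^sup>2) * indicator {a..b} s \<le>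
          2 * (ennreal ((norm (S s \<omega> - H' s))\<^sup>2) * indicator {a..b} s) +
           2 * (ennreal ((norm (H' s - \<eta>))\<^sup>2) * indicator {a..b} s)"
          by (auto simp: indicator_def)
      qed
      also have "\<dots> = 2 * ?L (\<lambda>s. S s \<omega>) H' +
          2 * ?L H' (\<lambda>s. \<eta>)"
        by (subst nn_integral_add) (auto simp: nn_integral_cmult)
      also have "\<dots> \<le> 2 * ennreal \<delta> + 2 * ennreal \<delta>"
      proof (intro add_mono mult_left_mono)
        have "?L (\<lambda>s. S s \<omega>) H' \<le> Z k \<omega>"
          unfolding Z_def S_def H'_def using ab
          by (intro nn_integral_mono) (auto simp: indicator_def)
        then show "?L (\<lambda>s. S s \<omega>) H' \<le> ennreal \<delta>"
          using Zk by (rule order_trans)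
        have "?L H' (\<lambda>s. \<eta>)
           = ?L (\<lambda>s. H s \<omega>) (\<lambda>s. \<eta>)"
          unfolding H'_def using ab
          by (intro nn_integral_cong) (auto simp: indicator_def)
        then show "?L H' (\<lambda>s. \<eta>) \<le> ennreal \<delta>"
          using * by simp
      qed auto
      also have "\<dots> = ennreal (4 * \<delta>)"
      proof -
        have "ennreal (4 * \<delta>) = ennreal (2 * \<delta> + 2 * \<delta>)" by simp
        then show ?thesis using \<open>0 < \<delta>\<close> by (simp only: ennreal_plus) (simp add: ennreal_mult)
      qed
      finally show ?thesis .
    qed
    ultimately show False using sub[OF w] \<open>\<omega> \<notin> A\<close> by blast
  qed
  ultimately show ?thesis by blast
qed
end

section \<open>Almost sure consequences of the tail inequality\<close>

lemma nonpos_if_le_inverse_Suc: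
  assumes "\<And>k. x \<le> 1 / real (Suc k)"
  shows "x \<le> 0"
  using LIMSEQ_le_const[OF LIMSEQ_inverse_real_of_nat, of x] assms by (auto simp: inverse_eq_divide)

text \<open>The covers may depend on e; intersecting countably many of them gives one null set. This
  turns the tail inequality, which speaks only of covering events, into almost sure
  statements.\<close>

lemma (in prob_space) AE_by_small_covers:
  assumes "\<And>e. 0 < e \<Longrightarrow> \<exists>A\<in>events. prob A \<le> e \<and> {\<omega> \<in> space M. \<not> P \<omega>} \<subseteq> A"
  shows "AE \<omega> in M. P \<omega>"
proof -
  have "\<forall>j. \<exists>A\<in>events. prob A \<le> 1 / real (Suc j) \<and> {\<omega> \<in> space M. \<not> P \<omega>} \<subseteq> A"
    by (intro allI assms) simp
  then obtain A where A: "\<And>j. A j \<in> events" "\<And>j. prob (A j) \<le> 1 / real (Suc j)"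
      "\<And>j. {\<omega> \<in> space M. \<not> P \<omega>} \<subseteq> A j"
    by metis
  have N: "(\<Inter>j. A j) \<in> events" using A(1) by auto
  have "prob (\<Inter>j. A j) \<le> 1 / real (Suc j)" for j
    using finite_measure_mono[of "\<Inter>j. A j" "A j"] A(1,2)[of j] by fastforce
  then have "prob (\<Inter>j. A j) \<le> 0" by (rule nonpos_if_le_inverse_Suc)
  then have "emeasure M (\<Inter>j. A j) = 0"
    by (simp add: emeasure_eq_measure measure_le_0_iff)
  then show ?thesis
    using A(3) N by (intro AE_I[of _ _ "\<Inter>j. A j"]) auto
qed

context filtered_brownian_motion
begin

text \<open>With energy exactly 0 the parameter \<delta> of the tail inequality is free, so for each
  fixed deviation the probability bound can be made as small as desired.\<close>

lemma AE_ito_increment: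
  fixes H :: "real \<Rightarrow> 'w \<Rightarrow> real^'n^'m"
  assumes ito: "is_ito_integral M F W H I" and ab: "0 \<le> a" "a \<le> b"
  shows "AE \<omega> in M. (\<integral>\<^sup>+ s\<in>{a..b}. ennreal ((norm (H s \<omega> - \<eta>))\<^sup>2) \<partial>lborel) = 0 \<longrightarrow>
    I b \<omega> - I a \<omega> = \<eta> *v (W b \<omega> - W a \<omega>)"
proof -
  let ?D = "\<lambda>\<omega>. norm (I b \<omega> - I a \<omega> - \<eta> *v (W b \<omega> - W a \<omega>))"
  let ?Q = "\<lambda>\<omega>. \<integral>\<^sup>+ s\<in>{a..b}. ennreal ((norm (H s \<omega> - \<eta>))\<^sup>2) \<partial>lborel"
  have "AE \<omega> in M. ?Q \<omega> = 0 \<longrightarrow> ?D \<omega> \<le> 1 / real (Suc k)" for k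
  proof (rule AE_by_small_covers)
    fix e :: real assume e: "0 < e"
    define \<epsilon> where "\<epsilon> = 1 / real (Suc k)"
    define \<delta> where "\<delta> = e * \<epsilon>\<^sup>2 / (17 * CARD('n))"
    have pos: "\<epsilon> > 0" "\<delta> > 0" using e by (auto simp: \<epsilon>_def \<delta>_def)
    have eq: "17 * CARD('n) * \<delta> / \<epsilon>\<^sup>2 = e" using pos by (simp add: \<delta>_def)
    obtain A where "A \<in> events" "prob A \<le> 17 * CARD('n) * \<delta> / \<epsilon>\<^sup>2"
      and sub: "{\<omega> \<in> space M. \<epsilon> < ?D \<omega> \<and> ?Q \<omega> \<le> ennreal \<delta>} \<subseteq> A"
      using ito_integral_tail[OF ito ab pos, of \<eta>] by blast
    moreover have "{\<omega> \<in> space M. \<not> (?Q \<omega> = 0 \<longrightarrow> ?D \<omega> \<le> 1 / real (Suc k))} \<subseteq> A"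
      using sub by (auto simp: \<epsilon>_def not_le)
    ultimately show "\<exists>A\<in>events. prob A \<le> e \<and>
       {\<omega> \<in> space M. \<not> (?Q \<omega> = 0 \<longrightarrow> ?D \<omega> \<le> 1 / real (Suc k))} \<subseteq> A"
      unfolding eq by blast
  qed
  then have "AE \<omega> in M. \<forall>k. ?Q \<omega> = 0 \<longrightarrow> ?D \<omega> \<le> 1 / real (Suc k)"
    unfolding AE_all_countable by (rule allI)
  then show ?thesis
  proof eventually_elim
    case (elim \<omega>)
    show ?case
    proof
      assume "?Q \<omega> = 0"
      then have "?D \<omega> \<le> 0" using elim by (intro nonpos_if_le_inverse_Suc) blast
      then show "I b \<omega> - I a \<omega> = \<eta> *v (W b \<omega> - W a \<omega>)" by simp
    qed
  qed
qed

text \<open>The quantifier over a and b stands inside the almost sure statement, since the interval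
  without noise depends on the path. It is settled for rational endpoints first; continuity of I
  then reaches real endpoints. The open interval in the hypothesis matters because at the moment of
  leaving the noisy region H may still be nonzero.\<close>

lemma AE_ito_constant:
  fixes H :: "real \<Rightarrow> 'w \<Rightarrow> real^'n^'m"
  assumes ito: "is_ito_integral M F W H I"
  shows "AE \<omega> in M. \<forall>a b. 0 \<le> a \<and> a \<le> b \<and> (\<forall>s\<in>{a<..<b}. H s \<omega> = 0) \<longrightarrow> I a \<omega> = I b \<omega>"
proof -
  have "AE \<omega> in M. \<forall>q::rat. \<forall>r::rat. 0 \<le> q \<and> q \<le> r \<longrightarrow>
      (\<integral>\<^sup>+ s\<in>{real_of_rat q..real_of_rat r}. ennreal ((norm (H s \<omega> - 0))\<^sup>2) \<partial>lborel) = 0 \<longrightarrow>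
      I (of_rat r) \<omega> - I (of_rat q) \<omega> = 0"
    unfolding AE_all_countable
    using AE_ito_increment[OF ito, of "real_of_rat _" "real_of_rat _" 0]
    by (auto simp: of_rat_less_eq)
  moreover have "AE \<omega> in M. continuous_on {0..} (\<lambda>t. I t \<omega>)"
    using ito unfolding is_ito_integral_def continuous_paths_def by blast
  ultimately show ?thesis
  proof eventually_elim
    case (elim \<omega>)
    show ?case
    proof (intro allI impI)
      fix a b :: real assume *: "0 \<le> a \<and> a \<le> b \<and> (\<forall>s\<in>{a<..<b}. H s \<omega> = 0)"
      show "I a \<omega> = I b \<omega>"
      proof (cases "a = b")
        case False
        then have ab: "a < b" using * by simp
        then obtain c where c: "c \<in> {a<..<b} \<inter> \<rat>" using Rats_dense_in_real[OF ab] by auto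
        have eq: "I p \<omega> = I r \<omega>" if pr: "p \<in> {a<..<b} \<inter> \<rat>" "r \<in> {a<..<b} \<inter> \<rat>" "p \<le> r" for p r
        proof -
          obtain p' r' where p': "p = real_of_rat p'" "r = real_of_rat r'"
            using pr by (auto elim!: Rats_cases)
          have "0 \<le> p" using pr(1) * by auto
          then have "0 \<le> p' \<and> p' \<le> r'" using pr(3) by (simp add: p' of_rat_less_eq)
          moreover have "(\<integral>\<^sup>+ s\<in>{p..r}. ennreal ((norm (H s \<omega> - 0))\<^sup>2) \<partial>lborel) = (\<integral>\<^sup>+ s. 0 \<partial>(lborel :: real measure))"
            using pr * by (intro nn_integral_cong) (auto simp: indicator_def)
          ultimately show ?thesis using elim(1) unfolding p' by auto
        qed
        have const: "I q \<omega> = I c \<omega>" if "q \<in> {a<..<b} \<inter> \<rat>" for q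
        proof (cases "q \<le> c")
          case True
          then show ?thesis by (rule eq[OF that c])
        next
          case False
          then have "c \<le> q" by simp
          then show ?thesis by (rule eq[OF c that, symmetric])
        qed
        have cl: "closure ({a<..<b} \<inter> \<rat>) = {a..b}"
          using closure_open_Int_superset[of "{a<..<b}" \<rat>] ab by (simp add: Rats_closure_real)
        have cont: "continuous_on (closure ({a<..<b} \<inter> \<rat>)) (\<lambda>t. I t \<omega>)"
          unfolding cl using elim(2) * by (auto intro: continuous_on_subset)
        show ?thesis
          using continuous_constant_on_closure[OF cont const, of a]
            continuous_constant_on_closure[OF cont const, of b] cl ab by simp
      qed simp
    qed
  qed
qed

text \<open>A substitute for the convergence of the integral, which would need a maximal inequality.\<close>

lemma AE_ito_recurrent:
  fixes H :: "real \<Rightarrow> 'w \<Rightarrow> real^'n^'m" and C :: real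
  assumes ito: "is_ito_integral M F W H I" and "C > 0"
    and H2: "\<And>\<omega> T. \<omega> \<in> space M \<Longrightarrow> 0 \<le> T \<Longrightarrow> (\<integral>\<^sup>+ s\<in>{0..T}. ennreal ((norm (H s \<omega>))\<^sup>2) \<partial>lborel) \<le> ennreal C"
  shows "AE \<omega> in M. \<exists>K. \<exists>\<^sub>F n in sequentially. norm (I (real n) \<omega> - I 0 \<omega>) \<le> K"
proof (rule AE_by_small_covers)
  fix e :: real assume e: "0 < e"
  \<comment> \<open>The level at which the tail bound with energy C equals e.\<close>
  define K where "K = sqrt (17 * CARD('n) * C / e)"
  have K: "K > 0" using e \<open>C > 0\<close> by (simp add: K_def)
  have eq: "17 * CARD('n) * C / K\<^sup>2 = e"
    using e \<open>C > 0\<close> by (simp add: K_def real_sqrt_pow2)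
  have [measurable]: "I t \<in> borel_measurable M" if "t \<ge> 0" for t
    using ito that measurable_F_M unfolding is_ito_integral_def adapted_def by blast
  \<comment> \<open>Remaining beyond K from N on is contained in the deviation at the single time N,
    which has probability at most e. The sets increase with N, so their union obeys the same bound
    without any maximal inequality.\<close>
  define G where "G N = {\<omega> \<in> space M. \<forall>n\<ge>N. K < norm (I (real n) \<omega> - I 0 \<omega>)}" for N :: nat
  have Gm: "G N \<in> events" for N
    unfolding G_def by measurable
  have GP: "prob (G N) \<le> e" for N
  proof -
    obtain A where A: "A \<in> events" "prob A \<le> 17 * CARD('n) * C / K\<^sup>2"
      and sub: "{\<omega> \<in> space M. K < norm (I (real N) \<omega> - I 0 \<omega> - 0 *v (W (real N) \<omega> - W 0 \<omega>)) \<and>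
         (\<integral>\<^sup>+ s\<in>{0..real N}. ennreal ((norm (H s \<omega> - 0))\<^sup>2) \<partial>lborel) \<le> ennreal C} \<subseteq> A"
      using ito_integral_tail[OF ito _ _ K \<open>C > 0\<close>, of 0 "real N" 0] by auto
    have "G N \<subseteq> A"
      using sub H2[of _ "real N"] by (auto simp: G_def)
    then show ?thesis using A finite_measure_mono[of "G N" A] eq by simp
  qed
  have "(\<lambda>N. prob (G N)) \<longlonglongrightarrow> prob (\<Union>N. G N)"
    by (rule finite_Lim_measure_incseq) (auto intro: Gm simp: incseq_def G_def)
  then have "prob (\<Union>N. G N) \<le> e" using GP by (intro LIMSEQ_le_const2) auto
  moreover have "{\<omega> \<in> space M. \<not> (\<exists>K. \<exists>\<^sub>F n in sequentially. norm (I (real n) \<omega> - I 0 \<omega>) \<le> K)} \<subseteq> (\<Union>N. G N)"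
  proof clarify
    fix \<omega> assume w: "\<omega> \<in> space M" "\<nexists>K. \<exists>\<^sub>F n in sequentially. norm (I (real n) \<omega> - I 0 \<omega>) \<le> K"
    then have "\<forall>\<^sub>F n in sequentially. K < norm (I (real n) \<omega> - I 0 \<omega>)"
      by (simp add: frequently_def not_le)
    then show "\<omega> \<in> (\<Union>N. G N)" using w(1) by (auto simp: G_def eventually_sequentially)
  qed
  ultimately show "\<exists>A\<in>events. prob A \<le> e \<and>
     {\<omega> \<in> space M. \<not> (\<exists>K. \<exists>\<^sub>F n in sequentially. norm (I (real n) \<omega> - I 0 \<omega>) \<le> K)} \<subseteq> A"
    using Gm by (intro bexI[of _ "\<Union>N. G N"]) auto
qed

text \<open>Borel-Cantelli for the covering events of the tail inequality. The energy bound stays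
  inside as a premise because it will be available only for paths that eventually remain in the
  annulus where \<phi> is 1.\<close>

lemma AE_ito_increments_approx:
  fixes H :: "real \<Rightarrow> 'w \<Rightarrow> real^'n^'m" and a b \<delta> \<epsilon> :: "nat \<Rightarrow> real"
  assumes ito: "is_ito_integral M F W H I"
    and "\<And>n. 0 \<le> a n" "\<And>n. a n \<le> b n" and pos: "\<And>n. 0 < \<epsilon> n" "\<And>n. 0 < \<delta> n"
    and sum: "summable (\<lambda>n. \<delta> n / (\<epsilon> n)\<^sup>2)"
  shows "AE \<omega> in M. \<forall>\<^sub>F n in sequentially.
    (\<integral>\<^sup>+ s\<in>{a n..b n}. ennreal ((norm (H s \<omega> - \<eta> n))\<^sup>2) \<partial>lborel) \<le> ennreal (\<delta> n) \<longrightarrow>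
    norm (I (b n) \<omega> - I (a n) \<omega> - \<eta> n *v (W (b n) \<omega> - W (a n) \<omega>)) \<le> \<epsilon> n"
proof -
  define E where "E n = {\<omega> \<in> space M. \<epsilon> n < norm (I (b n) \<omega> - I (a n) \<omega> - \<eta> n *v (W (b n) \<omega> - W (a n) \<omega>)) \<and>
      (\<integral>\<^sup>+ s\<in>{a n..b n}. ennreal ((norm (H s \<omega> - \<eta> n))\<^sup>2) \<partial>lborel) \<le> ennreal (\<delta> n)}" for n
  have "\<exists>A. A \<in> events \<and> prob A \<le> 17 * CARD('n) * \<delta> n / (\<epsilon> n)\<^sup>2 \<and> E n \<subseteq> A" for n
    unfolding E_def using ito_integral_tail[OF ito assms(2,3) pos, of n] by blast
  then obtain A where "\<forall>n. A n \<in> events \<and> prob (A n) \<le> 17 * CARD('n) * \<delta> n / (\<epsilon> n)\<^sup>2 \<and> E n \<subseteq> A n"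
    using choice[of "\<lambda>n A. A \<in> events \<and> prob A \<le> 17 * CARD('n) * \<delta> n / (\<epsilon> n)\<^sup>2 \<and> E n \<subseteq> A"] by blast
  then have A: "\<And>n. A n \<in> events" "\<And>n. prob (A n) \<le> 17 * CARD('n) * \<delta> n / (\<epsilon> n)\<^sup>2"
    "\<And>n. E n \<subseteq> A n" by auto
  have "summable (\<lambda>n. prob (A n))"
    by (rule summable_comparison_test'[OF summable_mult[OF sum, of "17 * CARD('n)"]])
      (use A(2) in \<open>simp add: mult.assoc\<close>)
  then have "AE \<omega> in M. \<forall>\<^sub>F n in sequentially. \<omega> \<in> space M - A n"
    using A(1) by (intro borel_cantelli_AE1) (auto simp: emeasure_eq_measure)
  then show ?thesis
  proof eventually_elim
    case (elim \<omega>)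
    then show ?case
    proof eventually_elim
      case (elim n)
      then show ?case using A(3)[of n] unfolding E_def by force
    qed
  qed
qed

text \<open>The series of nonnegative terms has finite expectation, hence is almost surely finite;
  independence of the increments does not enter.\<close>

lemma AE_summable_W_increments:
  fixes a b c :: "nat \<Rightarrow> real"
  assumes ab: "\<And>n. 0 \<le> a n" "\<And>n. a n \<le> b n" and sum: "summable (\<lambda>n. c n * (b n - a n))" and c: "\<And>n. 0 \<le> c n"
  shows "AE \<omega> in M. summable (\<lambda>n. c n * (norm (W (b n) \<omega> - W (a n) \<omega>))\<^sup>2)"
proof -
  have [measurable]: "W t \<in> borel_measurable M" if "t \<ge> 0" for t
    using W_measurable that by blast
  have [measurable]: "W (a n) \<in> borel_measurable M" "W (b n) \<in> borel_measurable M" for n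
    using ab order_trans by (blast intro: W_measurable)+
  have moment: "(\<integral>\<^sup>+\<omega>. ennreal (c n * (norm (W (b n) \<omega> - W (a n) \<omega>))\<^sup>2) \<partial>M) = ennreal (CARD('n) * (c n * (b n - a n)))" for n
    using W_increment_second_moment[OF ab] c
    by (subst nn_integral_eq_integral) (auto simp: mult.left_commute)
  have "(\<integral>\<^sup>+\<omega>. (\<Sum>n. ennreal (c n * (norm (W (b n) \<omega> - W (a n) \<omega>))\<^sup>2)) \<partial>M) =
      (\<Sum>n. ennreal (CARD('n) * (c n * (b n - a n))))"
    by (subst nn_integral_suminf) (auto simp: moment)
  also have "\<dots> = ennreal (\<Sum>n. CARD('n) * (c n * (b n - a n)))"
    using ab c sum by (intro suminf_ennreal2) auto
  finally have "AE \<omega> in M. (\<Sum>n. ennreal (c n * (norm (W (b n) \<omega> - W (a n) \<omega>))\<^sup>2)) \<noteq> \<infinity>"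
    by (intro nn_integral_PInf_AE) auto
  then show ?thesis
    by eventually_elim (use c in \<open>auto intro: summable_suminf_not_top\<close>)
qed
end

section \<open>Divergence of the radial noise\<close>

text \<open>If \<open>w\<close> lies in the orthant given by the signs of \<open>u\<close>, no cancellation occurs in \<open>u \<bullet> w\<close>. Since there are only
  finitely many orthants, this replaces the rotational invariance of the Gaussian distribution.\<close>

definition orthant :: "'n set \<Rightarrow> (real^'n) set" where
  "orthant P = {w. \<forall>i. if i \<in> P then 1 \<le> w $ i else w $ i \<le> - 1}"

lemma orthant_closed [measurable]: "orthant P \<in> sets borel"
proof -
  have eq: "orthant P = (\<Inter>i. if i \<in> P then {w. 1 \<le> w $ i} else {w. w $ i \<le> - 1})"
    unfolding orthant_def by (auto split: if_splits)
  have "closed (if i \<in> P then {w::real^'a. 1 \<le> w $ i} else {w. w $ i \<le> - 1})" for i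
    by (auto intro!: closed_Collect_le continuous_intros)
  then show ?thesis unfolding eq by (intro borel_closed closed_INT ballI)
qed

lemma borel_measurable_indicator_orthant:
  fixes U D :: "'a \<Rightarrow> real^'n"
  assumes [measurable]: "U \<in> borel_measurable N" "D \<in> borel_measurable N"
  shows "(\<lambda>\<omega>. indicat_real (orthant {i. 0 \<le> U \<omega> $ i}) (D \<omega>)) \<in> borel_measurable N"
proof -
  have "D \<omega> \<in> orthant {i. 0 \<le> U \<omega> $ i} \<longleftrightarrow>
     (\<forall>i\<in>UNIV. (0 \<le> U \<omega> $ i \<longrightarrow> 1 \<le> D \<omega> $ i) \<and> (\<not> 0 \<le> U \<omega> $ i \<longrightarrow> D \<omega> $ i \<le> - 1))" for \<omega>
    by (simp add: orthant_def if_bool_eq_conj)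
  then show ?thesis unfolding indicator_def by (simp only:) measurable
qed

lemma orthant_inner:
  fixes u w :: "real^'n"
  assumes "w \<in> orthant {i. 0 \<le> u $ i}"
  shows "norm u \<le> u \<bullet> w"
proof -
  have "\<bar>u $ i\<bar> \<le> u $ i * w $ i" for i
  proof (cases "0 \<le> u $ i")
    case True
    then have "1 \<le> w $ i" using assms unfolding orthant_def by auto
    then show ?thesis using True mult_left_mono[of 1 "w $ i" "u $ i"] by simp
  next
    case False
    then have "w $ i \<le> - 1" using assms unfolding orthant_def by auto
    then show ?thesis using False mult_left_mono[of 1 "- (w $ i)" "- (u $ i)"] by simp
  qed
  then have "(\<Sum>i\<in>UNIV. \<bar>u $ i\<bar>) \<le> u \<bullet> w"
    unfolding inner_vec_def by (auto intro: sum_mono)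
  then show ?thesis using norm_le_l1_cart[of u] by simp
qed

lemma exp_minus_le: "0 \<le> y \<Longrightarrow> y \<le> 1 \<Longrightarrow> exp (- y) \<le> 1 - y / (2::real)"
proof -
  assume y: "0 \<le> y" "y \<le> 1"
  have "1 \<le> (1 - y / 2) * (1 + y)"
    using mult_nonneg_nonneg[of y "1 - y"] y by (simp add: algebra_simps)
  also have "\<dots> \<le> (1 - y / 2) * exp y"
    using y by (intro mult_left_mono exp_ge_add_one_self) auto
  finally show ?thesis by (simp add: exp_minus field_simps)
qed

context filtered_brownian_motion
begin

text \<open>The mass of an orthant under the standard normal law. As a product of one-dimensional
  masses it refers to no time, which gives one lower bound for all unit increments.\<close>

definition orthant_prob :: "'n set \<Rightarrow> real" where
  "orthant_prob P = enn2real (\<Prod>i\<in>UNIV. \<integral>\<^sup>+x. ennreal (normal_density 0 1 x) *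
     indicator (if i \<in> P then {1..} else {..- 1}) x \<partial>lborel)"

lemma orthant_prob_eq:
  assumes "0 \<le> s"
  shows "emeasure M {\<omega> \<in> space M. W (s + 1) \<omega> - W s \<omega> \<in> orthant P} =
    (\<Prod>i\<in>UNIV. \<integral>\<^sup>+x. ennreal (normal_density 0 1 x) * indicator (if i \<in> P then {1..} else {..- 1}) x \<partial>lborel)"
proof -
  let ?Q = "\<lambda>i. if i \<in> P then {1..} else {..- 1 :: real}"
  have [measurable]: "W s \<in> borel_measurable M" "W (s + 1) \<in> borel_measurable M"
    using assms W_measurable by auto
  have "emeasure M {\<omega> \<in> space M. W (s + 1) \<omega> - W s \<omega> \<in> orthant P} =
     (\<integral>\<^sup>+\<omega>. indicator {\<omega> \<in> space M. W (s + 1) \<omega> - W s \<omega> \<in> orthant P} \<omega> \<partial>M)"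
    by (subst nn_integral_indicator) auto
  also have "\<dots> = (\<integral>\<^sup>+\<omega>. (\<Prod>i\<in>UNIV. indicator (?Q i) ((W (s + 1) \<omega> - W s \<omega>) $ i)) \<partial>M)"
  proof (intro nn_integral_cong)
    fix \<omega> assume w: "\<omega> \<in> space M"
    define x where "x = W (s + 1) \<omega> - W s \<omega>"
    have "(\<Prod>i\<in>UNIV. indicator (?Q i) (x $ i) :: ennreal) = indicator (orthant P) x"
    proof (cases "x \<in> orthant P")
      case True
      then have "indicator (?Q i) (x $ i) = (1 :: ennreal)" for i
        by (auto simp: orthant_def indicator_def)
      then show ?thesis using True by simp
    next
      case False
      then obtain i where "\<not> (if i \<in> P then 1 \<le> x $ i else x $ i \<le> - 1)" by (auto simp: orthant_def)
      then have "indicator (?Q i) (x $ i) = (0 :: ennreal)"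
        by (auto simp: indicator_def split: if_splits)
      then have "(\<Prod>i\<in>UNIV. indicator (?Q i) (x $ i) :: ennreal) = 0"
        by (intro prod_zero) (simp, blast)
      then show ?thesis using False by simp
    qed
    then show "indicator {\<omega> \<in> space M. W (s + 1) \<omega> - W s \<omega> \<in> orthant P} \<omega> =
      (\<Prod>i\<in>UNIV. indicator (?Q i) ((W (s + 1) \<omega> - W s \<omega>) $ i) :: ennreal)"
      using w unfolding x_def by (simp add: indicator_def)
  qed
  also have "\<dots> = (\<Prod>i\<in>UNIV. \<integral>\<^sup>+x. ennreal (normal_density 0 (sqrt (s + 1 - s)) x) *
      indicator (?Q i) x \<partial>lborel)"
    using assms by (intro nn_integral_W_increment_prod) auto
  finally show ?thesis by simp
qed

lemma prob_orthant:
  assumes "0 \<le> s"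
  shows "prob {\<omega> \<in> space M. W (s + 1) \<omega> - W s \<omega> \<in> orthant P} = orthant_prob P"
  unfolding measure_def orthant_prob_eq[OF assms] orthant_prob_def ..

lemma orthant_prob_pos: "0 < orthant_prob P"
proof -
  have pos: "(\<integral>\<^sup>+x. ennreal (normal_density 0 1 x) * indicator A x \<partial>lborel) \<noteq> 0"
    if A: "A \<in> sets borel" "{a..a + 1} \<subseteq> A" for A and a :: real
  proof
    note [measurable] = A(1)
    assume "(\<integral>\<^sup>+x. ennreal (normal_density 0 1 x) * indicator A x \<partial>lborel) = 0"
    then have "AE x in lborel. ennreal (normal_density 0 1 x) * indicator A x = 0"
      by (subst (asm) nn_integral_0_iff_AE) auto
    then have "AE x in lborel. x \<notin> A"
      by eventually_elim (auto simp: indicator_def normal_density_def split: if_splits)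
    then have "emeasure lborel A = 0"
      by (subst (asm) AE_iff_measurable[OF _ refl]) auto
    then have "emeasure lborel {a..a + 1} = 0"
      using emeasure_mono[OF A(2), of lborel] A(1) by simp
    then show False by simp
  qed
  have "(\<integral>\<^sup>+x. ennreal (normal_density 0 1 x) * indicator (if i \<in> P then {1..} else {..- 1}) x \<partial>lborel) \<noteq> 0" for i
    using pos[of "{1..}" 1] pos[of "{..-1}" "-2"] by (cases "i \<in> P") auto
  then have "emeasure M {\<omega> \<in> space M. W (0 + 1) \<omega> - W 0 \<omega> \<in> orthant P} \<noteq> 0"
    unfolding orthant_prob_eq[OF order_refl] by (simp add: prod_zero_iff)
  then show ?thesis
    unfolding prob_orthant[OF order_refl, symmetric] by (simp add: emeasure_eq_measure zero_less_measure_iff)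
qed

text \<open>A conditional lower bound stated with a nonnegative weight Z instead of a conditional
  expectation. The target orthant is random, but it is determined by the sign pattern of U, known at
  time s; on each of the finitely many patterns the orthant is fixed and independence
  applies.\<close>

lemma orthant_expectation_ge:
  assumes "0 \<le> s" and U: "(U :: 'w \<Rightarrow> real^'n) \<in> borel_measurable (F s)"
    and Z: "Z \<in> borel_measurable (F s)" "integrable M Z" "\<And>\<omega>. \<omega> \<in> space M \<Longrightarrow> 0 \<le> Z \<omega>"
    and c: "\<And>P. c \<le> orthant_prob P"
  shows "c * expectation Z \<le>
    expectation (\<lambda>\<omega>. Z \<omega> * indicator (orthant {i. 0 \<le> U \<omega> $ i}) (W (s + 1) \<omega> - W s \<omega>))"
proof -
  define pat where "pat P \<omega> = (indicator {\<omega>. {i. 0 \<le> U \<omega> $ i} = P} \<omega> :: real)" for P \<omega>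
  have sp: "space (F s) = space M" using assms by simp
  have patF: "pat P \<in> borel_measurable (F s)" for P
  proof -
    note [measurable] = U
    have "pat P = (\<lambda>\<omega>. if (\<forall>i\<in>P. 0 \<le> U \<omega> $ i) \<and> (\<forall>i\<in>-P. U \<omega> $ i < 0) then 1 else 0)"
    proof
      fix \<omega>
      have "{i. 0 \<le> U \<omega> $ i} = P \<longleftrightarrow> (\<forall>i\<in>P. 0 \<le> U \<omega> $ i) \<and> (\<forall>i\<in>-P. U \<omega> $ i < 0)"
        by (auto simp: set_eq_iff not_le[symmetric])
      then show "pat P \<omega> = (if (\<forall>i\<in>P. 0 \<le> U \<omega> $ i) \<and> (\<forall>i\<in>-P. U \<omega> $ i < 0) then 1 else 0)"
        by (simp add: pat_def indicator_def)
    qed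
    then show ?thesis by (simp only:) measurable
  qed
  have ZM[measurable]: "Z \<in> borel_measurable M" and patM[measurable]: "pat P \<in> borel_measurable M" for P
    using Z(1) patF measurable_F_M[OF assms(1)] by auto
  have zp: "integrable M (\<lambda>\<omega>. Z \<omega> * pat P \<omega>)" for P
  proof (rule Bochner_Integration.integrable_bound[OF Z(2)])
    show "AE \<omega> in M. norm (Z \<omega> * pat P \<omega>) \<le> norm (Z \<omega>)" by (auto simp: pat_def indicator_def)
  qed measurable
  have [measurable]: "W s \<in> borel_measurable M" "W (s + 1) \<in> borel_measurable M"
    using assms W_measurable by auto
  have ind: "integrable M (\<lambda>\<omega>. indicator (orthant P) (W (s + 1) \<omega> - W s \<omega>) :: real)" for P
  proof (rule Bochner_Integration.integrable_bound)
    show "integrable M (\<lambda>_. 1 :: real)" by simp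
    show "(\<lambda>\<omega>. indicator (orthant P) (W (s + 1) \<omega> - W s \<omega>) :: real) \<in> borel_measurable M"
      using borel_measurable_diff[of "W (s + 1)" M "W s"]
      by (rule measurable_compose) (auto intro: borel_measurable_indicator orthant_closed)
  qed (simp add: indicator_def)
  have Eind: "expectation (\<lambda>\<omega>. indicator (orthant P) (W (s + 1) \<omega> - W s \<omega>)) = orthant_prob P" for P
  proof -
    have "expectation (\<lambda>\<omega>. indicat_real (orthant P) (W (s + 1) \<omega> - W s \<omega>)) =
       expectation (indicat_real {\<omega> \<in> space M. W (s + 1) \<omega> - W s \<omega> \<in> orthant P})"
      by (intro Bochner_Integration.integral_cong) (auto simp: indicator_def)
    also have "\<dots> = prob {\<omega> \<in> space M. W (s + 1) \<omega> - W s \<omega> \<in> orthant P}"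
      by (simp add: Int_def conj_commute)
    finally show ?thesis using prob_orthant[OF assms(1), of P] by simp
  qed
  have prod: "integrable M (\<lambda>\<omega>. Z \<omega> * pat P \<omega> * indicator (orthant P) (W (s + 1) \<omega> - W s \<omega>))"
    "expectation (\<lambda>\<omega>. Z \<omega> * pat P \<omega> * indicator (orthant P) (W (s + 1) \<omega> - W s \<omega>)) =
      expectation (\<lambda>\<omega>. Z \<omega> * pat P \<omega>) * orthant_prob P" for P
    using W_increment_indep[OF assms(1) _ borel_measurable_times[OF Z(1) patF] borel_measurable_indicator[OF orthant_closed] zp ind, of P P]
    by (simp_all add: Eind)
  \<comment> \<open>The sign patterns partition the probability space: exactly one summand
    survives.\<close>
  have decomp: "(\<Sum>P\<in>UNIV. h P * pat P \<omega>) = h {i. 0 \<le> U \<omega> $ i}" for h \<omega>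
  proof -
    have "(\<Sum>P\<in>UNIV. h P * pat P \<omega>) = (\<Sum>P\<in>UNIV. if P = {i. 0 \<le> U \<omega> $ i} then h P else 0)"
      by (intro sum.cong) (auto simp: pat_def indicator_def)
    then show ?thesis by simp
  qed
  have "c * expectation Z = (\<Sum>P\<in>UNIV. c * expectation (\<lambda>\<omega>. Z \<omega> * pat P \<omega>))"
  proof -
    have "expectation Z = expectation (\<lambda>\<omega>. \<Sum>P\<in>UNIV. Z \<omega> * pat P \<omega>)" using decomp[of "\<lambda>_. Z _"] by simp
    also have "\<dots> = (\<Sum>P\<in>UNIV. expectation (\<lambda>\<omega>. Z \<omega> * pat P \<omega>))"
      by (intro Bochner_Integration.integral_sum zp)
    finally show ?thesis by (simp add: sum_distrib_left)
  qed
  also have "\<dots> \<le> (\<Sum>P\<in>UNIV. expectation (\<lambda>\<omega>. Z \<omega> * pat P \<omega>) * orthant_prob P)"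
  proof (intro sum_mono)
    fix P
    have "0 \<le> expectation (\<lambda>\<omega>. Z \<omega> * pat P \<omega>)"
      using Z(3) by (intro Bochner_Integration.integral_nonneg) (auto simp: pat_def)
    then show "c * expectation (\<lambda>\<omega>. Z \<omega> * pat P \<omega>) \<le> expectation (\<lambda>\<omega>. Z \<omega> * pat P \<omega>) * orthant_prob P"
      unfolding mult.commute[of _ "orthant_prob P"] by (rule mult_right_mono[OF c])
  qed
  also have "\<dots> = expectation (\<lambda>\<omega>. \<Sum>P\<in>UNIV. Z \<omega> * pat P \<omega> * indicator (orthant P) (W (s + 1) \<omega> - W s \<omega>))"
    unfolding prod(2)[symmetric] by (rule Bochner_Integration.integral_sum[symmetric]) (rule prod(1))
  also have "(\<lambda>\<omega>. \<Sum>P\<in>UNIV. Z \<omega> * pat P \<omega> * indicator (orthant P) (W (s + 1) \<omega> - W s \<omega>)) =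
     (\<lambda>\<omega>. Z \<omega> * indicator (orthant {i. 0 \<le> U \<omega> $ i}) (W (s + 1) \<omega> - W s \<omega>))"
    using decomp[of "\<lambda>P. Z _ * indicator (orthant P) (W (s + 1) _ - W s _)"]
    by (simp add: mult.assoc mult.commute[of "pat _ _"])
  finally show ?thesis .
qed

text \<open>A conditional Borel-Cantelli argument with weights. The Laplace transform of the partial
  sums is at most exp (- c/2 times the sum of the weights), which tends to 0, so by Markov's
  inequality the partial sums exceed every K almost surely. The spacing of the times ensures that
  each hit is known before the next increment starts.\<close>

lemma AE_orthant_hits_not_summable:
  fixes t y :: "nat \<Rightarrow> real" and U :: "nat \<Rightarrow> 'w \<Rightarrow> real^'n"
  assumes t: "\<And>n. 0 \<le> t n" "\<And>n. t n + 1 \<le> t (Suc n)"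
    and U: "\<And>n. U n \<in> borel_measurable (F (t n))"
    and y: "\<And>n. 0 \<le> y n" "\<And>n. y n \<le> 1" "\<not> summable y"
  shows "AE \<omega> in M. \<not> summable (\<lambda>n. y n * indicat_real (orthant {i. 0 \<le> U n \<omega> $ i}) (W (t n + 1) \<omega> - W (t n) \<omega>))"
proof -
  define c where "c = Min (range orthant_prob)"
  have c: "c \<le> orthant_prob P" for P unfolding c_def by (intro Min_le) auto
  have c0: "c > 0" unfolding c_def using orthant_prob_pos by (subst Min_gr_iff) auto
  define q where "q n \<omega> = indicat_real (orthant {i. 0 \<le> U n \<omega> $ i}) (W (t n + 1) \<omega> - W (t n) \<omega>)" for n \<omega>
  have q01: "q n \<omega> = 0 \<or> q n \<omega> = 1" for n \<omega> by (auto simp: q_def indicator_def)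
  define Z where "Z m \<omega> = exp (- (\<Sum>n<m. y n * q n \<omega>))" for m \<omega>
  \<comment> \<open>As q is 0 or 1, exp (- y q) = 1 - (1 - exp (- y)) q, which is linear in the
    hit.\<close>
  have ZS: "Z (Suc m) \<omega> = Z m \<omega> - (1 - exp (- y m)) * (Z m \<omega> * q m \<omega>)" for m \<omega>
    using q01[of m \<omega>] by (auto simp: Z_def exp_diff exp_minus exp_add algebra_simps divide_simps)
  have Z01: "0 \<le> Z m \<omega>" "Z m \<omega> \<le> 1" for m \<omega>
    using y(1) by (auto simp: Z_def q_def intro!: sum_nonneg)
  have qF: "q n \<in> borel_measurable (F (t (Suc n)))" for n
  proof -
    let ?D = "\<lambda>\<omega>. W (t n + 1) \<omega> - W (t n) \<omega>"
    have tn: "0 \<le> t n" "t n \<le> t (Suc n)" using t[of n] by auto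
    have [measurable]: "U n \<in> borel_measurable (F (t (Suc n)))"
      using measurable_F_mono[OF tn U[of n]] .
    have [measurable]: "?D \<in> borel_measurable (F (t (Suc n)))"
      using t[of n] by (intro borel_measurable_diff W_measurable_F) auto
    show ?thesis unfolding q_def by (rule borel_measurable_indicator_orthant) measurable
  qed
  have tmono: "t m \<le> t n" if "m \<le> n" for m n
    using that by (induction n rule: dec_induct) (use t(2) in \<open>smt (verit)\<close>)+
  have ZF: "Z m \<in> borel_measurable (F (t m))" for m
  proof -
    have "q n \<in> borel_measurable (F (t m))" if "n < m" for n
      using measurable_F_mono[OF t(1) tmono qF, of n m] that by simp
    then show ?thesis unfolding Z_def by measurable
  qed
  have ZM[measurable]: "Z m \<in> borel_measurable M" and qM[measurable]: "q m \<in> borel_measurable M" for m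
    using measurable_F_M[OF t(1) ZF] measurable_F_M[OF t(1) qF] by auto
  have Zi: "integrable M (Z m)" for m
    by (rule Bochner_Integration.integrable_bound[of _ "\<lambda>_. 1::real"]) (use Z01 in auto)
  have Zqi: "integrable M (\<lambda>\<omega>. Z m \<omega> * q m \<omega>)" for m
  proof (rule Bochner_Integration.integrable_bound[OF Zi[of m]])
    have "norm (Z m \<omega> * q m \<omega>) \<le> norm (Z m \<omega>)" for \<omega>
      using q01[of m \<omega>] by auto
    then show "AE \<omega> in M. norm (Z m \<omega> * q m \<omega>) \<le> norm (Z m \<omega>)" by simp
  qed measurable
  have EZ: "expectation (Z m) \<le> exp (- (c / 2) * (\<Sum>n<m. y n))" for m
  proof (induction m)
    case 0
    then show ?case by (simp add: Z_def prob_space)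
  next
    case (Suc m)
    have yb: "y m / 2 \<le> 1 - exp (- y m)" using exp_minus_le[of "y m"] y by auto
    have Z0: "0 \<le> expectation (Z m)" using Z01 by (intro Bochner_Integration.integral_nonneg) auto
    have "c * expectation (Z m) \<le> expectation (\<lambda>\<omega>. Z m \<omega> * q m \<omega>)"
      unfolding q_def by (rule orthant_expectation_ge[OF t(1) U ZF Zi]) (use Z01 c in auto)
    then have "(y m / 2) * (c * expectation (Z m)) \<le> (1 - exp (- y m)) * expectation (\<lambda>\<omega>. Z m \<omega> * q m \<omega>)"
      using yb y(1)[of m] c0 Z0 by (intro mult_mono) (auto intro: order_trans)
    moreover have "expectation (Z (Suc m)) = expectation (Z m) - (1 - exp (- y m)) * expectation (\<lambda>\<omega>. Z m \<omega> * q m \<omega>)"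
      unfolding ZS using Zi Zqi by simp
    ultimately have "expectation (Z (Suc m)) \<le> expectation (Z m) * (1 + (- (c / 2) * y m))"
      by (simp add: algebra_simps)
    also have "\<dots> \<le> expectation (Z m) * exp (- (c / 2) * y m)"
      using Z0 by (intro mult_left_mono exp_ge_add_one_self)
    also have "\<dots> \<le> exp (- (c / 2) * (\<Sum>n<m. y n)) * exp (- (c / 2) * y m)"
      using Suc by (intro mult_right_mono) auto
    finally show ?case by (simp add: exp_add[symmetric] algebra_simps)
  qed
  have "AE \<omega> in M. \<not> (\<forall>m. (\<Sum>n<m. y n * q n \<omega>) \<le> real K)" for K :: nat
  proof (rule AE_by_small_covers)
    fix e :: real assume e: "0 < e"
    have "\<not> (\<exists>B. \<forall>m. (\<Sum>n<m. y n) \<le> B)"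
      using y bounded_imp_summable[of y] by (metis lessThan_Suc_atMost)
    \<comment> \<open>Chosen so that the Markov bound exp (K - c/2 times the partial sum) drops
      below e.\<close>
    then obtain m where m: "(\<Sum>n<m. y n) > (real K - ln e) / (c / 2)" by (meson not_le)
    define A where "A = {\<omega> \<in> space M. exp (- real K) \<le> Z m \<omega>}"
    have "prob A \<le> expectation (Z m) / exp (- real K)"
      unfolding A_def by (rule integral_Markov_inequality_measure[OF Zi, of "{}"]) (use Z01 in auto)
    also have "\<dots> \<le> exp (- (c / 2) * (\<Sum>n<m. y n)) / exp (- real K)"
      by (intro divide_right_mono EZ) auto
    also have "\<dots> = exp (real K - (c / 2) * (\<Sum>n<m. y n))"
      by (simp add: exp_diff[symmetric])
    also have "\<dots> \<le> exp (ln e)" using m c0 by (simp add: field_simps)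
    finally have "prob A \<le> e" using e by simp
    moreover have "{\<omega> \<in> space M. \<not> \<not> (\<forall>m. (\<Sum>n<m. y n * q n \<omega>) \<le> real K)} \<subseteq> A"
      by (auto simp: A_def Z_def)
    moreover have "A \<in> events" unfolding A_def by measurable
    ultimately show "\<exists>A\<in>events. prob A \<le> e \<and> {\<omega> \<in> space M. \<not> \<not> (\<forall>m. (\<Sum>n<m. y n * q n \<omega>) \<le> real K)} \<subseteq> A"
      by blast
  qed
  then have "AE \<omega> in M. \<forall>K::nat. \<not> (\<forall>m. (\<Sum>n<m. y n * q n \<omega>) \<le> real K)"
    unfolding AE_all_countable by (rule allI)
  then show ?thesis
  proof eventually_elim
    case (elim \<omega>)
    show ?case
    proof
      assume "summable (\<lambda>n. y n * indicat_real (orthant {i. 0 \<le> U n \<omega> $ i}) (W (t n + 1) \<omega> - W (t n) \<omega>))"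
      then have s: "summable (\<lambda>n. y n * q n \<omega>)" by (simp add: q_def)
      obtain K :: nat where "(\<Sum>n. y n * q n \<omega>) \<le> real K" using real_arch_simple by blast
      moreover have "(\<Sum>n<m. y n * q n \<omega>) \<le> (\<Sum>n. y n * q n \<omega>)" for m
        using s y(1) by (intro sum_le_suminf) (auto simp: q_def)
      ultimately have "\<forall>m. (\<Sum>n<m. y n * q n \<omega>) \<le> real K" using order_trans by blast
      then show False using elim by blast
    qed
  qed
qed
end

section \<open>Paths of the dynamics\<close>

lemma inner_real2: "x \<bullet> y = x $ 1 * y $ 1 + x $ 2 * y $ 2" for x y :: "real^2"
  by (simp add: inner_vec_def sum_2)

lemma ort_nth [simp]: "ort x $ 1 = - (x $ 2)" "ort x $ 2 = x $ 1"
  by (simp_all add: ort_def)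

lemma inner_ort_self [simp]: "x \<bullet> ort x = 0"
  by (simp add: inner_real2)

lemma inner_ort_ort [simp]: "ort x \<bullet> ort y = x \<bullet> y"
  by (simp add: inner_real2)

lemma norm_ort [simp]: "norm (ort x) = norm x"
  by (simp add: norm_eq_sqrt_inner)

lemma bounded_linear_ort: "bounded_linear ort"
  unfolding linear_conv_bounded_linear[symmetric]
  by (rule linearI) (auto simp: vec_eq_iff forall_2)

lemma continuous_on_ort [continuous_intros]: "continuous_on A g \<Longrightarrow> continuous_on A (\<lambda>x. ort (g x))"
  by (rule bounded_linear.continuous_on[OF bounded_linear_ort])

definition drift :: "real^2 \<Rightarrow> real^2" where
  "drift x = - fgrad x + \<bar>norm x - 1\<bar> *\<^sub>R ort x"

lemma continuous_on_drift [continuous_intros]: "continuous_on A g \<Longrightarrow> continuous_on A (\<lambda>x. drift (g x))"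
  unfolding drift_def fgrad_def by (intro continuous_intros)

lemma inner_drift: "x \<bullet> drift x = - (slope (norm x) * (norm x)\<^sup>2)"
  by (simp add: drift_def fgrad_def inner_add_right inner_diff_right power2_norm_eq_inner)

lemma norm_drift_sq: "(norm (drift x))\<^sup>2 = (norm (fgrad x))\<^sup>2 + ((norm x - 1) * norm x)\<^sup>2"
proof -
  let ?b = "\<bar>norm x - 1\<bar> *\<^sub>R ort x"
  have "fgrad x \<bullet> ort x = 0" "ort x \<bullet> fgrad x = 0" by (simp_all add: fgrad_def inner_commute[of "ort x"])
  then have "(norm (- fgrad x + ?b))\<^sup>2 = (norm (fgrad x))\<^sup>2 + (norm ?b)\<^sup>2"
    unfolding power2_norm_eq_inner inner_add_left inner_add_right
    by simp
  then show ?thesis by (simp add: drift_def power_mult_distrib)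
qed

lemma norm_drift_annulus:
  assumes "1/2 \<le> norm x" "norm x \<le> 3/2"
  shows "norm (drift x) \<le> 3 * \<bar>norm x - 1\<bar>"
proof -
  have "(norm (drift x))\<^sup>2 = (norm x - 1)\<^sup>2 * (4 + (norm x)\<^sup>2)"
    using assms by (simp add: norm_drift_sq norm_fgrad_outer power_mult_distrib distrib_left mult.commute)
  also have "\<dots> \<le> (norm x - 1)\<^sup>2 * 9"
    using power_mono[OF assms(2), of 2] by (intro mult_left_mono) (auto simp: power2_eq_square)
  also have "\<dots> = (3 * \<bar>norm x - 1\<bar>)\<^sup>2" by (simp add: power_mult_distrib)
  finally show ?thesis by (rule power2_le_imp_le) simp
qed

text \<open>One sample path, with \<open>i\<close> in the role of the path of the Ito integral.
  Everything here is deterministic and is later interpreted for almost every \<omega>.\<close>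

locale drift_path =
  fixes x i :: "real \<Rightarrow> real^2" and x0 :: "real^2"
  assumes cont_x: "continuous_on {0..} x"
    and path_eq: "\<And>t. 0 \<le> t \<Longrightarrow> x t = x0 + (LINT s:{0..t}|lborel. drift (x s)) + i t"
begin

lemma cont_x_on: "0 \<le> a \<Longrightarrow> continuous_on {a..b} x"
  using cont_x by (rule continuous_on_subset) auto

lemma increment_eq:
  assumes "0 \<le> a" "a \<le> b"
  shows "x b - x a = integral {a..b} (\<lambda>s. drift (x s)) + (i b - i a)"
proof -
  have L: "(LINT s:{0..t}|lborel. drift (x s)) = integral {0..t} (\<lambda>s. drift (x s))" if "0 \<le> t" for t
    by (rule set_borel_integral_eq_integral(2))
      (auto intro!: borel_integrable_atLeastAtMost' continuous_intros cont_x_on)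
  have "integral {0..a} (\<lambda>s. drift (x s)) + integral {a..b} (\<lambda>s. drift (x s)) = integral {0..b} (\<lambda>s. drift (x s))"
    by (rule Henstock_Kurzweil_Integration.integral_combine[OF assms])
      (auto intro!: integrable_continuous_interval continuous_intros cont_x_on)
  then show ?thesis
    using path_eq[of a] path_eq[of b] assms by (simp add: L algebra_simps)
qed

text \<open>With \<open>\<kappa> = 1\<close> and \<open>\<kappa> = - 1\<close> this keeps the path away from infinity and from the origin:
  both are surrounded by a region without noise from which the drift leads away.\<close>

lemma barrier:
  fixes \<kappa> c :: real
  assumes frozen: "\<And>a b. 0 \<le> a \<Longrightarrow> a \<le> b \<Longrightarrow> (\<And>s. a < s \<Longrightarrow> s < b \<Longrightarrow> \<phi> (x s) = 0) \<Longrightarrow> i a = i b"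
    and start: "\<kappa> * (norm (x 0))\<^sup>2 \<le> c"
    and beyond: "\<And>y. c < \<kappa> * (norm y)\<^sup>2 \<Longrightarrow> \<phi> y = 0 \<and> \<kappa> * (y \<bullet> drift y) \<le> 0"
    and "0 \<le> t"
  shows "\<kappa> * (norm (x t))\<^sup>2 \<le> c"
proof (rule ccontr)
  define V where "V u = \<kappa> * (x u \<bullet> x u)" for u
  have V: "V u = \<kappa> * (norm (x u))\<^sup>2" for u by (simp add: V_def power2_norm_eq_inner)
  assume "\<not> \<kappa> * (norm (x t))\<^sup>2 \<le> c"
  then have Vt: "c < V t" by (simp add: V)
  have contV: "continuous_on {0..t} V"
    unfolding V_def by (intro continuous_intros cont_x_on) simp_all
  define S where "S = {u \<in> {0..t}. V u \<le> c}"
  have cl: "closed S"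
    unfolding S_def by (rule continuous_on_closed_Collect_le[OF contV continuous_on_const closed_atLeastAtMost])
  have zero: "0 \<in> S" using start \<open>0 \<le> t\<close> by (simp add: S_def V)
  have bdd: "bdd_above S" unfolding S_def by (auto intro: bdd_aboveI[of _ t])
  \<comment> \<open>The last time up to t at which the barrier is respected. From then on the noise
    is off, so the path solves an ordinary differential equation and V has derivative
    \<open>2 * (\<kappa> * (x u \<bullet> drift (x u)))\<close>, which is at most 0: V cannot have
    risen above c.\<close>
  define s where "s = Sup S"
  have "s \<in> S"
    unfolding s_def by (rule closed_contains_Sup[OF _ bdd cl]) (use zero in auto)
  then have s: "0 \<le> s" "s < t" "V s \<le> c"
    using Vt by (auto simp: S_def less_le)
  have after: "c < V u" if "s < u" "u \<le> t" for u
  proof (rule ccontr)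
    assume "\<not> c < V u"
    then have "u \<in> S" using that s by (auto simp: S_def)
    then have "u \<le> s" unfolding s_def using bdd by (rule cSup_upper)
    then show False using that by simp
  qed
  have x_eq: "x u = x s + integral {s..u} (\<lambda>s. drift (x s))" if "u \<in> {s..t}" for u
  proof -
    have "i s = i u"
      by (rule frozen) (use that s after beyond in \<open>auto simp: V\<close>)
    then show ?thesis using increment_eq[of s u] that s by (simp add: algebra_simps)
  qed
  have "V t \<le> V s"
  proof (rule DERIV_nonpos_imp_decreasing_open[OF less_imp_le[OF s(2)]])
    show "continuous_on {s..t} V" using contV s by (auto intro: continuous_on_subset)
    fix u assume u: "s < u" "u < t"
    have "((\<lambda>u. integral {s..u} (\<lambda>s. drift (x s))) has_vector_derivative drift (x u)) (at u within {s..t})"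
      by (rule integral_has_vector_derivative) (use u s in \<open>auto intro!: continuous_intros cont_x_on\<close>)
    then have "((\<lambda>u. x s + integral {s..u} (\<lambda>s. drift (x s))) has_vector_derivative drift (x u)) (at u within {s..t})"
      by (auto intro!: derivative_eq_intros)
    then have "(x has_vector_derivative drift (x u)) (at u within {s..t})"
      by (rule has_vector_derivative_transform[rotated 2]) (use u in simp, rule x_eq)
    moreover have "at u within {s..t} = at u" using u by (intro at_within_interior) simp
    ultimately have "(x has_derivative (\<lambda>h. h *\<^sub>R drift (x u))) (at u)"
      by (simp add: has_vector_derivative_def)
    then have "(V has_derivative (\<lambda>h. \<kappa> * (x u \<bullet> (h *\<^sub>R drift (x u)) + (h *\<^sub>R drift (x u)) \<bullet> x u))) (at u)"
      unfolding V_def by (intro derivative_intros)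
    then have "(V has_real_derivative 2 * (\<kappa> * (x u \<bullet> drift (x u)))) (at u)"
      by (rule has_derivative_imp_has_field_derivative) (simp add: inner_commute algebra_simps)
    moreover have "\<kappa> * (x u \<bullet> drift (x u)) \<le> 0" using after[of u] u beyond by (simp add: V)
    ultimately show "\<exists>y. (V has_real_derivative y) (at u) \<and> y \<le> 0"
      by (intro exI[of _ "2 * (\<kappa> * (x u \<bullet> drift (x u)))"]) auto
  qed
  then show False using Vt s by simp
qed

text \<open>Because h is nonnegative its integral increases with t, so a bound at arbitrarily late
  times is enough. This is why mere recurrence of the Ito integral can stand in for its
  convergence.\<close>

lemma drift_integral_bounded:
  fixes N :: nat
  assumes freq: "\<exists>\<^sub>F n in sequentially. norm (i (real n) - i 0) \<le> K"
    and bnd: "\<And>t. 0 \<le> t \<Longrightarrow> norm (x t) \<le> B"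
    and h: "continuous_on {real N..} h" "\<And>s. real N \<le> s \<Longrightarrow> 0 \<le> h s"
      "\<And>s. real N \<le> s \<Longrightarrow> h s \<le> drift (x s) \<bullet> v"
  shows "\<exists>C. \<forall>t\<ge>real N. integral {real N..t} h \<le> C"
proof -
  define C where "C = (2 * B + (K + norm (i N - i 0))) * norm v"
  have hi: "h integrable_on {real N..t}" for t
    using h(1) by (intro integrable_continuous_interval) (auto intro: continuous_on_subset)
  have "integral {real N..t} h \<le> C" if t: "real N \<le> t" for t
  proof -
    obtain n :: nat where n: "t \<le> real n" "norm (i n - i 0) \<le> K"
    proof -
      have "\<forall>\<^sub>F n in sequentially. t \<le> real n"
        using filterlim_real_sequentially by (simp add: filterlim_at_top)
      from frequently_eventually_frequently[OF freq this]
      have "\<exists>\<^sub>F n in sequentially. norm (i (real n) - i 0) \<le> K \<and> t \<le> real n" .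
      then obtain n where "norm (i (real n) - i 0) \<le> K \<and> t \<le> real n"
        by (rule frequentlyE)
      then show ?thesis using that by blast
    qed
    have nN: "real N \<le> real n" using n t by simp
    have "integral {real N..t} h \<le> integral {real N..real n} h"
      using n h(2) by (intro integral_subset_le hi) auto
    also have "\<dots> \<le> integral {real N..real n} (\<lambda>s. drift (x s) \<bullet> v)"
      using h(3) by (intro integral_le hi integrable_continuous_interval)
        (auto intro!: continuous_intros cont_x_on)
    also have "\<dots> = integral {real N..real n} (\<lambda>s. drift (x s)) \<bullet> v"
      by (intro integral_component_eq integrable_continuous_interval continuous_intros cont_x_on) simp
    also have "\<dots> = ((x n - x N) - ((i n - i 0) - (i N - i 0))) \<bullet> v"
      using increment_eq[OF _ nN] by simp
    also have "\<dots> \<le> norm ((x n - x N) - ((i n - i 0) - (i N - i 0))) * norm v"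
      by (rule norm_cauchy_schwarz)
    also have "\<dots> \<le> C"
      unfolding C_def using bnd[of n] bnd[of N] n(2)
      by (intro mult_right_mono) (norm, simp)
    finally show ?thesis .
  qed
  then show ?thesis by blast
qed


text \<open>Both halves test the drift against a fixed vector and apply
  \<open>drift_integral_bounded\<close>. Testing against \<open>drift l\<close> shows that the drift
  at the limit vanishes, as the integral would otherwise grow linearly; testing against
  \<open>ort l\<close> isolates the rotation.\<close>

lemma convergent_path:
  assumes lim: "(x \<longlongrightarrow> l) at_top"
    and freq: "\<exists>\<^sub>F n in sequentially. norm (i (real n) - i 0) \<le> K"
    and bnd: "\<And>t. 0 \<le> t \<Longrightarrow> norm (x t) \<le> B"
    and lower: "\<And>t. 0 \<le> t \<Longrightarrow> r \<le> norm (x t)" and "0 < r"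
  shows "\<exists>(N::nat) C. (\<forall>s\<ge>real N. 3/4 \<le> norm (x s) \<and> norm (x s) \<le> 3/2) \<and>
    (\<forall>t\<ge>real N. integral {real N..t} (\<lambda>s. \<bar>norm (x s) - 1\<bar>) \<le> C)"
proof -
  \<comment> \<open>A natural number as threshold keeps the family of exceptional null sets
    countable in the final argument.\<close>
  have ev_nat: "\<exists>N::nat. \<forall>s\<ge>real N. P s" if ev: "eventually P at_top" for P :: "real \<Rightarrow> bool"
  proof -
    obtain T where T: "\<And>s. T \<le> s \<Longrightarrow> P s" using ev unfolding eventually_at_top_linorder by blast
    obtain N :: nat where "T \<le> real N" using real_arch_simple by blast
    then show ?thesis using T by (intro exI[of _ N]) auto
  qed
  have "isCont drift l"
    using continuous_on_drift[of UNIV "\<lambda>x. x"] by (simp add: continuous_on_eq_continuous_at)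
  then have lim_drift: "((\<lambda>s. drift (x s)) \<longlongrightarrow> drift l) at_top"
    using lim by (rule isCont_tendsto_compose)
  have "drift l = 0"
  proof (rule ccontr)
    assume "drift l \<noteq> 0"
    define m where "m = drift l \<bullet> drift l / 2"
    have m: "m > 0" "m < drift l \<bullet> drift l" using \<open>drift l \<noteq> 0\<close> by (auto simp: m_def)
    have "((\<lambda>s. drift (x s) \<bullet> drift l) \<longlongrightarrow> drift l \<bullet> drift l) at_top"
      by (intro tendsto_intros lim_drift)
    then have "\<forall>\<^sub>F s in at_top. m < drift (x s) \<bullet> drift l" using m(2) by (rule order_tendstoD(1))
    from ev_nat[OF this] obtain N :: nat where N: "\<And>s. real N \<le> s \<Longrightarrow> m < drift (x s) \<bullet> drift l" by blast
    obtain C where C: "\<And>t. real N \<le> t \<Longrightarrow> integral {real N..t} (\<lambda>_. m) \<le> C"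
      using drift_integral_bounded[OF freq bnd, of N "\<lambda>_. m" "drift l"] N m
      by (force intro: less_imp_le)
    have "integral {real N..real N + (\<bar>C\<bar> + 1) / m} (\<lambda>_. m) = \<bar>C\<bar> + 1" using m by simp
    then show False using C[of "real N + (\<bar>C\<bar> + 1) / m"] m by simp
  qed
  \<comment> \<open>The drift also vanishes at the origin; the lower bound r on the path excludes
    that limit.\<close>
  have "r \<le> norm l"
    by (rule tendsto_lowerbound[OF tendsto_norm[OF lim]])
      (auto simp: eventually_at_top_linorder intro!: exI[of _ 0] lower)
  then have "l \<noteq> 0" using \<open>0 < r\<close> by auto
  moreover have "slope (norm l) * (norm l)\<^sup>2 = 0" using inner_drift[of l] \<open>drift l = 0\<close> by simp
  ultimately have "fgrad l = 0" by (simp add: fgrad_def)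
  then have l1: "norm l = 1" using \<open>l \<noteq> 0\<close> by (simp add: fgrad_eq_0_iff)
  \<comment> \<open>With q the distance of the norm from 1,
    \<open>drift (x s) \<bullet> ort l\<close> is at least q times this expression: the rotation
    contributes q times \<open>x s \<bullet> l\<close>, and the slope is at most 4 q in absolute
    value once the norm is at least 1/2. Its limit is 1, so 1/2 is eventually a lower bound.\<close>
  have "((\<lambda>s. x s \<bullet> l - 4 * \<bar>x s \<bullet> ort l\<bar>) \<longlongrightarrow> l \<bullet> l - 4 * \<bar>l \<bullet> ort l\<bar>) at_top"
    by (intro tendsto_intros lim)
  moreover have "l \<bullet> l = 1" using l1 by (simp add: power2_norm_eq_inner[symmetric])
  ultimately have "((\<lambda>s. x s \<bullet> l - 4 * \<bar>x s \<bullet> ort l\<bar>) \<longlongrightarrow> 1) at_top" by simp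
  then have "\<forall>\<^sub>F s in at_top. 1/2 < x s \<bullet> l - 4 * \<bar>x s \<bullet> ort l\<bar>" by (rule order_tendstoD(1)) simp
  moreover have "((\<lambda>s. norm (x s)) \<longlongrightarrow> 1) at_top" using tendsto_norm[OF lim] l1 by simp
  then have "\<forall>\<^sub>F s in at_top. 3/4 < norm (x s)" "\<forall>\<^sub>F s in at_top. norm (x s) < 3/2"
    by (rule order_tendstoD; simp)+
  ultimately have "\<forall>\<^sub>F s in at_top. 1/2 < x s \<bullet> l - 4 * \<bar>x s \<bullet> ort l\<bar> \<and> 3/4 < norm (x s) \<and> norm (x s) < 3/2"
    by eventually_elim simp
  from ev_nat[OF this] obtain N :: nat where
    "\<forall>s\<ge>real N. 1/2 < x s \<bullet> l - 4 * \<bar>x s \<bullet> ort l\<bar> \<and> 3/4 < norm (x s) \<and> norm (x s) < 3/2" ..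
  then have N: "\<And>s. real N \<le> s \<Longrightarrow> 1/2 < x s \<bullet> l - 4 * \<bar>x s \<bullet> ort l\<bar>"
    "\<And>s. real N \<le> s \<Longrightarrow> 3/4 < norm (x s) \<and> norm (x s) < 3/2" by blast+
  have le: "\<bar>norm (x s) - 1\<bar> / 2 \<le> drift (x s) \<bullet> ort l" if "real N \<le> s" for s
  proof -
    define q where "q = \<bar>norm (x s) - 1\<bar>"
    have n: "1/2 \<le> norm (x s)" using N(2)[OF that] by simp
    have "\<bar>slope (norm (x s))\<bar> * (1/2) \<le> \<bar>slope (norm (x s))\<bar> * norm (x s)" using n by (intro mult_left_mono) auto
    then have "\<bar>slope (norm (x s))\<bar> \<le> 4 * q"
      using norm_fgrad_outer[OF n] by (simp add: norm_fgrad q_def)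
    then have "\<bar>slope (norm (x s)) * (x s \<bullet> ort l)\<bar> \<le> 4 * q * \<bar>x s \<bullet> ort l\<bar>"
      unfolding abs_mult by (rule mult_right_mono) simp
    moreover have "drift (x s) \<bullet> ort l = q * (x s \<bullet> l) - slope (norm (x s)) * (x s \<bullet> ort l)"
      by (simp add: drift_def fgrad_def inner_add_left inner_diff_left q_def)
    moreover have "q * (1/2) \<le> q * (x s \<bullet> l - 4 * \<bar>x s \<bullet> ort l\<bar>)"
      using N(1)[OF that] by (intro mult_left_mono) (auto simp: q_def)
    ultimately show ?thesis unfolding q_def[symmetric] by (simp add: algebra_simps)
  qed
  have "\<exists>C. \<forall>t\<ge>real N. integral {real N..t} (\<lambda>s. \<bar>norm (x s) - 1\<bar> / 2) \<le> C"
  proof (rule drift_integral_bounded[OF freq bnd])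
    show "continuous_on {real N..} (\<lambda>s. \<bar>norm (x s) - 1\<bar> / 2)"
      using continuous_on_subset[OF cont_x, of "{real N..}"] by (auto intro!: continuous_intros)
  qed (use le in auto)
  then obtain C where "\<forall>t\<ge>real N. integral {real N..t} (\<lambda>s. \<bar>norm (x s) - 1\<bar> / 2) \<le> C" by blast
  then have "\<forall>t\<ge>real N. integral {real N..t} (\<lambda>s. \<bar>norm (x s) - 1\<bar>) \<le> 2 * C"
    by (simp add: mult.commute)
  then show ?thesis using N(2) by (intro exI[of _ N] exI[of _ "2 * C"]) (auto intro: less_imp_le)
qed

text \<open>Expanding \<open>(norm (x (t n + 1)))\<^sup>2\<close> around \<open>x (t n)\<close>, every term except the radial noise is summable.\<close>

lemma summable_radial_noise:
  fixes w :: "nat \<Rightarrow> real^2" and \<epsilon> :: "nat \<Rightarrow> real" and N :: nat and \<theta> C :: real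
  defines "t \<equiv> \<lambda>n. real n + \<theta>"
  assumes "0 \<le> \<theta>"
    and annulus: "\<And>s. real N \<le> s \<Longrightarrow> 3/4 \<le> norm (x s)" "\<And>s. real N \<le> s \<Longrightarrow> norm (x s) \<le> 3/2"
    and int: "\<And>t. real N \<le> t \<Longrightarrow> integral {real N..t} (\<lambda>s. \<bar>norm (x s) - 1\<bar>) \<le> C"
    and noise: "\<forall>\<^sub>F n in sequentially. norm (i (t n + 1) - i (t n) - (1 / (t n + 1)) *\<^sub>R w n) \<le> \<epsilon> n"
    and \<epsilon>: "summable \<epsilon>" "\<And>n. \<epsilon> n \<le> 1"
    and w: "summable (\<lambda>n. (1 / (t n + 1))\<^sup>2 * (norm (w n))\<^sup>2)"
    and dist: "summable (\<lambda>n. \<bar>norm (x (t n)) - 1\<bar>)"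
  shows "summable (\<lambda>n. 1 / (t n + 1) * \<bar>x (t n) \<bullet> w n\<bar>)"
proof -
  let ?r = "\<lambda>s. \<bar>norm (x s) - 1\<bar>"
  define q where "q n = \<bar>norm (x (t n)) - 1\<bar>" for n
  define d where "d n = integral {t n..t n + 1} ?r" for n
  have tS: "t (Suc n) = t n + 1" for n by (simp add: t_def)
  have t0: "0 \<le> t n" for n using \<open>0 \<le> \<theta>\<close> by (simp add: t_def)
  have tN: "real N \<le> t n" if "N \<le> n" for n using \<open>0 \<le> \<theta>\<close> that by (simp add: t_def)
  have ri: "?r integrable_on {a..b}" if "0 \<le> a" for a b
    using that by (intro integrable_continuous_interval continuous_intros cont_x_on)
  have d0: "0 \<le> d n" for n
    unfolding d_def by (intro integral_nonneg ri t0) auto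
  \<comment> \<open>Consecutive sampling times differ by exactly 1, so the intervals adjoin and the
    d n add up to one integral, bounded by C.\<close>
  have dsum: "(\<Sum>k<n. d (N + k)) = integral {t N..t (N + n)} ?r" for n
  proof (induction n)
    case (Suc n)
    have "integral {t N..t (N + n)} ?r + integral {t (N + n)..t (N + Suc n)} ?r
       = integral {t N..t (N + Suc n)} ?r"
      by (rule Henstock_Kurzweil_Integration.integral_combine) (simp_all add: t_def ri[OF t0[unfolded t_def]])
    then show ?case using Suc tS[of "N + n"] by (simp add: d_def)
  qed simp
  have intC: "integral {t N..t m} ?r \<le> C" if "N \<le> m" for m
  proof -
    have "integral {t N..t m} ?r \<le> integral {real N..t m} ?r"
      using tN[of N] t0 by (intro integral_subset_le ri) auto
    also have "\<dots> \<le> C" using int[OF tN[OF that]] .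
    finally show ?thesis .
  qed
  have "summable (\<lambda>k. d (N + k))"
  proof (rule bounded_imp_summable[of _ C])
    show "(\<Sum>k\<le>n. d (N + k)) \<le> C" for n
      using dsum[of "Suc n"] intC[of "N + Suc n"] by (simp add: lessThan_Suc_atMost)
  qed (rule d0)
  then have dsummable: "summable d"
    using summable_iff_shift[of d N] by (simp add: add.commute)
  \<comment> \<open>Needed to bound the square of the drift increment by a multiple of d n, rather
    than by its square.\<close>
  have dC: "d n \<le> C" if "N \<le> n" for n
  proof -
    have "d n \<le> (\<Sum>k<Suc (n - N). d (N + k))"
      using that sum_nonneg[of "{..<n - N}" "\<lambda>k. d (N + k)"] d0 by simp
    also have "\<dots> \<le> C" unfolding dsum using that by (intro intC) simp
    finally show ?thesis .
  qed
  \<comment> \<open>The increment D is e + c w + h (drift, frozen noise, error of freezing), and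
    |y'|^2 = |y|^2 + 2 y.D + |D|^2 is solved for the noise term. As norms are at most 3/2, the
    difference of a squared norm from 1 costs the factor 5/2, rounded to 3. The drift gives 9 d
    linearly and 27 C d through |D|^2; the error gives 3 \<epsilon> twice.\<close>
  have main: "1 / (t n + 1) * \<bar>x (t n) \<bullet> w n\<bar> \<le>
      3 * q (Suc n) + 3 * q n + (9 + 27 * C) * d n + 6 * \<epsilon> n + 3 * ((1 / (t n + 1))\<^sup>2 * (norm (w n))\<^sup>2)"
    if n: "N \<le> n" "norm (i (t n + 1) - i (t n) - (1 / (t n + 1)) *\<^sub>R w n) \<le> \<epsilon> n" for n
  proof -
    define c where "c = 1 / (t n + 1)"
    define e where "e = integral {t n..t n + 1} (\<lambda>s. drift (x s))"
    define h where "h = i (t n + 1) - i (t n) - c *\<^sub>R w n"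
    define y where "y = x (t n)"
    define y' where "y' = x (t n + 1)"
    have y'_eq: "y' = y + (e + c *\<^sub>R w n + h)"
      using increment_eq[OF t0, of n "t n + 1"] by (simp add: y_def y'_def e_def h_def algebra_simps)
    have yb: "norm y \<le> 3/2" "norm y' \<le> 3/2"
      using annulus(2) tN[OF n(1)] unfolding y_def y'_def by auto
    have sq: "\<bar>(norm z)\<^sup>2 - 1\<bar> \<le> 5/2 * \<bar>norm z - 1\<bar>" if "norm z \<le> 3/2" for z :: "real^2"
    proof -
      have "\<bar>(norm z)\<^sup>2 - 1\<bar> = (norm z + 1) * \<bar>norm z - 1\<bar>"
      proof -
        have "(norm z)\<^sup>2 - 1 = (norm z + 1) * (norm z - 1)"
          by (simp add: power2_eq_square algebra_simps)
        then show ?thesis by (simp only: abs_mult) simp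
      qed
      also have "\<dots> \<le> 5/2 * \<bar>norm z - 1\<bar>" using that by (intro mult_right_mono) auto
      finally show ?thesis .
    qed
    have en: "norm e \<le> 3 * d n"
    proof -
      have "norm e \<le> integral {t n..t n + 1} (\<lambda>s. 3 * \<bar>norm (x s) - 1\<bar>)"
        unfolding e_def
      proof (rule integral_norm_bound_integral)
        show "(\<lambda>s. drift (x s)) integrable_on {t n..t n + 1}"
          by (intro integrable_continuous_interval continuous_intros cont_x_on t0)
        show "(\<lambda>s. 3 * \<bar>norm (x s) - 1\<bar>) integrable_on {t n..t n + 1}"
          using integrable_on_cmult_left[OF ri[OF t0]] by simp
        fix s assume "s \<in> {t n..t n + 1}"
        then have "real N \<le> s" using tN[OF n(1)] by simp
        then show "norm (drift (x s)) \<le> 3 * \<bar>norm (x s) - 1\<bar>"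
          using annulus[of s] by (intro norm_drift_annulus) auto
      qed
      then show ?thesis by (simp add: d_def)
    qed
    have hn: "norm h \<le> \<epsilon> n" using n(2) by (simp add: h_def c_def)
    have e0: "0 \<le> \<epsilon> n" using hn norm_ge_zero order_trans by blast
    have c0: "0 \<le> c" using t0[of n] by (simp add: c_def)
    define D where "D = e + c *\<^sub>R w n + h"
    have "(norm y')\<^sup>2 = (norm y)\<^sup>2 + 2 * (y \<bullet> D) + (norm D)\<^sup>2"
      unfolding y'_eq D_def[symmetric]
      by (simp add: power2_norm_eq_inner inner_add_left inner_add_right inner_commute)
    moreover have "y \<bullet> D = y \<bullet> e + c * (y \<bullet> w n) + y \<bullet> h" by (simp add: D_def inner_add_right)
    ultimately have eq: "2 * (c * (y \<bullet> w n)) = ((norm y')\<^sup>2 - 1) - ((norm y)\<^sup>2 - 1) - 2 * (y \<bullet> e) - 2 * (y \<bullet> h) - (norm D)\<^sup>2"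
      by simp
    have ye: "\<bar>y \<bullet> z\<bar> \<le> 3/2 * norm z" for z
      using Cauchy_Schwarz_ineq2[of y z] mult_right_mono[OF yb(1) norm_ge_zero[of z]] by linarith
    have "norm D \<le> norm e + norm (c *\<^sub>R w n) + norm h"
      unfolding D_def using norm_triangle_ineq[of "e + c *\<^sub>R w n" h] norm_triangle_ineq[of e "c *\<^sub>R w n"]
      by linarith
    then have "(norm D)\<^sup>2 \<le> (norm e + norm (c *\<^sub>R w n) + norm h)\<^sup>2" by (intro power_mono) auto
    also have "\<dots> \<le> 3 * (norm e)\<^sup>2 + 3 * (norm (c *\<^sub>R w n))\<^sup>2 + 3 * (norm h)\<^sup>2"
    proof -
      have "(a + b + g)\<^sup>2 \<le> 3 * a\<^sup>2 + 3 * b\<^sup>2 + 3 * g\<^sup>2" for a b g :: real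
        using zero_le_power2[of "a - b"] zero_le_power2[of "b - g"] zero_le_power2[of "a - g"]
        by (simp add: power2_eq_square algebra_simps)
      then show ?thesis .
    qed
    also have "(norm e)\<^sup>2 \<le> 9 * C * d n"
    proof -
      have "(norm e)\<^sup>2 \<le> (3 * d n)\<^sup>2" using en by (intro power_mono) auto
      also have "\<dots> = 9 * (d n * d n)" by (simp add: power2_eq_square)
      also have "\<dots> \<le> 9 * (C * d n)" using dC[OF n(1)] d0[of n] by (intro mult_left_mono mult_right_mono) auto
      finally show ?thesis by simp
    qed
    also have "(norm h)\<^sup>2 \<le> \<epsilon> n"
    proof -
      have "(norm h)\<^sup>2 \<le> (\<epsilon> n)\<^sup>2" using hn by (intro power_mono) auto
      also have "\<dots> \<le> \<epsilon> n" using \<epsilon>(2)[of n] e0 by (simp add: power2_eq_square mult_left_le)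
      finally show ?thesis .
    qed
    finally have Db: "(norm D)\<^sup>2 \<le> 27 * C * d n + 3 * (c\<^sup>2 * (norm (w n))\<^sup>2) + 3 * \<epsilon> n"
      by (simp add: power_mult_distrib)
    have "\<bar>2 * (c * (y \<bullet> w n))\<bar> \<le> \<bar>(norm y')\<^sup>2 - 1\<bar> + \<bar>(norm y)\<^sup>2 - 1\<bar> + 2 * \<bar>y \<bullet> e\<bar> + 2 * \<bar>y \<bullet> h\<bar> + (norm D)\<^sup>2"
      unfolding eq using zero_le_power2[of "norm D"] by linarith
    also have "\<dots> \<le> 5/2 * q (Suc n) + 5/2 * q n + 3 * (3 * d n) + 3 * \<epsilon> n + (27 * C * d n + 3 * (c\<^sup>2 * (norm (w n))\<^sup>2) + 3 * \<epsilon> n)"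
      using sq[OF yb(1)] sq[OF yb(2)] ye[of e] ye[of h] en hn Db
      unfolding q_def tS y_def[symmetric] y'_def[symmetric] by linarith
    also have "\<dots> \<le> 3 * q (Suc n) + 3 * q n + (9 + 27 * C) * d n + 6 * \<epsilon> n + 3 * (c\<^sup>2 * (norm (w n))\<^sup>2)"
    proof -
      have "0 \<le> q n" "0 \<le> q (Suc n)" by (simp_all add: q_def)
      then show ?thesis unfolding distrib_right by linarith
    qed
    finally have "2 * (c * \<bar>y \<bullet> w n\<bar>) \<le> 3 * q (Suc n) + 3 * q n + (9 + 27 * C) * d n + 6 * \<epsilon> n + 3 * (c\<^sup>2 * (norm (w n))\<^sup>2)"
      using c0 by (simp add: abs_mult)
    moreover have "0 \<le> c * \<bar>y \<bullet> w n\<bar>" using c0 by simp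
    ultimately show ?thesis unfolding c_def[symmetric] y_def[symmetric] by linarith
  qed
  have qs: "summable q" using dist by (simp add: q_def[abs_def])
  have "summable (\<lambda>n. 3 * q (Suc n) + 3 * q n + (9 + 27 * C) * d n + 6 * \<epsilon> n + 3 * ((1 / (t n + 1))\<^sup>2 * (norm (w n))\<^sup>2))"
    using qs dsummable \<epsilon>(1) w by (intro summable_add summable_mult) (simp_all only: summable_Suc_iff)
  moreover have "\<forall>\<^sub>F n in sequentially. norm (1 / (t n + 1) * \<bar>x (t n) \<bullet> w n\<bar>) \<le>
    3 * q (Suc n) + 3 * q n + (9 + 27 * C) * d n + 6 * \<epsilon> n + 3 * ((1 / (t n + 1))\<^sup>2 * (norm (w n))\<^sup>2)"
    using noise eventually_ge_at_top[of N]
  proof eventually_elim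
    case (elim n)
    then show ?case using main[OF elim(2,1)] t0[of n] by simp
  qed
  ultimately show ?thesis by (rule summable_comparison_test_ev[rotated])
qed

end

section \<open>The stochastic differential equation\<close>

text \<open>Rounding time down to multiples of 1 / (k + 1) leaves only countably many random
  variables, which gives joint measurability; continuity of the paths carries it to the limit.
  Fubini in the time offset depends on it.\<close>

lemma borel_measurable_pair_continuous_paths:
  fixes Y :: "real \<Rightarrow> 'w \<Rightarrow> 'b::metric_space"
  assumes meas: "\<And>t. Y t \<in> borel_measurable M"
    and cont: "\<And>\<omega>. \<omega> \<in> space M \<Longrightarrow> continuous_on UNIV (\<lambda>t. Y t \<omega>)"
  shows "(\<lambda>p. Y (fst p) (snd p)) \<in> borel_measurable (borel \<Otimes>\<^sub>M M)"
proof (rule borel_measurable_LIMSEQ_metric)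
  define u where "u k t = of_int \<lfloor>t * real (Suc k)\<rfloor> / real (Suc k)" for k t
  show "(\<lambda>p. Y (u k (fst p)) (snd p)) \<in> borel_measurable (borel \<Otimes>\<^sub>M M)" for k
    unfolding u_def
  proof (rule measurable_compose_countable[where f = "\<lambda>j p. Y (of_int j / real (Suc k)) (snd p)"
        and g = "\<lambda>p. \<lfloor>fst p * real (Suc k)\<rfloor>"])
    show "(\<lambda>p. Y (of_int j / real (Suc k)) (snd p)) \<in> borel_measurable (borel \<Otimes>\<^sub>M M)" for j
      using meas by measurable
    show "(\<lambda>p. \<lfloor>fst p * real (Suc k)\<rfloor>) \<in> borel \<Otimes>\<^sub>M M \<rightarrow>\<^sub>M count_space UNIV"
      by measurable
  qed
  fix p :: "real \<times> 'w" assume "p \<in> space (borel \<Otimes>\<^sub>M M)"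
  then have "snd p \<in> space M" by (auto simp: space_pair_measure)
  then have "isCont (\<lambda>t. Y t (snd p)) (fst p)"
    using cont by (simp add: continuous_on_eq_continuous_at)
  moreover have "(\<lambda>k. u k t) \<longlonglongrightarrow> t" for t
  proof (rule tendsto_sandwich)
    show "\<forall>\<^sub>F k in sequentially. t - 1 / real (Suc k) \<le> u k t"
    proof (intro always_eventually allI)
      fix k
      have "t * real (Suc k) - 1 \<le> of_int \<lfloor>t * real (Suc k)\<rfloor>" by linarith
      then have "(t * real (Suc k) - 1) / real (Suc k) \<le> u k t"
        unfolding u_def by (rule divide_right_mono) simp
      then show "t - 1 / real (Suc k) \<le> u k t" by (simp add: diff_divide_distrib)
    qed
    show "\<forall>\<^sub>F k in sequentially. u k t \<le> t"
    proof (intro always_eventually allI)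
      fix k
      have "u k t \<le> (t * real (Suc k)) / real (Suc k)"
        unfolding u_def by (rule divide_right_mono) (auto simp del: of_nat_Suc)
      then show "u k t \<le> t" by simp
    qed
    show "(\<lambda>k. t - 1 / real (Suc k)) \<longlonglongrightarrow> t"
      using tendsto_diff[OF tendsto_const LIMSEQ_inverse_real_of_nat, of t] by (simp add: inverse_eq_divide)
  qed simp
  ultimately show "(\<lambda>k. Y (u k (fst p)) (snd p)) \<longlonglongrightarrow> Y (fst p) (snd p)"
    by (intro isCont_tendsto_compose[of _ "\<lambda>t. Y t (snd p)"])
qed

lemma nn_integral_eq_HK_integral:
  fixes f :: "real \<Rightarrow> real"
  assumes "continuous_on {a..b} f" "\<And>s. s \<in> {a..b} \<Longrightarrow> 0 \<le> f s"
  shows "(\<integral>\<^sup>+s\<in>{a..b}. ennreal (f s) \<partial>lborel) = ennreal (integral {a..b} f)"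
proof -
  have si: "set_integrable lborel {a..b} f" by (rule borel_integrable_atLeastAtMost'[OF assms(1)])
  have "(\<integral>\<^sup>+s\<in>{a..b}. ennreal (f s) \<partial>lborel) = (\<integral>\<^sup>+s. ennreal (indicator {a..b} s *\<^sub>R f s) \<partial>lborel)"
    by (intro nn_integral_cong) (auto simp: indicator_def)
  also have "\<dots> = ennreal (LINT s:{a..b}|lborel. f s)"
    unfolding set_lebesgue_integral_def using si assms(2)
    by (intro nn_integral_eq_integral) (auto simp: set_integrable_def indicator_def)
  also have "(LINT s:{a..b}|lborel. f s) = integral {a..b} f"
    by (rule set_borel_integral_eq_integral(2)[OF si])
  finally show ?thesis .
qed

lemma norm_scaleR_mat1_sq: "(norm (c *\<^sub>R mat 1 :: real^2^2))\<^sup>2 = 2 * c\<^sup>2"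
proof -
  have "(norm (mat 1 :: real^2^2))\<^sup>2 = 2"
    unfolding norm_matrix_sq by (simp add: sum_2 mat_def)
  then show ?thesis by (simp add: power_mult_distrib)
qed

lemma scaleR_mat1_mult [simp]: "(c *\<^sub>R mat 1) *v w = c *\<^sub>R (w :: real^'n)"
  by (simp add: scaleR_matrix_vector_assoc[symmetric])

lemma slope_nonneg: "1 \<le> r \<Longrightarrow> 0 \<le> slope r"
  by (simp add: slope_def divide_le_eq)

lemma slope_nonpos: "r < 1/2 \<Longrightarrow> slope r \<le> 0"
  by (simp add: slope_def)

lemma (in drift_path) path_0: "x 0 = x0 + i 0"
proof -
  have "(LINT s:{0..0}|lborel. drift (x s)) = integral {0..0} (\<lambda>s. drift (x s))"
    by (rule set_borel_integral_eq_integral(2), rule borel_integrable_atLeastAtMost',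
        intro continuous_intros cont_x_on) simp
  then show ?thesis using path_eq[of 0] by simp
qed

lemma (in filtered_brownian_motion) AE_ito_0:
  fixes H :: "real \<Rightarrow> 'w \<Rightarrow> real^'n^'m"
  assumes "is_ito_integral M F W H I"
  shows "AE \<omega> in M. I 0 \<omega> = 0"
proof -
  obtain n \<tau> \<xi> where simple: "\<And>k. simple_integrand M F (n k) (\<tau> k) (\<xi> k)"
    and approx_T: "\<And>T. 0 \<le> T \<Longrightarrow> null_in_probability M (\<lambda>k \<omega>. SUP t\<in>{0..T}. ennreal
            (norm (simple_integral W (n k) (\<tau> k) (\<xi> k) t \<omega> - I t \<omega>)))"
    using assms unfolding is_ito_integral_def by blast
  note approx = approx_T[OF order_refl]
  have \<tau>: "0 \<le> \<tau> k j" if "j \<le> n k" for k j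
  proof -
    have "0 \<le> \<tau> k 0" and mono: "\<And>i. i < n k \<Longrightarrow> \<tau> k i \<le> \<tau> k (Suc i)"
      using simple[of k] unfolding simple_integrand_def by auto
    then show ?thesis using steps_mono[of "n k" "\<tau> k" 0 j, OF mono _ that] by simp
  qed
  have J0: "simple_integral W (n k) (\<tau> k) (\<xi> k) 0 \<omega> = 0" for k \<omega>
    unfolding simple_integral_def using \<tau> by (intro sum.neutral) (simp add: min_def)
  have I_meas: "(\<lambda>\<omega>. ennreal (norm (I 0 \<omega>))) \<in> borel_measurable M"
    using approx by (simp add: J0 null_in_probability_def)
  have lim: "(\<lambda>k::nat. prob {\<omega> \<in> space M. ennreal \<epsilon> < ennreal (norm (I 0 \<omega>))}) \<longlonglongrightarrow> 0" if "\<epsilon> > 0" for \<epsilon>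
    using approx that by (simp add: J0 null_in_probability_def)
  have "AE \<omega> in M. norm (I 0 \<omega>) \<le> 1 / real (Suc k)" for k
  proof -
    have "prob {\<omega> \<in> space M. ennreal (1 / real (Suc k)) < ennreal (norm (I 0 \<omega>))} = 0"
      using lim[of "1 / real (Suc k)"] by (simp add: LIMSEQ_const_iff del: of_nat_Suc)
    then show ?thesis using I_meas
      by (intro AE_I[of _ _ "{\<omega> \<in> space M. ennreal (1 / real (Suc k)) < ennreal (norm (I 0 \<omega>))}"])
        (auto simp: emeasure_eq_measure not_le ennreal_less_iff simp del: of_nat_Suc)
  qed
  then have "AE \<omega> in M. \<forall>k. norm (I 0 \<omega>) \<le> 1 / real (Suc k)"
    unfolding AE_all_countable by (rule allI)
  then show ?thesis
  proof eventually_elim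
    case (elim \<omega>)
    then have "norm (I 0 \<omega>) \<le> 0" by (intro nonpos_if_le_inverse_Suc) blast
    then show ?case by simp
  qed
qed

locale spiral_sde = filtered_brownian_motion M F W
  for M :: "'w measure" and F :: "real \<Rightarrow> 'w measure" and W :: "real \<Rightarrow> 'w \<Rightarrow> real^2" +
  fixes X I :: "real \<Rightarrow> 'w \<Rightarrow> real^2" and \<phi> :: "real^2 \<Rightarrow> real" and x0 :: "real^2"
  assumes phi_range: "\<And>x. \<phi> x \<in> {0..1}"
    and phi_one: "\<And>x. x \<in> ball 0 2 - ball 0 (2/3) \<Longrightarrow> \<phi> x = 1"
    and phi_zero: "\<And>x. x \<in> ball 0 (1/2) \<union> - ball 0 3 \<Longrightarrow> \<phi> x = 0"
    and x0: "x0 \<noteq> 0"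
    and adapted_X: "adapted F X" and continuous_X: "continuous_paths M X"
    and ito: "is_ito_integral M F W (\<lambda>t \<omega>. (1 / (t + 1) * \<phi> (X t \<omega>)) *\<^sub>R mat 1) I"
    and sde: "AE \<omega> in M. \<forall>t\<ge>0. X t \<omega> = x0 + (LINT s:{0..t}|lborel. drift (X s \<omega>)) + I t \<omega>"
begin

abbreviation "H \<equiv> \<lambda>t \<omega>. (1 / (t + 1) * \<phi> (X t \<omega>)) *\<^sub>R (mat 1 :: real^2^2)"

section \<open>Bounds on the noise coefficient and on the solution\<close>

lemma norm_H_sq_le: "0 \<le> t \<Longrightarrow> (norm (H t \<omega>))\<^sup>2 \<le> 2 / (t + 1)\<^sup>2"
proof -
  assume "0 \<le> t"
  have "(\<phi> (X t \<omega>))\<^sup>2 \<le> 1" using phi_range[of "X t \<omega>"] by (simp add: power_le_one)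
  then show ?thesis
    unfolding norm_scaleR_mat1_sq by (simp add: power_mult_distrib power_divide divide_right_mono)
qed

lemma nn_integral_H: "(\<integral>\<^sup>+ s\<in>{0..}. ennreal ((norm (H s \<omega>))\<^sup>2) \<partial>lborel) \<le> ennreal 2"
proof -
  have "(\<integral>\<^sup>+ s\<in>{0..}. ennreal ((norm (H s \<omega>))\<^sup>2) \<partial>lborel) \<le> (\<integral>\<^sup>+ s. ennreal (2 / (s + 1)\<^sup>2) * indicator {0..} s \<partial>lborel)"
    using norm_H_sq_le by (intro nn_integral_mono) (auto simp: indicator_def intro!: ennreal_leI)
  also have "\<dots> = ennreal (0 - (- 2 / (0 + 1)))"
  proof (rule nn_integral_FTC_atLeast)
    show "((\<lambda>s::real. - 2 / (s + 1)) \<longlongrightarrow> 0) at_top" by real_asymp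
    show "((\<lambda>s. - 2 / (s + 1)) has_real_derivative 2 / (s + 1)\<^sup>2) (at s)" if "0 \<le> s" for s :: real
      using that by (auto intro!: derivative_eq_intros simp: power2_eq_square)
  qed auto
  finally show ?thesis by simp
qed

lemma AE_drift_path: "AE \<omega> in M. drift_path (\<lambda>t. X t \<omega>) (\<lambda>t. I t \<omega>) x0"
  using sde continuous_X[unfolded continuous_paths_def]
  by eventually_elim (simp add: drift_path_def)

text \<open>Two applications of \<open>barrier\<close>. The maximum and minimum with the norm of x0
  allow for a start inside one of the noise-free regions; the lower bound is positive since x0 is
  not 0, which later keeps a limit away from the origin.\<close>

lemma AE_bounds:
  "AE \<omega> in M. \<forall>t\<ge>0. min (norm x0) (1/2) \<le> norm (X t \<omega>) \<and> norm (X t \<omega>) \<le> max (norm x0) 3"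
  using AE_drift_path AE_ito_0[OF ito] AE_ito_constant[OF ito]
proof eventually_elim
  case (elim \<omega>)
  interpret drift_path "\<lambda>t. X t \<omega>" "\<lambda>t. I t \<omega>" x0 by (rule elim(1))
  have start: "X 0 \<omega> = x0" using path_0 elim(2) by simp
  have frozen: "I a \<omega> = I b \<omega>" if "0 \<le> a" "a \<le> b" "\<And>s. a < s \<Longrightarrow> s < b \<Longrightarrow> \<phi> (X s \<omega>) = 0" for a b
    using elim(3) that by auto
  show ?case
  proof (intro allI impI)
    fix t :: real assume t: "0 \<le> t"
    have "1 * (norm (X t \<omega>))\<^sup>2 \<le> (max (norm x0) 3)\<^sup>2"
    proof (rule barrier[where \<phi> = \<phi>, OF frozen _ _ t])
      show "1 * (norm (X 0 \<omega>))\<^sup>2 \<le> (max (norm x0) 3)\<^sup>2" unfolding start by (simp add: power_mono)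
      fix y :: "real^2" assume "(max (norm x0) 3)\<^sup>2 < 1 * (norm y)\<^sup>2"
      then have "max (norm x0) 3 < norm y"
        using power2_less_imp_less[of "max (norm x0) 3" "norm y"] by simp
      then have "3 < norm y" by simp
      then show "\<phi> y = 0 \<and> 1 * (y \<bullet> drift y) \<le> 0"
        using slope_nonneg[of "norm y"] phi_zero[of y] by (auto simp: inner_drift)
    qed auto
    then have "norm (X t \<omega>) \<le> max (norm x0) 3"
      using power2_le_imp_le[of "norm (X t \<omega>)" "max (norm x0) 3"] by simp
    moreover have "- 1 * (norm (X t \<omega>))\<^sup>2 \<le> - (min (norm x0) (1/2))\<^sup>2"
    proof (rule barrier[where \<phi> = \<phi>, OF frozen _ _ t])
      show "- 1 * (norm (X 0 \<omega>))\<^sup>2 \<le> - (min (norm x0) (1/2))\<^sup>2" unfolding start by (simp add: power_mono)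
      fix y :: "real^2" assume "- (min (norm x0) (1/2))\<^sup>2 < - 1 * (norm y)\<^sup>2"
      then have "norm y < min (norm x0) (1/2)"
        using power2_less_imp_less[of "norm y" "min (norm x0) (1/2)"] by simp
      then have "norm y < 1/2" by simp
      then show "\<phi> y = 0 \<and> - 1 * (y \<bullet> drift y) \<le> 0"
        using slope_nonpos[of "norm y"] phi_zero[of y] by (auto simp: inner_drift mult_nonpos_nonneg)
    qed auto
    then have "min (norm x0) (1/2) \<le> norm (X t \<omega>)"
      using power2_le_imp_le[of "min (norm x0) (1/2)" "norm (X t \<omega>)"] by simp
    ultimately show "min (norm x0) (1/2) \<le> norm (X t \<omega>) \<and> norm (X t \<omega>) \<le> max (norm x0) 3" by simp
  qed
qed

text \<open>Summable radii would make the radial noise summable, against the orthant hits. The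
  conditions on the path stand inside the almost sure statement: H agrees with the deterministic
  function of time only while the path stays where \<phi> is 1.\<close>

lemma AE_not_summable_radii:
  fixes N :: nat
  assumes \<theta>: "0 \<le> \<theta>" "\<theta> \<le> 1"
  shows "AE \<omega> in M. (\<forall>s\<ge>real N. 3/4 \<le> norm (X s \<omega>) \<and> norm (X s \<omega>) \<le> 3/2) \<longrightarrow>
    (\<forall>t\<ge>real N. integral {real N..t} (\<lambda>s. \<bar>norm (X s \<omega>) - 1\<bar>) \<le> C) \<longrightarrow>
    \<not> summable (\<lambda>n. \<bar>norm (X (real n + \<theta>) \<omega>) - 1\<bar>)"
proof -
  define t where "t n = real n + \<theta>" for n
  define c where "c n = 1 / (t n + 1)" for n
  define w where "w n \<omega> = W (t n + 1) \<omega> - W (t n) \<omega>" for n \<omega>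
  \<comment> \<open>The energy of H minus its frozen value over a unit step is at most 2 / (n +
    1)^4. An error (n + 1)^(-p) is summable for p > 1, and the ratio of \<delta> to its square is
    summable for p < 3/2; 5/4 lies midway.\<close>
  define \<epsilon> where "\<epsilon> n = real (Suc n) powr (-5/4)" for n
  define \<delta> where "\<delta> n = 2 / real (Suc n) ^ 4" for n
  have t0: "0 \<le> t n" for n using \<theta> by (simp add: t_def)
  have tn: "real n \<le> t n" for n using \<theta> by (simp add: t_def)
  have c: "0 \<le> c n" "c n \<le> 1 / real (Suc n)" for n
    using t0[of n] tn[of n] by (auto simp: c_def intro!: divide_left_mono)
  have sum_p: "summable (\<lambda>n. real (Suc n) powr s)" if "s < -1" for s
    using that by (subst summable_Suc_iff[of "\<lambda>n. real n powr s"]) (simp add: summable_real_powr_iff)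
  let ?q = "\<lambda>n \<omega>. indicat_real (orthant {i. 0 \<le> X (t n) \<omega> $ i}) (W (t n + 1) \<omega> - W (t n) \<omega>)"
  have approx: "AE \<omega> in M. \<forall>\<^sub>F n in sequentially.
    (\<integral>\<^sup>+ s\<in>{t n..t n + 1}. ennreal ((norm (H s \<omega> - c n *\<^sub>R mat 1))\<^sup>2) \<partial>lborel) \<le> ennreal (\<delta> n) \<longrightarrow>
    norm (I (t n + 1) \<omega> - I (t n) \<omega> - (c n *\<^sub>R mat 1) *v (W (t n + 1) \<omega> - W (t n) \<omega>)) \<le> \<epsilon> n"
  proof (rule AE_ito_increments_approx[OF ito t0])
    have "\<delta> n / (\<epsilon> n)\<^sup>2 = 2 * real (Suc n) powr - (3/2)" for n
    proof -
      have "(\<epsilon> n)\<^sup>2 = real (Suc n) powr (-5/2)"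
        by (simp add: \<epsilon>_def power2_eq_square powr_add[symmetric] del: of_nat_Suc)
      moreover have "real (Suc n) ^ 4 = real (Suc n) powr 4"
        by (subst powr_realpow[symmetric]) auto
      ultimately have "\<delta> n / (\<epsilon> n)\<^sup>2 = 2 / (real (Suc n) powr 4 * real (Suc n) powr (-5/2))"
        by (simp add: \<delta>_def del: of_nat_Suc)
      also have "\<dots> = 2 / real (Suc n) powr (3/2)"
        by (simp only: powr_add[symmetric]) simp
      also have "\<dots> = 2 * real (Suc n) powr - (3/2)"
        by (simp only: powr_minus_divide mult_1_right times_divide_eq_right)
      finally show ?thesis .
    qed
    then show "summable (\<lambda>n. \<delta> n / (\<epsilon> n)\<^sup>2)" using sum_p[of "- (3/2)"] by (simp only:) (intro summable_mult, simp)
  qed (auto simp: \<epsilon>_def \<delta>_def)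
  have c2: "summable (\<lambda>n. (c n)\<^sup>2)"
  proof (rule summable_comparison_test'[OF sum_p[of "-2"]])
    fix n
    have "norm ((c n)\<^sup>2) \<le> (1 / real (Suc n))\<^sup>2"
      using power_mono[OF c(2) c(1), of n 2] by simp
    also have "\<dots> = real (Suc n) powr - 2"
      by (simp only: powr_minus_divide) (simp add: power_divide del: of_nat_Suc)
    finally show "norm ((c n)\<^sup>2) \<le> real (Suc n) powr - 2" .
  qed simp
  have noise: "AE \<omega> in M. summable (\<lambda>n. (c n)\<^sup>2 * (norm (w n \<omega>))\<^sup>2)"
    unfolding w_def by (rule AE_summable_W_increments) (use t0 c2 in auto)
  \<comment> \<open>The offset is at most 1, so c n is at least 1 / (n + 2).\<close>
  have not_sum: "\<not> summable c"
  proof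
    assume "summable c"
    then have "summable (\<lambda>n. 1 / real (Suc (Suc n)))"
      by (rule summable_comparison_test'[where N = 0]) (use t0 \<theta> in \<open>auto simp: c_def t_def intro!: divide_left_mono\<close>)
    then have "summable (\<lambda>n. inverse (real n))"
      unfolding inverse_eq_divide using summable_Suc_iff[of "\<lambda>n. 1 / real (Suc n)"] summable_Suc_iff[of "\<lambda>n. 1 / real n"] by simp
    then show False using not_summable_harmonic[where 'a = real] by (simp add: inverse_eq_divide)
  qed
  have "AE \<omega> in M. \<not> summable (\<lambda>n. c n * ?q n \<omega>)"
  proof (rule AE_orthant_hits_not_summable[OF t0 _ _ c(1) _ not_sum])
    show "X (t n) \<in> borel_measurable (F (t n))" for n
      using adapted_X t0 by (simp add: adapted_def)
    show "c n \<le> 1" for n using t0[of n] by (simp add: c_def)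
  qed (simp add: t_def)
  with approx noise AE_drift_path show ?thesis
  proof eventually_elim
    case (elim \<omega>)
    interpret drift_path "\<lambda>t. X t \<omega>" "\<lambda>t. I t \<omega>" x0 by (rule elim(3))
    show ?case
    proof (intro impI notI)
      assume ann: "\<forall>s\<ge>real N. 3/4 \<le> norm (X s \<omega>) \<and> norm (X s \<omega>) \<le> 3/2"
        and int: "\<forall>t\<ge>real N. integral {real N..t} (\<lambda>s. \<bar>norm (X s \<omega>) - 1\<bar>) \<le> C"
        and sum: "summable (\<lambda>n. \<bar>norm (X (real n + \<theta>) \<omega>) - 1\<bar>)"
      have small: "(\<integral>\<^sup>+ s\<in>{t n..t n + 1}. ennreal ((norm (H s \<omega> - c n *\<^sub>R mat 1))\<^sup>2) \<partial>lborel) \<le> ennreal (\<delta> n)"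
        if "N \<le> n" for n
      proof -
        have "(norm (H s \<omega> - c n *\<^sub>R mat 1))\<^sup>2 \<le> \<delta> n" if s: "s \<in> {t n..t n + 1}" for s
        proof -
          have "real N \<le> s" using s tn[of n] \<open>N \<le> n\<close> by simp
          then have "3/4 \<le> norm (X s \<omega>)" "norm (X s \<omega>) \<le> 3/2" using ann by auto
          then have "\<phi> (X s \<omega>) = 1" by (intro phi_one) simp
          then have "H s \<omega> - c n *\<^sub>R mat 1 = (1 / (s + 1) - c n) *\<^sub>R mat 1" by (simp add: scaleR_diff_left)
          then have eq: "(norm (H s \<omega> - c n *\<^sub>R mat 1))\<^sup>2 = 2 * (c n - 1 / (s + 1))\<^sup>2"
            by (simp only: norm_scaleR_mat1_sq power2_commute)
          have "c n - 1 / (s + 1) = (s - t n) * (c n * (1 / (s + 1)))"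
            using s t0[of n] by (simp add: c_def field_simps)
          moreover have "0 \<le> (s - t n) * (c n * (1 / (s + 1)))" using s t0[of n] c(1) by auto
          moreover have "(s - t n) * (c n * (1 / (s + 1))) \<le> 1 * (1 / real (Suc n) * (1 / real (Suc n)))"
            using s t0[of n] c tn[of n] by (intro mult_mono) (auto intro!: divide_left_mono)
          ultimately have "(c n - 1 / (s + 1))\<^sup>2 \<le> (1 / real (Suc n) * (1 / real (Suc n)))\<^sup>2"
            by (intro power_mono) auto
          also have "\<dots> = 1 / real (Suc n) ^ 4"
            by (simp add: power_mult_distrib power_divide power_mult[symmetric] power_add[symmetric] del: of_nat_Suc)
          finally show ?thesis unfolding eq by (simp add: \<delta>_def del: of_nat_Suc)
        qed
        then have "(\<integral>\<^sup>+ s\<in>{t n..t n + 1}. ennreal ((norm (H s \<omega> - c n *\<^sub>R mat 1))\<^sup>2) \<partial>lborel)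
           \<le> (\<integral>\<^sup>+ s. ennreal (\<delta> n) * indicator {t n..t n + 1} s \<partial>lborel)"
          by (intro nn_integral_mono) (auto simp: indicator_def intro!: ennreal_leI)
        also have "\<dots> = ennreal (\<delta> n)" by (subst nn_integral_cmult_indicator) auto
        finally show ?thesis .
      qed
      have ev: "\<forall>\<^sub>F n in sequentially. norm (I (t n + 1) \<omega> - I (t n) \<omega> - c n *\<^sub>R w n \<omega>) \<le> \<epsilon> n"
        using elim(1) eventually_ge_at_top[of N]
        by eventually_elim (use small in \<open>simp add: w_def\<close>)
      have "summable (\<lambda>n. c n * \<bar>X (t n) \<omega> \<bullet> w n \<omega>\<bar>)"
        unfolding c_def t_def
      proof (rule summable_radial_noise[where N = N and C = C and \<epsilon> = \<epsilon>])
        show "summable \<epsilon>" unfolding \<epsilon>_def using sum_p[of "-5/4"] by simp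
        show "\<epsilon> n \<le> 1" for n
          unfolding \<epsilon>_def using powr_mono[of "-5/4" 0 "real (Suc n)"] by (simp del: of_nat_Suc)
      qed (use ann int sum \<theta> ev elim(2) in \<open>auto simp: c_def t_def\<close>)
      then have "summable (\<lambda>n. 4/3 * (c n * \<bar>X (t n) \<omega> \<bullet> w n \<omega>\<bar>))" by (rule summable_mult)
      then have "summable (\<lambda>n. c n * ?q n \<omega>)"
      proof (rule summable_comparison_test'[where N = N])
        fix n assume n: "N \<le> n"
        \<comment> \<open>On a hit the inner product is at least the norm of X, which is at least
          3/4 in the annulus; this is the origin of 4/3.\<close>
        have "indicat_real (orthant {i. 0 \<le> X (t n) \<omega> $ i}) (w n \<omega>) \<le> 4/3 * \<bar>X (t n) \<omega> \<bullet> w n \<omega>\<bar>"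
        proof (cases "w n \<omega> \<in> orthant {i. 0 \<le> X (t n) \<omega> $ i}")
          case True
          have "real N \<le> t n" using tn[of n] n by simp
          then have "3/4 \<le> norm (X (t n) \<omega>)" using ann by simp
          then show ?thesis using orthant_inner[OF True] True by simp
        qed simp
        then have "c n * indicat_real (orthant {i. 0 \<le> X (t n) \<omega> $ i}) (w n \<omega>) \<le> c n * (4/3 * \<bar>X (t n) \<omega> \<bullet> w n \<omega>\<bar>)"
          using c(1) by (rule mult_left_mono)
        then show "norm (c n * ?q n \<omega>) \<le> 4/3 * (c n * \<bar>X (t n) \<omega> \<bullet> w n \<omega>\<bar>)"
          using c(1)[of n] by (simp add: w_def)
      qed
      then show False using elim(4) by simp
    qed
  qed
qed
end

lemma sum_indicator_unit_intervals:
  "(\<Sum>n<k. indicator {a + real n..<a + real n + 1} s) = (indicator {a..<a + real k} s :: ennreal)"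
proof (induction k)
  case (Suc k)
  then show ?case by (auto simp: indicator_def)
qed simp

context spiral_sde
begin

text \<open>Integrability of \<open>\<bar>norm (X s) - 1\<bar>\<close> gives summability along \<open>n + \<theta>\<close> only for almost every \<open>\<theta>\<close>, depending
  on the path, whereas the exceptional null set of paths depends on \<open>\<theta>\<close>; Fubini reconciles the two.\<close>

lemma AE_not_annulus_integrable:
  fixes N C :: nat
  shows "AE \<omega> in M. \<not> ((\<forall>s\<ge>real N. 3/4 \<le> norm (X s \<omega>) \<and> norm (X s \<omega>) \<le> 3/2) \<and>
    (\<forall>t\<ge>real N. integral {real N..t} (\<lambda>s. \<bar>norm (X s \<omega>) - 1\<bar>) \<le> real C))"
proof -
  let ?r = "\<lambda>\<omega> s. \<bar>norm (X s \<omega>) - 1\<bar>"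
  obtain Z where Z: "{\<omega> \<in> space M. \<not> continuous_on {0..} (\<lambda>t. X t \<omega>)} \<subseteq> Z" "emeasure M Z = 0" "Z \<in> events"
    using continuous_X unfolding continuous_paths_def by (rule AE_E)
  \<comment> \<open>A version whose paths are all continuous on the whole line: 0 on the exceptional
    null set and constant at negative times. Joint measurability is proved for this version.\<close>
  define Y where "Y t \<omega> = (if \<omega> \<in> Z then 0 else X (max 0 t) \<omega>)" for t \<omega>
  have Y_eq: "Y s \<omega> = X s \<omega>" if "\<omega> \<notin> Z" "0 \<le> s" for s \<omega> using that by (simp add: Y_def)
  have Y_meas[measurable]: "Y t \<in> borel_measurable M" for t
  proof -
    have "X (max 0 t) \<in> borel_measurable M"
      by (rule measurable_F_M[of "max 0 t"]) (use adapted_X in \<open>simp_all add: adapted_def\<close>)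
    then show ?thesis unfolding Y_def using Z(3) by (intro measurable_If_set) auto
  qed
  have Y_cont: "continuous_on UNIV (\<lambda>t. Y t \<omega>)" if "\<omega> \<in> space M" for \<omega>
  proof (cases "\<omega> \<in> Z")
    case False
    then have "continuous_on {0..} (\<lambda>t. X t \<omega>)" using Z(1) that by blast
    then have "continuous_on UNIV (\<lambda>t. X (max 0 t) \<omega>)"
      by (rule continuous_on_compose2) (auto intro!: continuous_intros)
    then show ?thesis using False by (simp add: Y_def)
  qed (simp add: Y_def)
  define g where "g s \<omega> = \<bar>norm (Y s \<omega>) - 1\<bar>" for s \<omega>
  have g_meas: "(\<lambda>p. g (fst p) (snd p)) \<in> borel_measurable (borel \<Otimes>\<^sub>M M)"
    unfolding g_def using borel_measurable_pair_continuous_paths[OF Y_meas Y_cont] by measurable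
  have g_shift: "(\<lambda>p. g (h (fst p)) (snd p)) \<in> borel_measurable (lborel \<Otimes>\<^sub>M M)" if [measurable]: "h \<in> borel_measurable borel" for h
  proof -
    have "(\<lambda>p. (h (fst p), snd p)) \<in> lborel \<Otimes>\<^sub>M M \<rightarrow>\<^sub>M borel \<Otimes>\<^sub>M M" by measurable
    from measurable_compose[OF this g_meas] show ?thesis by simp
  qed
  have g_swap: "(\<lambda>p. g (snd p) (fst p)) \<in> borel_measurable (M \<Otimes>\<^sub>M lborel)"
  proof -
    have "(\<lambda>p. (snd p, fst p)) \<in> M \<Otimes>\<^sub>M lborel \<rightarrow>\<^sub>M borel \<Otimes>\<^sub>M M" by measurable
    from measurable_compose[OF this g_meas] show ?thesis by simp
  qed
  have g_section: "(\<lambda>s. g s \<omega>) \<in> borel_measurable borel" if "\<omega> \<in> space M" for \<omega>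
    unfolding g_def by (intro borel_measurable_continuous_onI continuous_intros Y_cont that)
  \<comment> \<open>The event of the statement in visibly measurable form: rational times, natural
    end points, and a nonnegative integral in place of \<open>integral\<close>.\<close>
  define E where "E = {\<omega> \<in> space M. (\<forall>q::rat. real N \<le> of_rat q \<longrightarrow> 3/4 \<le> norm (Y (of_rat q) \<omega>) \<and> norm (Y (of_rat q) \<omega>) \<le> 3/2) \<and>
     (\<forall>k::nat. (\<integral>\<^sup>+ s\<in>{real N..real N + real k}. ennreal (g s \<omega>) \<partial>lborel) \<le> ennreal (real C))}"
  have E_meas[measurable]: "E \<in> events"
  proof -
    have [measurable]: "(\<lambda>\<omega>. \<integral>\<^sup>+ s\<in>{real N..real N + real k}. ennreal (g s \<omega>) \<partial>lborel) \<in> borel_measurable M" for k :: nat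
    proof (rule lborel.borel_measurable_nn_integral)
      show "(\<lambda>(\<omega>, s). ennreal (g s \<omega>) * indicator {real N..real N + real k} s) \<in> borel_measurable (M \<Otimes>\<^sub>M lborel)"
        unfolding split_beta using g_swap by measurable
    qed
    show ?thesis unfolding E_def by measurable
  qed
  have E_path: "3/4 \<le> norm (X s \<omega>) \<and> norm (X s \<omega>) \<le> 3/2" if w: "\<omega> \<in> E" "\<omega> \<notin> Z" and s: "real N \<le> s" for \<omega> s
  proof -
    have wM: "\<omega> \<in> space M" using w by (simp add: E_def)
    have cl: "closure ({real N<..} \<inter> \<rat>) = {real N..}"
      using closure_open_Int_superset[of "{real N<..}" \<rat>] by (simp add: Rats_closure_real)
    have cont: "continuous_on (closure ({real N<..} \<inter> \<rat>)) (\<lambda>t. norm (Y t \<omega>))"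
      using continuous_on_subset[OF Y_cont[OF wM] subset_UNIV] by (intro continuous_intros) 
    have r: "3/4 \<le> norm (Y q \<omega>) \<and> norm (Y q \<omega>) \<le> 3/2" if "q \<in> {real N<..} \<inter> \<rat>" for q
      using that w(1) by (auto simp: E_def elim!: Rats_cases)
    have "3/4 \<le> norm (Y s \<omega>)"
      by (rule continuous_ge_on_closure[OF cont]) (use r s cl in auto)
    moreover have "norm (Y s \<omega>) \<le> 3/2"
      by (rule continuous_le_on_closure[OF cont]) (use r s cl in auto)
    ultimately show ?thesis using Y_eq[OF w(2), of s] s by simp
  qed
  have X_cont: "continuous_on {real N..b} (?r \<omega>)" if "\<omega> \<in> space M" "\<omega> \<notin> Z" for \<omega> b
  proof -
    have "continuous_on {0..} (\<lambda>t. X t \<omega>)" using Z(1) that by blast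
    then have "continuous_on {real N..b} (\<lambda>t. X t \<omega>)" by (rule continuous_on_subset) auto
    then show ?thesis by (intro continuous_intros)
  qed
  have E_int: "(\<integral>\<^sup>+ s\<in>{real N..b}. ennreal (g s \<omega>) \<partial>lborel) = ennreal (integral {real N..b} (?r \<omega>))"
    if "\<omega> \<in> space M" "\<omega> \<notin> Z" for \<omega> b
  proof -
    have "(\<integral>\<^sup>+ s\<in>{real N..b}. ennreal (g s \<omega>) \<partial>lborel) = (\<integral>\<^sup>+ s\<in>{real N..b}. ennreal \<bar>norm (X s \<omega>) - 1\<bar> \<partial>lborel)"
      using Y_eq[OF that(2)] by (intro nn_integral_cong) (auto simp: indicator_def g_def)
    then show ?thesis using nn_integral_eq_HK_integral[OF X_cont[OF that]] by simp
  qed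
  have AE_Z: "AE \<omega> in M. \<omega> \<notin> Z" using Z(2,3) by (intro AE_not_in) auto
  \<comment> \<open>Divergence is expressed by the extended sum being infinite, which is measurable
    in both variables. The series starts at N so that only times after N occur.\<close>
  define P where "P \<theta> \<omega> \<longleftrightarrow> (\<theta> \<in> {0..<1} \<longrightarrow> \<omega> \<in> E \<longrightarrow> (\<Sum>n. ennreal (g (real N + real n + \<theta>) \<omega>)) = \<infinity>)"
    for \<theta> :: real and \<omega>
  have P_section: "AE \<omega> in M. P \<theta> \<omega>" for \<theta>
  proof (cases "\<theta> \<in> {0..<1}")
    case True
    then have "AE \<omega> in M. (\<forall>s\<ge>real N. 3/4 \<le> norm (X s \<omega>) \<and> norm (X s \<omega>) \<le> 3/2) \<longrightarrow>
      (\<forall>t\<ge>real N. integral {real N..t} (?r \<omega>) \<le> real C) \<longrightarrow>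
      \<not> summable (\<lambda>n. \<bar>norm (X (real n + \<theta>) \<omega>) - 1\<bar>)"
      by (intro AE_not_summable_radii) auto
    with AE_Z show ?thesis
    proof eventually_elim
      case (elim \<omega>)
      show ?case unfolding P_def
      proof (intro impI, rule ccontr)
        assume w: "\<omega> \<in> E" and fin: "(\<Sum>n. ennreal (g (real N + real n + \<theta>) \<omega>)) \<noteq> \<infinity>"
        have wM: "\<omega> \<in> space M" using w by (simp add: E_def)
        have "integral {real N..t} (?r \<omega>) \<le> real C" if t: "real N \<le> t" for t
        proof -
          obtain k :: nat where "t - real N \<le> real k" using real_arch_simple by blast
          then have k: "t \<le> real N + real k" by simp
          have "ennreal (integral {real N..real N + real k} (?r \<omega>)) \<le> ennreal (real C)"
            using w unfolding E_int[OF wM elim(1), symmetric] by (simp add: E_def)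
          then have "integral {real N..real N + real k} (?r \<omega>) \<le> real C" by simp
          moreover have "integral {real N..t} (?r \<omega>) \<le> integral {real N..real N + real k} (?r \<omega>)"
            using k by (intro integral_subset_le integrable_continuous_interval X_cont wM elim(1)) auto
          ultimately show ?thesis by simp
        qed
        then have "\<not> summable (\<lambda>n. \<bar>norm (X (real n + \<theta>) \<omega>) - 1\<bar>)"
          using elim(2) E_path[OF w elim(1)] by blast
        moreover have "summable (\<lambda>n. g (real N + real n + \<theta>) \<omega>)"
          using fin by (intro summable_suminf_not_top) (auto simp: g_def)
        then have "summable (\<lambda>n. \<bar>norm (X (real (n + N) + \<theta>) \<omega>) - 1\<bar>)"
          using Y_eq[OF elim(1)] True by (simp add: g_def add.commute add.left_commute)
        then have "summable (\<lambda>n. \<bar>norm (X (real n + \<theta>) \<omega>) - 1\<bar>)"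
          by (subst (asm) summable_iff_shift[of "\<lambda>n. \<bar>norm (X (real n + \<theta>) \<omega>) - 1\<bar>" N])
        ultimately show False by blast
      qed
    qed
  qed (auto simp: P_def)
  interpret pair: pair_sigma_finite lborel M ..
  have P_meas: "{p \<in> space (lborel \<Otimes>\<^sub>M M). P (fst p) (snd p)} \<in> sets (lborel \<Otimes>\<^sub>M M)"
  proof -
    have [measurable]: "(\<lambda>p. g (real N + real n + fst p) (snd p)) \<in> borel_measurable (lborel \<Otimes>\<^sub>M M)" for n
      by (rule g_shift) measurable
    show ?thesis unfolding P_def by measurable
  qed
  have "AE \<theta> in lborel. AE \<omega> in M. P \<theta> \<omega>" using P_section by simp
  then have "AE \<omega> in M. AE \<theta> in lborel. P \<theta> \<omega>" using pair.AE_commute[OF P_meas] by simp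
  then have notE: "AE \<omega> in M. \<omega> \<notin> E"
  proof eventually_elim
    case (elim \<omega>)
    show ?case
    proof
      assume w: "\<omega> \<in> E"
      then have wM: "\<omega> \<in> space M" by (simp add: E_def)
      note [measurable] = g_section[OF wM]
      \<comment> \<open>Integrating the n-th term over the offset in {0..<1} gives the integral of g
        over the n-th unit interval after N. The whole series thus has integral at most C and is
        finite for almost every offset, whereas P makes it infinite for almost every offset in
        {0..<1}.\<close>
      define G where "G n \<theta> = ennreal (g (real N + real n + \<theta>) \<omega>) * indicator {0..<1} \<theta>" for n and \<theta> :: real
      have [measurable]: "G n \<in> borel_measurable borel" for n unfolding G_def by measurable
      have shift: "(\<integral>\<^sup>+ \<theta>. G n \<theta> \<partial>lborel) = (\<integral>\<^sup>+ s. ennreal (g s \<omega>) * indicator {real N + real n..<real N + real n + 1} s \<partial>lborel)" for n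
      proof -
        have "(\<integral>\<^sup>+ s. ennreal (g s \<omega>) * indicator {real N + real n..<real N + real n + 1} s \<partial>lborel)
           = ennreal \<bar>1\<bar> * (\<integral>\<^sup>+ \<theta>. ennreal (g ((real N + real n) + 1 * \<theta>) \<omega>) *
              indicator {real N + real n..<real N + real n + 1} ((real N + real n) + 1 * \<theta>) \<partial>lborel)"
          by (rule nn_integral_real_affine) auto
        also have "\<dots> = (\<integral>\<^sup>+ \<theta>. G n \<theta> \<partial>lborel)"
          unfolding G_def by (simp, intro nn_integral_cong) (auto simp: indicator_def)
        finally show ?thesis by simp
      qed
      have partial: "(\<Sum>n<k. \<integral>\<^sup>+ \<theta>. G n \<theta> \<partial>lborel) \<le> ennreal (real C)" for k
      proof -
        have "(\<Sum>n<k. \<integral>\<^sup>+ \<theta>. G n \<theta> \<partial>lborel) =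
          (\<integral>\<^sup>+ s. (\<Sum>n<k. ennreal (g s \<omega>) * indicator {real N + real n..<real N + real n + 1} s) \<partial>lborel)"
          unfolding shift by (rule nn_integral_sum[symmetric]) measurable
        also have "\<dots> = (\<integral>\<^sup>+ s. ennreal (g s \<omega>) * indicator {real N..<real N + real k} s \<partial>lborel)"
          unfolding sum_distrib_left[symmetric] sum_indicator_unit_intervals ..
        also have "\<dots> \<le> (\<integral>\<^sup>+ s\<in>{real N..real N + real k}. ennreal (g s \<omega>) \<partial>lborel)"
          by (intro nn_integral_mono) (auto simp: indicator_def)
        also have "\<dots> \<le> ennreal (real C)" using w by (simp add: E_def)
        finally show ?thesis .
      qed
      have "(\<integral>\<^sup>+ \<theta>. (\<Sum>n. G n \<theta>) \<partial>lborel) = (\<Sum>n. \<integral>\<^sup>+ \<theta>. G n \<theta> \<partial>lborel)"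
        by (rule nn_integral_suminf) measurable
      also have "\<dots> \<le> ennreal (real C)"
        unfolding suminf_eq_SUP by (intro SUP_least partial)
      finally have "(\<integral>\<^sup>+ \<theta>. (\<Sum>n. G n \<theta>) \<partial>lborel) \<noteq> \<infinity>" by (auto simp: top_unique)
      then have "AE \<theta> in lborel. (\<Sum>n. G n \<theta>) \<noteq> \<infinity>"
        by (intro nn_integral_PInf_AE) auto
      with elim have "AE \<theta> in lborel. \<theta> \<notin> {0..<1::real}"
      proof eventually_elim
        case (elim \<theta>)
        show ?case
        proof
          assume th: "\<theta> \<in> {0..<1}"
          then have "(\<Sum>n. G n \<theta>) = (\<Sum>n. ennreal (g (real N + real n + \<theta>) \<omega>))" by (simp add: G_def)
          then show False using elim th w by (simp add: P_def)
        qed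
      qed
      then have "{0..<1::real} \<in> null_sets lborel" using Measure_Space.AE_iff_null_sets[of "{0..<1::real}" lborel] by simp
      then show False by (simp add: null_sets_def)
    qed
  qed
  have inE: "\<omega> \<in> E" if "\<omega> \<in> space M" "\<omega> \<notin> Z"
    and ann: "\<forall>s\<ge>real N. 3/4 \<le> norm (X s \<omega>) \<and> norm (X s \<omega>) \<le> 3/2"
    and int: "\<forall>t\<ge>real N. integral {real N..t} (?r \<omega>) \<le> real C" for \<omega>
  proof -
    have "3/4 \<le> norm (Y (of_rat q) \<omega>) \<and> norm (Y (of_rat q) \<omega>) \<le> 3/2" if "real N \<le> of_rat q" for q
    proof -
      have "0 \<le> real_of_rat q" using that of_nat_0_le_iff[of N, where 'a = real] by linarith
      then show ?thesis using ann that Y_eq[OF \<open>\<omega> \<notin> Z\<close>, of "of_rat q"] by simp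
    qed
    moreover have "(\<integral>\<^sup>+ s\<in>{real N..real N + real k}. ennreal (g s \<omega>) \<partial>lborel) \<le> ennreal (real C)" for k
      unfolding E_int[OF that(1,2)] using int by (intro ennreal_leI) simp
    ultimately show ?thesis using that(1) by (simp add: E_def)
  qed
  from notE AE_Z AE_space show ?thesis
    by eventually_elim (use inE in blast)
qed

section \<open>Non-convergence and the probability of the events\<close>

lemma AE_not_convergent: "AE \<omega> in M. \<nexists>l. ((\<lambda>t. X t \<omega>) \<longlongrightarrow> l) at_top"
proof -
  have "(\<integral>\<^sup>+ s\<in>{0..T}. ennreal ((norm (H s \<omega>))\<^sup>2) \<partial>lborel) \<le> ennreal 2" for T \<omega>
    by (rule order_trans[OF nn_set_integral_set_mono nn_integral_H]) auto
  then have freq: "AE \<omega> in M. \<exists>K. \<exists>\<^sub>F n in sequentially. norm (I (real n) \<omega> - I 0 \<omega>) \<le> K"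
    by (intro AE_ito_recurrent[OF ito, of 2]) simp_all
  have "AE \<omega> in M. \<forall>N C :: nat. \<not> ((\<forall>s\<ge>real N. 3/4 \<le> norm (X s \<omega>) \<and> norm (X s \<omega>) \<le> 3/2) \<and>
    (\<forall>t\<ge>real N. integral {real N..t} (\<lambda>s. \<bar>norm (X s \<omega>) - 1\<bar>) \<le> real C))"
    unfolding AE_all_countable by (intro allI AE_not_annulus_integrable)
  with freq AE_drift_path AE_bounds show ?thesis
  proof eventually_elim
    case (elim \<omega>)
    interpret drift_path "\<lambda>t. X t \<omega>" "\<lambda>t. I t \<omega>" x0 by (rule elim(2))
    obtain K where K: "\<exists>\<^sub>F n in sequentially. norm (I (real n) \<omega> - I 0 \<omega>) \<le> K" using elim(1) by blast
    show ?case
    proof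
      assume "\<exists>l. ((\<lambda>t. X t \<omega>) \<longlongrightarrow> l) at_top"
      then obtain l where l: "((\<lambda>t. X t \<omega>) \<longlongrightarrow> l) at_top" by blast
      have "\<exists>(N::nat) C. (\<forall>s\<ge>real N. 3/4 \<le> norm (X s \<omega>) \<and> norm (X s \<omega>) \<le> 3/2) \<and>
        (\<forall>t\<ge>real N. integral {real N..t} (\<lambda>s. \<bar>norm (X s \<omega>) - 1\<bar>) \<le> C)"
        by (rule convergent_path[OF l K, of "max (norm x0) 3" "min (norm x0) (1/2)"]) (use elim(3) x0 in auto)
      then obtain N :: nat and C where N: "\<forall>s\<ge>real N. 3/4 \<le> norm (X s \<omega>) \<and> norm (X s \<omega>) \<le> 3/2"
        and C: "\<forall>t\<ge>real N. integral {real N..t} (\<lambda>s. \<bar>norm (X s \<omega>) - 1\<bar>) \<le> C" by blast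
      \<comment> \<open>The bound depends on the path; rounding it up brings it into the countable
        family for which the exceptional sets were collected.\<close>
      obtain C' :: nat where "C \<le> real C'" using real_arch_simple by blast
      then have "\<forall>t\<ge>real N. integral {real N..t} (\<lambda>s. \<bar>norm (X s \<omega>) - 1\<bar>) \<le> real C'"
        using C order_trans by blast
      then show False using elim(4) N by blast
    qed
  qed
qed

text \<open>The rotational part is orthogonal to the gradient. The first quotient in
  \<open>event_C\<close> is therefore exactly 1, or infinite at a critical point.\<close>

lemma inner_fgrad_drift: "fgrad x \<bullet> (- drift x) = (norm (fgrad x))\<^sup>2"
proof -
  have "fgrad x \<bullet> ort x = 0" by (simp add: fgrad_def)
  then show ?thesis by (simp add: drift_def inner_diff_right power2_norm_eq_inner)
qed

text \<open>Bounds the second quotient in \<open>event_C\<close> below along bounded paths. The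
  rotation is controlled by the gradient both near the circle, where the gradient has norm 2 |r -
  1|, and inside radius 1/2, where its norm (6 - 8 r) r is at least 2 r.\<close>

lemma norm_drift_le: "norm (drift x) \<le> (2 + norm x) * norm (fgrad x)"
proof (rule power2_le_imp_le)
  have "\<bar>norm x - 1\<bar> * norm x \<le> (1 + norm x) * norm (fgrad x)"
  proof (cases "1/2 \<le> norm x")
    case True
    have "\<bar>norm x - 1\<bar> * norm x \<le> \<bar>norm x - 1\<bar> * (2 * (1 + norm x))" by (intro mult_left_mono) auto
    also have "\<dots> = (1 + norm x) * norm (fgrad x)" by (simp add: norm_fgrad_outer[OF True])
    finally show ?thesis .
  next
    case False
    then have "norm (fgrad x) = (6 - 8 * norm x) * norm x" by (simp add: norm_fgrad slope_def)
    moreover have "2 * norm x \<le> (6 - 8 * norm x) * norm x" using False by (intro mult_right_mono) auto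
    ultimately have "norm x \<le> norm (fgrad x)" by (smt (verit) norm_ge_zero)
    moreover have "\<bar>norm x - 1\<bar> * norm x \<le> 1 * norm x" using False by (intro mult_right_mono) auto
    moreover have "1 * norm (fgrad x) \<le> (1 + norm x) * norm (fgrad x)" by (intro mult_right_mono) auto
    ultimately show ?thesis by linarith
  qed
  then have "(\<bar>norm x - 1\<bar> * norm x)\<^sup>2 \<le> ((1 + norm x) * norm (fgrad x))\<^sup>2"
    by (intro power_mono) auto
  then have "((norm x - 1) * norm x)\<^sup>2 \<le> (1 + norm x)\<^sup>2 * (norm (fgrad x))\<^sup>2"
    by (simp only: power_mult_distrib power2_abs)
  moreover have "(norm (fgrad x))\<^sup>2 * (1 + (1 + norm x)\<^sup>2) = (norm (fgrad x))\<^sup>2 + (1 + norm x)\<^sup>2 * (norm (fgrad x))\<^sup>2"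
    by (simp only: distrib_left mult_1_right mult.commute)
  ultimately have "(norm (drift x))\<^sup>2 \<le> (norm (fgrad x))\<^sup>2 * (1 + (1 + norm x)\<^sup>2)"
    unfolding norm_drift_sq by linarith
  also have "\<dots> \<le> (norm (fgrad x))\<^sup>2 * (2 + norm x)\<^sup>2"
    by (intro mult_left_mono) (auto simp: power2_sum)
  finally show "(norm (drift x))\<^sup>2 \<le> ((2 + norm x) * norm (fgrad x))\<^sup>2"
    by (simp add: power_mult_distrib mult.commute)
qed simp

lemma AE_events:
  "AE \<omega> in M. \<omega> \<in> event_C M fgrad X (\<lambda>t \<omega>. drift (X t \<omega>)) H \<inter> event_L M X"
  using AE_bounds AE_space
proof eventually_elim
  case (elim \<omega>)
  define B where "B = max (norm x0) 3"
  have bnd: "norm (X t \<omega>) \<le> B" if "0 \<le> t" for t using elim(1) that by (simp add: B_def)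
  have B: "0 \<le> B" by (simp add: B_def le_max_iff_disj)
  have "1 \<le> Liminf at_top (\<lambda>t. equotient (fgrad (X t \<omega>) \<bullet> (- drift (X t \<omega>))) ((norm (fgrad (X t \<omega>)))\<^sup>2))"
    unfolding inner_fgrad_drift by (rule Liminf_bounded) (simp add: equotient_def)
  then have 1: "0 < Liminf at_top (\<lambda>t. equotient (fgrad (X t \<omega>) \<bullet> (- drift (X t \<omega>))) ((norm (fgrad (X t \<omega>)))\<^sup>2))"
    by (rule less_le_trans[rotated]) simp
  have "ereal (1 / (2 + B)) \<le> Liminf at_top (\<lambda>t. equotient (norm (fgrad (X t \<omega>))) (norm (drift (X t \<omega>))))"
  proof (rule Liminf_bounded)
    have "ereal (1 / (2 + B)) \<le> equotient (norm (fgrad (X t \<omega>))) (norm (drift (X t \<omega>)))" if "0 \<le> t" for t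
    proof (cases "drift (X t \<omega>) = 0")
      case False
      have "norm (drift (X t \<omega>)) \<le> (2 + B) * norm (fgrad (X t \<omega>))"
        by (rule order_trans[OF norm_drift_le]) (use bnd[OF that] in \<open>auto intro!: mult_right_mono\<close>)
      then show ?thesis using False B by (simp add: equotient_def divide_simps mult.commute)
    qed (simp add: equotient_def)
    then show "\<forall>\<^sub>F t in at_top. ereal (1 / (2 + B)) \<le> equotient (norm (fgrad (X t \<omega>))) (norm (drift (X t \<omega>)))"
      by (rule eventually_mono[OF eventually_ge_at_top])
  qed
  then have 2: "0 < Liminf at_top (\<lambda>t. equotient (norm (fgrad (X t \<omega>))) (norm (drift (X t \<omega>))))"
    by (rule less_le_trans[rotated]) (use B in simp)
  have 3: "(\<integral>\<^sup>+ s\<in>{0..}. ennreal ((frobenius_norm (H s \<omega>))\<^sup>2) \<partial>lborel) < \<infinity>"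
    unfolding frobenius_norm_eq_norm
    using le_less_trans[OF nn_integral_H ennreal_less_top] by simp
  have "Limsup at_top (\<lambda>t. ereal (spectral_norm (H t \<omega>))) \<le> ereal 1"
  proof (rule Limsup_bounded)
    have "spectral_norm (H t \<omega>) \<le> 1" if "0 \<le> t" for t
      unfolding spectral_norm_def
    proof (rule onorm_bound)
      fix v :: "real^2"
      have "\<bar>1 / (t + 1) * \<phi> (X t \<omega>)\<bar> \<le> 1 * 1"
        unfolding abs_mult using phi_range[of "X t \<omega>"] that by (intro mult_mono) auto
      then show "norm (H t \<omega> *v v) \<le> 1 * norm v"
        unfolding scaleR_mat1_mult norm_scaleR by (intro mult_right_mono) auto
    qed simp
    then show "\<forall>\<^sub>F t in at_top. ereal (spectral_norm (H t \<omega>)) \<le> ereal 1"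
      by (intro eventually_mono[OF eventually_ge_at_top[of 0]]) simp
  qed
  then have 4: "Limsup at_top (\<lambda>t. ereal (spectral_norm (H t \<omega>))) < \<infinity>" by (rule le_less_trans) simp
  have "Limsup at_top (\<lambda>t. ereal (norm (X t \<omega>))) \<le> ereal B"
    by (rule Limsup_bounded) (use bnd in \<open>auto intro: eventually_mono[OF eventually_ge_at_top[of 0]]\<close>)
  then have 5: "Limsup at_top (\<lambda>t. ereal (norm (X t \<omega>))) < \<infinity>" by (rule le_less_trans) simp
  show ?case using 1 2 3 4 5 elim(2) by (simp add: event_C_def event_L_def)
qed

text \<open>The events involve upper and lower limits over continuous time; their measurability
  comes from completeness of M, since the complement lies in a null set.\<close>

lemma prob_events: "prob (event_C M fgrad X (\<lambda>t \<omega>. drift (X t \<omega>)) H \<inter> event_L M X) = 1"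
proof -
  let ?A = "event_C M fgrad X (\<lambda>t \<omega>. drift (X t \<omega>)) H \<inter> event_L M X"
  have sub: "?A \<subseteq> space M" by (auto simp: event_L_def)
  obtain Z where "{\<omega> \<in> space M. \<omega> \<notin> ?A} \<subseteq> Z" "emeasure M Z = 0" "Z \<in> events"
    using AE_events by (rule AE_E)
  then have "{\<omega> \<in> space M. \<omega> \<notin> ?A} \<in> events"
    by (intro complete[of _ Z]) (auto simp: null_sets_def)
  then have "space M - {\<omega> \<in> space M. \<omega> \<notin> ?A} \<in> events" by (rule sets.compl_sets)
  also have "space M - {\<omega> \<in> space M. \<omega> \<notin> ?A} = ?A" using sub by blast
  finally show ?thesis using AE_events by (simp add: prob_eq_1)
qed
end

theorem theorem4p1:
  fixes M :: "'w measure"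
    and \<F> :: "real \<Rightarrow> 'w measure"
    and W X \<alpha> :: "real \<Rightarrow> 'w \<Rightarrow> real^2"
    and \<beta> :: "real \<Rightarrow> 'w \<Rightarrow> real^2^2"
    and \<phi> :: "real^2 \<Rightarrow> real"
    and x0 :: "real^2"
    and f :: "real^2 \<Rightarrow> real^2"
  assumes f_def: "f = grad potential"
    and "usual_filtered_prob_space M \<F>"
    and "brownian_motion M \<F> W"
    and phi_range: "\<And>x. \<phi> x \<in> {0..1}"
    and phi_rot: "rotationally_invariant \<phi>"
    and phi_smooth: "smooth_fun \<phi>"
    and phi_one: "\<And>x. x \<in> ball 0 2 - ball 0 (2/3) \<Longrightarrow> \<phi> x = 1"
    and phi_zero: "\<And>x. x \<in> ball 0 (1/2) \<union> - ball 0 3 \<Longrightarrow> \<phi> x = 0"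
    and "x0 \<noteq> 0"
    and alpha_def: "\<alpha> = (\<lambda>t \<omega>. - f (X t \<omega>) + \<bar>norm (X t \<omega>) - 1\<bar> *\<^sub>R ort (X t \<omega>))"
    and beta_def: "\<beta> = (\<lambda>t \<omega>. (1 / (t + 1) * \<phi> (X t \<omega>)) *\<^sub>R mat 1)"
    and solution: "is_ito_process M \<F> W x0 \<alpha> \<beta> X"
  shows "lojasiewicz_function potential \<and>
    measure M (event_C M f X \<alpha> \<beta> \<inter> event_L M X) = 1 \<and>
    (AE \<omega> in M. \<nexists>l. ((\<lambda>t. X t \<omega>) \<longlongrightarrow> l) at_top)"
proof -
  have f: "f = fgrad" by (simp add: f_def grad_potential)
  have \<alpha>: "\<alpha> = (\<lambda>t \<omega>. drift (X t \<omega>))" by (simp add: alpha_def f drift_def)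
  obtain I where I: "is_ito_integral M \<F> W \<beta> I"
    and eq: "AE \<omega> in M. \<forall>t\<ge>0. set_integrable lborel {0..t} (\<lambda>s. \<alpha> s \<omega>) \<and>
        X t \<omega> = x0 + (LINT s:{0..t}|lborel. \<alpha> s \<omega>) + I t \<omega>"
    using solution unfolding is_ito_process_def by blast
  interpret usual_filtered_prob_space M \<F> by fact
  interpret spiral_sde M \<F> W X I \<phi> x0
  proof
    show "is_ito_integral M \<F> W (\<lambda>t \<omega>. (1 / (t + 1) * \<phi> (X t \<omega>)) *\<^sub>R mat 1) I"
      using I by (simp add: beta_def)
    show "AE \<omega> in M. \<forall>t\<ge>0. X t \<omega> = x0 + (LINT s:{0..t}|lborel. drift (X s \<omega>)) + I t \<omega>"
      using eq by eventually_elim (simp add: \<alpha>)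
    show "adapted \<F> X" "continuous_paths M X"
      using solution by (auto simp: is_ito_process_def)
  qed fact+
  show ?thesis
    using lojasiewicz_potential prob_events AE_not_convergent unfolding f \<alpha> beta_def by blast
qed

end
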